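(* Let $p\in P^{Log}$, $k\in\mathbb{N}$, and let $D_{\sigma,k}$ be the Bernstein singular integral formed with $r:=\lceil\frac12(k+2)\rceil$. There is a constant $C>0$ depending only on $k$ and $p(\cdot)$ such that for every $\sigma>0$ and every $f\in L^{p(\cdot)}$, $$\|f-D_{\sigma,k}f\|_{p(\cdot)}\le C\,\Omega_k\Big(f,\frac1\sigma\Big)_{p(\cdot)}.$$
   Context: $P$ is the class of measurable functions $p:\mathbb{R}\to[1,\infty)$ with $1\le \operatorname{ess\,inf}_{x\in\mathbb{R}}p(x)$ and $\operatorname{ess\,sup}_{x\in\mathbb{R}}p(x)<\infty$. $P^{Log}$ is the class of $p\in P$ for which there exist constants $c_1,c_2>0$ and $c_3\in\mathbb{R}$ with $|p(x)-p(y)|\ln(e+1/|x-y|)\le c_1$ for all $x,y\in\mathbb{R}$ and $|p(x)-c_3|\ln(e+|x|)\le c_2$ for all $x\in\mathbb{R}$. For $p\in P$, $L^{p(\cdot)}=L^{p(\cdot)}(\mathbb{R})$ is the Banach space of measurable $f:\mathbb{R}\to\mathbb{C}$ with $I_{p(\cdot)}(f/\lambda):=\int_{\mathbb{R}}|f(y)/\lambda|^{p(y)}dy<\infty$ for some $\lambda>0$, with norm $\|f\|_{p(\cdot)}=\inf\{\eta>0: I_{p(\cdot)}(f/\eta)<1\}$. $\mathbb{N}=\{1,2,\dots\}$. For $r,k\in\mathbb{N}$ with $r\ge\frac12(k+2)$ and $\sigma>0$ put $g(\sigma,r,x)=\left(\frac1x\sin\frac{\sigma x}{2r}\right)^{2r}$,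 $G(\sigma,r,k,\zeta)=\sum_{v=1}^k(-1)^{k-v}\frac1v\binom kv g\left(\sigma,r,\frac{\zeta}{v}\right)$, $\gamma_{r,\sigma}=\int_{\mathbb{R}}\left(\frac1t\sin\frac{\sigma t}{2r}\right)^{2r}dt$. The Bernstein singular integral is $D_{\sigma,k}f(x):=\frac{(-1)^{k+1}}{\gamma_{r,\sigma}}\int_{\mathbb{R}}f(u)\,G(\sigma,r,k,u-x)\,du$ for measurable complex-valued $f$ with $\int_{\mathbb{R}}\frac{|f(u)|}{1+u^{2r}}du<\infty$. Here $\lceil a\rceil=\min\{n\in\mathbb{N}:n\ge a\}$. For $\delta>0$, $T_\delta f(x):=\frac1\delta\int_0^\delta f(x+t)\,dt$, $I$ is the identity operator, and $\Omega_k(f,\delta)_{p(\cdot)}:=\|(I-T_\delta)^kf\|_{p(\cdot)}$. *)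

theory Defs
  imports "HOL-Analysis.Analysis" "HOL-Probability.Essential_Supremum"
begin

text \<open>
  Measurability and integrals on the real line are with respect to the completed Lebesgue
  measure \<open>lebesgue\<close>. Elements of \<open>L\<^sup>p\<^sup>(\<^sup>.\<^sup>)\<close> are represented by functions; all operators
  below respect equality almost everywhere.
\<close>

definition essinf :: "'a measure \<Rightarrow> ('a \<Rightarrow> ereal) \<Rightarrow> ereal" where
  "essinf M f = - esssup M (\<lambda>x. - f x)"

definition exponent_class :: "(real \<Rightarrow> real) set" where
  "exponent_class =
     {p \<in> borel_measurable lebesgue.
        (\<forall>x. 1 \<le> p x) \<and>
        1 \<le> essinf lebesgue (\<lambda>x. ereal (p x)) \<and>
        esssup lebesgue (\<lambda>x. ereal (p x)) < \<infinity>}"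

text \<open>For \<open>x = y\<close> the first inequality reads \<open>0 \<le> c\<^sub>1\<close>, whatever the value of \<open>1 / 0\<close>.\<close>

definition log_exponent_class :: "(real \<Rightarrow> real) set" where
  "log_exponent_class =
     {p \<in> exponent_class. \<exists>c\<^sub>1>0. \<exists>c\<^sub>2>0. \<exists>c\<^sub>3.
        (\<forall>x y. \<bar>p x - p y\<bar> * ln (exp 1 + 1 / \<bar>x - y\<bar>) \<le> c\<^sub>1) \<and>
        (\<forall>x. \<bar>p x - c\<^sub>3\<bar> * ln (exp 1 + \<bar>x\<bar>) \<le> c\<^sub>2)}"

definition modular :: "(real \<Rightarrow> real) \<Rightarrow> (real \<Rightarrow> complex) \<Rightarrow> ennreal" where
  "modular p f = (\<integral>\<^sup>+ y. ennreal (norm (f y) powr p y) \<partial>lebesgue)"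

definition Lp_var :: "(real \<Rightarrow> real) \<Rightarrow> (real \<Rightarrow> complex) set" where
  "Lp_var p =
     {f \<in> borel_measurable lebesgue. \<exists>\<mu>>0. modular p (\<lambda>y. f y / complex_of_real \<mu>) < \<infinity>}"

text \<open>
  Meaningful on \<^term>\<open>Lp_var p\<close> only: outside, the set may be empty, and the infimum of the
  empty set of reals is an unspecified number.
\<close>

definition norm_var :: "(real \<Rightarrow> real) \<Rightarrow> (real \<Rightarrow> complex) \<Rightarrow> real" where
  "norm_var p f = Inf {\<eta>. 0 < \<eta> \<and> modular p (\<lambda>y. f y / complex_of_real \<eta>) < 1}"

text \<open>At \<open>x = 0\<close> this is \<open>0\<close> instead of the limit; this single point does not affect the integrals.\<close>

definition bernstein_g :: "real \<Rightarrow> nat \<Rightarrow> real \<Rightarrow> real" where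
  "bernstein_g \<sigma> r x = (1 / x * sin (\<sigma> * x / (2 * real r))) ^ (2 * r)"

definition bernstein_G :: "real \<Rightarrow> nat \<Rightarrow> nat \<Rightarrow> real \<Rightarrow> real" where
  "bernstein_G \<sigma> r k \<zeta> =
     (\<Sum>v = 1..k. (- 1) ^ (k - v) * (1 / real v) * real (k choose v) * bernstein_g \<sigma> r (\<zeta> / real v))"

definition bernstein_gamma :: "nat \<Rightarrow> real \<Rightarrow> real" where
  "bernstein_gamma r \<sigma> = (LINT t|lebesgue. (1 / t * sin (\<sigma> * t / (2 * real r))) ^ (2 * r))"

text \<open>
  Used for \<open>r \<ge> (k + 2) / 2\<close> and functions \<open>f\<close> such that \<open>\<bar>f u\<bar> / (1 + u\<^sup>2\<^sup>r)\<close> is integrable;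
  then the integrand is integrable for every \<open>x\<close>.
\<close>

definition bernstein_D :: "nat \<Rightarrow> real \<Rightarrow> nat \<Rightarrow> (real \<Rightarrow> complex) \<Rightarrow> real \<Rightarrow> complex" where
  "bernstein_D r \<sigma> k f x =
     complex_of_real ((- 1) ^ (k + 1) / bernstein_gamma r \<sigma>) *
     (LINT u|lebesgue. f u * complex_of_real (bernstein_G \<sigma> r k (u - x)))"

definition steklov :: "real \<Rightarrow> (real \<Rightarrow> complex) \<Rightarrow> real \<Rightarrow> complex" where
  "steklov \<delta> f x = complex_of_real (1 / \<delta>) * (LINT t:{0..\<delta>}|lebesgue. f (x + t))"

definition Omega_var :: "(real \<Rightarrow> real) \<Rightarrow> nat \<Rightarrow> (real \<Rightarrow> complex) \<Rightarrow> real \<Rightarrow> real" where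
  "Omega_var p k f \<delta> = norm_var p (((\<lambda>h x. h x - steklov \<delta> h x) ^^ k) f)"

end

theory Submission
  imports Defs "HOL-Probability.Probability_Mass_Function" "HOL-Real_Asymp.Real_Asymp"
begin

text \<open>
  Write T for the Steklov mean. Dilating the line, one may take its step and \<open>\<sigma>\<close>
  to be 1 as long as the estimates are pointwise; the exponent enters only at the end. The operator is
  built so that the error is, up to sign, the average of the k-th difference of f with step t against
  the normalised kernel g (\<open>bernstein_D_representation\<close>). Translations are not bounded on
  spaces with variable exponent, so these differences must be compared with
  \<open>\<phi> = (I - T) ^ k f\<close> by means of averaging kernels.

  This is done by inverting \<open>I - T\<close>. The formal sum of the powers of T is I plus
  convolution with the renewal density u of the uniform distribution on \<open>[0, 1]\<close>, which
  solves \<open>u t = 1 + \<integral> u\<close> for t in \<open>[0, 1)\<close> and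
  \<open>u t = \<integral> u\<close> for \<open>t \<ge> 1\<close>, with integrals over
  \<open>[t - 1, t]\<close>. Thus u is an average of its own past, and its oscillation contracts
  geometrically (\<open>self_averaging_contract\<close>): u converges exponentially fast to a
  constant. Although u is not integrable, \<open>u (s - t) - u s\<close> is, and it gives the
  identity
  \<open>f (x + t) - f x = h (x + t) - h x + \<integral> (u (s - t) - u s) * h (x + s) ds\<close>
  with \<open>h = (I - T) f\<close> (\<open>shift_difference_identity\<close>). Iterating it k
  times bounds the k-th difference by translates of \<open>\<bar>\<phi>\<bar>\<close> and by an
  average of \<open>\<bar>\<phi>\<bar>\<close> at length scale \<open>1 + \<bar>t\<bar>\<close>,
  with a factor of order \<open>(1 + \<bar>t\<bar>) ^ k\<close>. As
  \<open>2 * r \<ge> k + 2\<close>, the kernel g decays fast enough to integrate this in t, and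
  the error is bounded at every point by a multiple of \<open>\<bar>\<phi>\<bar>\<close> plus the
  convolution of \<open>\<bar>\<phi>\<bar>\<close> with the kernel
  \<open>(1 + \<bar>s\<bar>) powr (-3/2)\<close> dilated to the length
  \<open>1 / \<sigma>\<close> (\<open>bernstein_D_pointwise_bound\<close>).

  It remains to bound that convolution uniformly in its scale (\<open>norm_var_bound\<close>). The
  kernel is dominated by a mixture of uniform distributions on centred intervals. For averages over
  one interval the log-Hoelder conditions give a pointwise bound of the modular density
  (\<open>average_powr_le\<close>): where the function exceeds 1 the local condition allows the
  exponent to be frozen at its infimum over the interval, and elsewhere the decay condition allows it
  to be replaced by its limit at infinity. Jensen's inequality combines the intervals of the mixture.
\<close>

section \<open>A decay kernel and its means\<close>

abbreviation ennorm :: "(real \<Rightarrow> complex) \<Rightarrow> real \<Rightarrow> ennreal" where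
  "ennorm f \<equiv> \<lambda>y. ennreal (norm (f y))"

text \<open>
  The exponent has to exceed 1 for integrability. It is kept below 2 because the moment of the
  Bernstein kernel that is finally needed costs the power of the dilation factor that equals this
  exponent minus 1: with decay 2 the case of even k would lead to a logarithmically divergent
  integral.
\<close>
definition decay_kernel :: "real \<Rightarrow> real" where
  "decay_kernel s = (1 + \<bar>s\<bar>) powr (-3/2)"

lemma decay_kernel_nonneg [simp]: "0 \<le> decay_kernel s"
  by (simp add: decay_kernel_def)

lemma decay_kernel_le_1: "decay_kernel s \<le> 1"
  using powr_mono2'[of "-3/2" 1 "1 + \<bar>s\<bar>"] by (simp add: decay_kernel_def)

lemma decay_kernel_borel [measurable]: "decay_kernel \<in> borel_measurable borel"
  unfolding decay_kernel_def[abs_def] by measurable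

text \<open>
  A comparison of arguments up to a factor is a comparison of values up to a power of that factor.
  This one principle covers translations and dilations of the kernel alike.
\<close>
lemma decay_kernel_comparison:
  assumes c: "0 < c" and le: "1 + \<bar>s\<bar> \<le> c * (1 + \<bar>t\<bar>)"
  shows "decay_kernel t \<le> c powr (3/2) * decay_kernel s"
proof -
  have "decay_kernel t = c powr (3/2) * (c * (1 + \<bar>t\<bar>)) powr (-3/2)"
    using c powr_add[of c "3/2" "-3/2"] by (simp add: decay_kernel_def powr_mult mult.assoc[symmetric])
  also have "(c * (1 + \<bar>t\<bar>)) powr (-3/2) \<le> (1 + \<bar>s\<bar>) powr (-3/2)"
    by (rule powr_mono2') (use le in auto)
  finally show ?thesis using c by (simp add: decay_kernel_def mult_left_mono)
qed

lemma decay_kernel_antimono: "\<bar>s\<bar> \<le> \<bar>t\<bar> \<Longrightarrow> decay_kernel t \<le> decay_kernel s"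
  using decay_kernel_comparison[of 1 s t] by simp

lemma decay_kernel_integral_finite: "(\<integral>\<^sup>+s. ennreal (decay_kernel s) \<partial>lborel) < \<infinity>"
proof -
  let ?F = "\<lambda>s::real. - 2 * (1 + s) powr (-1/2)"
  have "(\<integral>\<^sup>+s. ennreal (decay_kernel s) * indicator {0..} s \<partial>lborel) = ennreal (0 - ?F 0)"
  proof (rule nn_integral_FTC_atLeast)
    show "DERIV ?F s :> decay_kernel s" if "0 \<le> s" for s
      using that by (auto intro!: derivative_eq_intros simp: decay_kernel_def)
    show "(?F \<longlongrightarrow> 0) at_top" by real_asymp
  qed auto
  then have half: "(\<integral>\<^sup>+s. ennreal (decay_kernel s) * indicator {0..} s \<partial>lborel) < \<infinity>" by simp
  have "(\<integral>\<^sup>+s. ennreal (decay_kernel s) * indicator {..0} s \<partial>lborel) =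
      ennreal \<bar>-1\<bar> * (\<integral>\<^sup>+s. ennreal (decay_kernel (0 + (-1) * s)) * indicator {..0} (0 + (-1) * s) \<partial>lborel)"
    by (rule nn_integral_real_affine) auto
  also have "\<dots> = (\<integral>\<^sup>+s. ennreal (decay_kernel s) * indicator {0..} s \<partial>lborel)"
    by (simp add: decay_kernel_def indicator_def cong: if_cong)
  finally have half': "(\<integral>\<^sup>+s. ennreal (decay_kernel s) * indicator {..0} s \<partial>lborel) < \<infinity>" using half by simp
  have "(\<integral>\<^sup>+s. ennreal (decay_kernel s) \<partial>lborel) \<le>
     (\<integral>\<^sup>+s. ennreal (decay_kernel s) * indicator {0..} s + ennreal (decay_kernel s) * indicator {..0} s \<partial>lborel)"
    by (rule nn_integral_mono) (auto simp: indicator_def)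
  also have "\<dots> = (\<integral>\<^sup>+s. ennreal (decay_kernel s) * indicator {0..} s \<partial>lborel) + (\<integral>\<^sup>+s. ennreal (decay_kernel s) * indicator {..0} s \<partial>lborel)"
    by (rule nn_integral_add) auto
  also have "\<dots> < \<infinity>" using half half' by simp
  finally show ?thesis .
qed

text \<open>
  Convolution with the decay kernel, dilated by R and normalised so that its mass does not depend on
  R. It is not divided by that mass, so a constant function is multiplied by
  \<open>kernel_mass\<close> below.
\<close>
definition kernel_mean :: "real \<Rightarrow> (real \<Rightarrow> ennreal) \<Rightarrow> real \<Rightarrow> ennreal" where
  "kernel_mean R F x = (\<integral>\<^sup>+s. ennreal (decay_kernel (s / R) / R) * F (x + s) \<partial>lborel)"

lemma kernel_mean_borel [measurable]:
  assumes [measurable]: "F \<in> borel_measurable borel"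
  shows "kernel_mean R F \<in> borel_measurable borel"
  unfolding kernel_mean_def[abs_def] by measurable

lemma kernel_mean_mono: "(\<And>y. F y \<le> G y) \<Longrightarrow> kernel_mean R F x \<le> kernel_mean R G x"
  unfolding kernel_mean_def by (intro nn_integral_mono mult_left_mono) auto

lemma kernel_mean_eq_conv:
  assumes [measurable]: "F \<in> borel_measurable borel"
  shows "kernel_mean R F x = (\<integral>\<^sup>+y. ennreal (decay_kernel ((y - x) / R) / R) * F y \<partial>lborel)"
  using nn_integral_real_affine[of "\<lambda>y. ennreal (decay_kernel ((y - x) / R) / R) * F y" 1 x]
  by (simp add: kernel_mean_def)

lemma kernel_mean_shift:
  assumes [measurable]: "F \<in> borel_measurable borel" and R: "0 < R" and a: "\<bar>a\<bar> \<le> b * R"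
  shows "kernel_mean R F (x + a) \<le> ennreal ((1 + b) powr (3/2)) * kernel_mean R F x"
proof -
  have b: "0 \<le> b"   proof -
    have "0 \<le> b * R" using a by linarith
    then show ?thesis using R by (simp add: zero_le_mult_iff)
  qed
  have *: "decay_kernel ((y - (x + a)) / R) \<le> (1 + b) powr (3/2) * decay_kernel ((y - x) / R)" for y
  proof (rule decay_kernel_comparison)
    have "\<bar>(y - x) / R\<bar> \<le> \<bar>(y - (x + a)) / R\<bar> + \<bar>a / R\<bar>"
      by (rule order_trans[OF _ abs_triangle_ineq]) (simp add: add_divide_distrib[symmetric])
    also have "\<bar>a / R\<bar> \<le> b" using a R by (simp add: abs_divide pos_divide_le_eq)
    finally have w: "\<bar>(y - x) / R\<bar> \<le> \<bar>(y - (x + a)) / R\<bar> + b" by simp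
    have "0 \<le> b * \<bar>(y - (x + a)) / R\<bar>" using b by simp
    moreover have "(1 + b) * (1 + \<bar>(y - (x + a)) / R\<bar>) = 1 + \<bar>(y - (x + a)) / R\<bar> + b + b * \<bar>(y - (x + a)) / R\<bar>"
      by (simp only: distrib_left distrib_right mult_1 mult_1_right add_ac)
    ultimately show "1 + \<bar>(y - x) / R\<bar> \<le> (1 + b) * (1 + \<bar>(y - (x + a)) / R\<bar>)"
      using w by linarith
  qed (use b in auto)
  have "kernel_mean R F (x + a) \<le> (\<integral>\<^sup>+y. ennreal ((1 + b) powr (3/2)) * (ennreal (decay_kernel ((y - x) / R) / R) * F y) \<partial>lborel)"
    unfolding kernel_mean_eq_conv[OF assms(1)]
  proof (rule nn_integral_mono)
    fix y
    have "ennreal (decay_kernel ((y - (x + a)) / R) / R) \<le> ennreal ((1 + b) powr (3/2)) * ennreal (decay_kernel ((y - x) / R) / R)"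
      using divide_right_mono[OF *[of y], of R] R by (simp add: ennreal_mult[symmetric] ennreal_leI)
    from mult_right_mono[OF this, of "F y"]
    show "ennreal (decay_kernel ((y - (x + a)) / R) / R) * F y \<le> ennreal ((1 + b) powr (3/2)) * (ennreal (decay_kernel ((y - x) / R) / R) * F y)"
      by (simp add: mult.assoc)
  qed
  also have "\<dots> = ennreal ((1 + b) powr (3/2)) * kernel_mean R F x"
    unfolding kernel_mean_eq_conv[OF assms(1)] by (rule nn_integral_cmult) auto
  finally show ?thesis .
qed

definition kernel_mass :: real where
  "kernel_mass = enn2real (\<integral>\<^sup>+s. ennreal (decay_kernel s) \<partial>lborel)"

lemma kernel_mass: "(\<integral>\<^sup>+s. ennreal (decay_kernel s) \<partial>lborel) = ennreal kernel_mass" "0 \<le> kernel_mass"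
  using decay_kernel_integral_finite by (auto simp: kernel_mass_def)

lemma scaled_kernel_mass:
  assumes "0 < R" shows "(\<integral>\<^sup>+s. ennreal (decay_kernel (s / R) / R) \<partial>lborel) = ennreal kernel_mass"
proof -
  have "(\<integral>\<^sup>+s. ennreal (decay_kernel (s / R) / R) \<partial>lborel) =
     ennreal \<bar>R\<bar> * (\<integral>\<^sup>+s. ennreal (decay_kernel ((0 + R * s) / R) / R) \<partial>lborel)"
    by (rule nn_integral_real_affine) (use assms in auto)
  also have "\<dots> = (\<integral>\<^sup>+s. ennreal R * ennreal (decay_kernel s / R) \<partial>lborel)"
    using assms by (simp add: nn_integral_cmult)
  also have "\<dots> = (\<integral>\<^sup>+s. ennreal (decay_kernel s) \<partial>lborel)"
    using assms by (simp add: ennreal_mult[symmetric])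
  finally show ?thesis by (simp add: kernel_mass)
qed

text \<open>
  One of the two arguments is at least half as large as their sum, so its kernel value is comparable
  to that at the sum. Integrated, this says that the convolution of the kernel with itself is bounded
  by a multiple of the kernel.
\<close>
lemma decay_kernel_conv:
  "decay_kernel a * decay_kernel b \<le> 2 powr (3/2) * decay_kernel (a + b) * (decay_kernel a + decay_kernel b)"
proof -
  have half: "decay_kernel c \<le> 2 powr (3/2) * decay_kernel (a + b)" if "\<bar>a + b\<bar> \<le> 2 * \<bar>c\<bar>" for c
    by (rule decay_kernel_comparison) (use that in auto)
  consider "\<bar>a + b\<bar> \<le> 2 * \<bar>a\<bar>" | "\<bar>a + b\<bar> \<le> 2 * \<bar>b\<bar>" by linarith
  then show ?thesis
  proof cases
    case 1
    have "decay_kernel a * decay_kernel b \<le> (2 powr (3/2) * decay_kernel (a + b)) * decay_kernel b"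
      by (rule mult_right_mono[OF half[OF 1]]) simp
    then show ?thesis by (simp add: distrib_left add_increasing)
  next
    case 2
    have "decay_kernel a * decay_kernel b \<le> 2 powr (3/2) * decay_kernel (a + b) * decay_kernel a"
      using mult_left_mono[OF half[OF 2], of "decay_kernel a"] by (simp add: mult_ac)
    then show ?thesis by (simp add: distrib_left add_increasing2)
  qed
qed

definition conv_const :: real where "conv_const = 2 powr (3/2) * (2 * kernel_mass)"

lemma conv_const_nonneg: "0 \<le> conv_const"
  using kernel_mass by (simp add: conv_const_def)

lemma kernel_mean_iterate:
  assumes [measurable]: "F \<in> borel_measurable borel" and R: "0 < R"
  shows "kernel_mean R (kernel_mean R F) x \<le> ennreal conv_const * kernel_mean R F x"
proof -
  let ?k = "\<lambda>s. ennreal (decay_kernel (s / R) / R)"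
  have conv: "(\<integral>\<^sup>+s. ?k (s - x) * ?k (y - s) \<partial>lborel) \<le> ennreal conv_const * ?k (y - x)" for y
  proof -
    have "(\<integral>\<^sup>+s. ?k (s - x) * ?k (y - s) \<partial>lborel) \<le> (\<integral>\<^sup>+s. ennreal (2 powr (3/2)) * ?k (y - x) * (?k (s - x) + ?k (y - s)) \<partial>lborel)"
    proof (rule nn_integral_mono)
      fix s
      let ?a = "(s - x) / R" and ?b = "(y - s) / R"
      have ab: "?a + ?b = (y - x) / R" by (simp add: add_divide_distrib[symmetric])
      have "decay_kernel ?a / R * (decay_kernel ?b / R) = (decay_kernel ?a * decay_kernel ?b) / (R * R)" by simp
      also have "\<dots> \<le> (2 powr (3/2) * decay_kernel (?a + ?b) * (decay_kernel ?a + decay_kernel ?b)) / (R * R)"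
        by (rule divide_right_mono[OF decay_kernel_conv]) (use R in simp)
      also have "\<dots> = 2 powr (3/2) * (decay_kernel ((y - x) / R) / R) * (decay_kernel ?a / R + decay_kernel ?b / R)"
        unfolding ab using R by (simp add: field_simps)
      finally show "?k (s - x) * ?k (y - s) \<le> ennreal (2 powr (3/2)) * ?k (y - x) * (?k (s - x) + ?k (y - s))"
        using R by (simp add: ennreal_mult[symmetric] ennreal_plus[symmetric] ennreal_leI del: ennreal_plus)
    qed
    also have "\<dots> = ennreal (2 powr (3/2)) * ?k (y - x) * ((\<integral>\<^sup>+s. ?k (s - x) \<partial>lborel) + (\<integral>\<^sup>+s. ?k (y - s) \<partial>lborel))"
      by (simp add: nn_integral_cmult nn_integral_add)
    also have "(\<integral>\<^sup>+s. ?k (s - x) \<partial>lborel) = ennreal kernel_mass"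
      using nn_integral_real_affine[of ?k 1 "-x"] scaled_kernel_mass[OF R] by simp
    also have "(\<integral>\<^sup>+s. ?k (y - s) \<partial>lborel) = ennreal kernel_mass"
      using nn_integral_real_affine[of ?k "-1" y] scaled_kernel_mass[OF R] by simp
    also have "ennreal (2 powr (3/2)) * ?k (y - x) * (ennreal kernel_mass + ennreal kernel_mass) = ennreal conv_const * ?k (y - x)"
      using kernel_mass R by (simp add: conv_const_def ennreal_mult[symmetric] ennreal_plus[symmetric] mult_ac del: ennreal_plus)
    finally show ?thesis .
  qed
  have "kernel_mean R (kernel_mean R F) x = (\<integral>\<^sup>+s. ?k (s - x) * (\<integral>\<^sup>+y. ?k (y - s) * F y \<partial>lborel) \<partial>lborel)"
    by (subst kernel_mean_eq_conv) (simp_all add: kernel_mean_eq_conv)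
  also have "\<dots> = (\<integral>\<^sup>+s. (\<integral>\<^sup>+y. ?k (s - x) * ?k (y - s) * F y \<partial>lborel) \<partial>lborel)"
    by (simp add: nn_integral_cmult mult.assoc)
  also have "\<dots> = (\<integral>\<^sup>+y. (\<integral>\<^sup>+s. ?k (s - x) * ?k (y - s) * F y \<partial>lborel) \<partial>lborel)"
    by (rule lborel_pair.Fubini') measurable
  also have "\<dots> = (\<integral>\<^sup>+y. (\<integral>\<^sup>+s. ?k (s - x) * ?k (y - s) \<partial>lborel) * F y \<partial>lborel)"
    by (simp add: nn_integral_multc)
  also have "\<dots> \<le> (\<integral>\<^sup>+y. ennreal conv_const * ?k (y - x) * F y \<partial>lborel)"
    by (intro nn_integral_mono mult_right_mono conv) auto
  also have "\<dots> = ennreal conv_const * kernel_mean R F x"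
    by (simp add: nn_integral_cmult kernel_mean_eq_conv mult.assoc)
  finally show ?thesis .
qed

lemma kernel_mean_le_unit_scale:
  assumes [measurable]: "F \<in> borel_measurable borel" and R: "1 \<le> R"
  shows "kernel_mean R F x \<le> ennreal (R powr (1/2)) * kernel_mean 1 F x"
proof -
  have "kernel_mean R F x \<le> (\<integral>\<^sup>+s. ennreal (R powr (1/2)) * (ennreal (decay_kernel (s / 1) / 1) * F (x + s)) \<partial>lborel)"
    unfolding kernel_mean_def
  proof (rule nn_integral_mono)
    fix s
    have "decay_kernel (s / R) \<le> R powr (3/2) * decay_kernel s"
      by (rule decay_kernel_comparison) (use R in \<open>auto simp: distrib_left abs_divide\<close>)
    then have "decay_kernel (s / R) / R \<le> R powr (3/2) * decay_kernel s / R" using R by (intro divide_right_mono) auto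
    also have "\<dots> = R powr (1/2) * decay_kernel s"
      using R powr_diff[of R "3/2" 1] by simp
    finally have "ennreal (decay_kernel (s / R) / R) \<le> ennreal (R powr (1/2)) * ennreal (decay_kernel (s / 1) / 1)"
      by (simp add: ennreal_mult[symmetric] ennreal_leI)
    from mult_right_mono[OF this, of "F (x + s)"]
    show "ennreal (decay_kernel (s / R) / R) * F (x + s) \<le> ennreal (R powr (1/2)) * (ennreal (decay_kernel (s / 1) / 1) * F (x + s))"
      by (simp add: mult.assoc)
  qed
  also have "\<dots> = ennreal (R powr (1/2)) * kernel_mean 1 F x"
    unfolding kernel_mean_def by (rule nn_integral_cmult) auto
  finally show ?thesis .
qed

section \<open>The renewal density of the uniform distribution\<close>

text \<open>
  The expected number of partial sums in \<open>[0, t]\<close>, starting with the empty sum, of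
  independent variables that are uniform on \<open>[0, 1]\<close>. It solves the delay equation
  \<open>a' (t) = a t - a (t - 1)\<close> with \<open>a 0 = 1\<close> and
  \<open>a = 0\<close> on the negative half-line, and the sum is what stepwise integration of that
  equation produces.
\<close>
definition renewal_count :: "real \<Rightarrow> real" where
  "renewal_count t = (\<Sum>j | real j \<le> t. (real j - t) ^ j * exp (t - real j) / fact j)"

text \<open>
  By the delay equation this difference is the derivative of the renewal function at positive t other
  than 1.
\<close>
definition renewal_density :: "real \<Rightarrow> real" where
  "renewal_density t = renewal_count t - renewal_count (t - 1)"

lemma renewal_count_eq_sum:
  assumes "t \<le> real N"
  shows "renewal_count t = (\<Sum>j\<le>N. if real j \<le> t then (real j - t) ^ j * exp (t - real j) / fact j else 0)"
proof -
  have "{j. real j \<le> t} \<subseteq> {..N}" using assms by auto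
  then show ?thesis unfolding renewal_count_def
    by (intro sum.mono_neutral_cong_left) auto
qed

lemma renewal_count_neg: "t < 0 \<Longrightarrow> renewal_count t = 0"
  unfolding renewal_count_def by (rule sum.neutral) auto

lemma renewal_count_0: "renewal_count 0 = 1"
proof -
  have "{j. real j \<le> 0} = {0}" by auto
  then show ?thesis by (simp add: renewal_count_def)
qed

lemma renewal_count_continuous: "continuous_on {0..} renewal_count"
proof -
  have *: "continuous_on {0..real N} renewal_count" for N
  proof -
    have "continuous_on {0..real N} (\<lambda>t. if t \<le> real j then 0 else (real j - t) ^ j * exp (t - real j) / fact j :: real)" if "j > 0" for j
      by (rule continuous_on_cases_le) (use that in \<open>auto intro!: continuous_intros\<close>)
    moreover have "(if t \<le> real j then 0 else (real j - t) ^ j * exp (t - real j) / fact j) =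
      (if real j \<le> t then (real j - t) ^ j * exp (t - real j) / fact j else 0 :: real)" if "j > 0" for j t
      using that by auto
    ultimately have "continuous_on {0..real N} (\<lambda>t. if real j \<le> t then (real j - t) ^ j * exp (t - real j) / fact j else 0 :: real)" if "j > 0" for j
      using that by simp
    moreover have "continuous_on {0..real N} (\<lambda>t. if real 0 \<le> t then (real 0 - t) ^ 0 * exp (t - real 0) / fact 0 else 0 :: real)"
      by (rule continuous_on_eq[of _ exp]) (auto intro!: continuous_intros)
    ultimately have "continuous_on {0..real N} (\<lambda>t. if real j \<le> t then (real j - t) ^ j * exp (t - real j) / fact j else 0 :: real)" for j
      by (cases "j = 0") auto
    then have "continuous_on {0..real N} (\<lambda>t. \<Sum>j\<le>N. if real j \<le> t then (real j - t) ^ j * exp (t - real j) / fact j else 0 :: real)"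
      by (intro continuous_on_sum) auto
    then show ?thesis
      by (rule continuous_on_eq) (simp add: renewal_count_eq_sum[where N = N])
  qed
  show ?thesis
    unfolding continuous_on_eq_continuous_within
  proof
    fix x :: real assume x: "x \<in> {0..}"
    obtain N where N: "x < real N" using reals_Archimedean2 by blast
    have "continuous (at x within {0..real N}) renewal_count"
      using *[of N] x N by (auto simp: continuous_on_eq_continuous_within)
    moreover have "at x within {0..real N} = at x within {0..}"
      by (rule at_within_nhd[of _ "{..<real N}"]) (use N in auto)
    ultimately show "continuous (at x within {0..}) renewal_count" by simp
  qed
qed

text \<open>
  Differentiating the summand with index \<open>Suc j\<close> reproduces it and subtracts the summand
  with index j at \<open>t - 1\<close>. Integer points are left out because a new summand starts
  there; the kink at 1 is real.
\<close>
lemma renewal_count_deriv: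
  assumes t: "t > 0" "t \<notin> \<nat>"
  shows "(renewal_count has_real_derivative renewal_density t) (at t)"
proof -
  define N where "N = nat \<lfloor>t\<rfloor>"
  have N: "real N < t" "t < real N + 1"
  proof -
    have "real N \<le> t" unfolding N_def using t by simp
    moreover have "real N \<noteq> t" using t(2) by (metis of_nat_in_Nats)
    ultimately show "real N < t" by simp
    show "t < real N + 1" unfolding N_def using t by linarith
  qed
  let ?b = "\<lambda>j t. (real j - t) ^ j * exp (t - real j) / fact j :: real"
  have eq: "renewal_count s = (\<Sum>j\<le>N. ?b j s)" if "s \<in> {real N<..<real N + 1}" for s
  proof -
    have "{j. real j \<le> s} = {..N}" using that by auto
    then show ?thesis by (simp add: renewal_count_def)
  qed
  have eq1: "renewal_count (t - 1) = (\<Sum>j<N. ?b j (t - 1))"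
  proof -
    have "{j. real j \<le> t - 1} = {..<N}" using N by auto
    then show ?thesis by (simp add: renewal_count_def)
  qed
  have d: "(?b (Suc j) has_real_derivative ?b (Suc j) t - ?b j (t - 1)) (at t)" for j
  proof -
    have "(?b (Suc j) has_real_derivative
       (- (real (Suc j) * (real (Suc j) - t) ^ j) * exp (t - real (Suc j)) + (real (Suc j) - t) ^ Suc j * exp (t - real (Suc j))) / fact (Suc j)) (at t)"
      by (rule derivative_eq_intros refl | simp del: of_nat_Suc power_Suc)+
    moreover have "(- (real (Suc j) * (real (Suc j) - t) ^ j) * exp (t - real (Suc j)) + (real (Suc j) - t) ^ Suc j * exp (t - real (Suc j))) / fact (Suc j)
       = ?b (Suc j) t - ?b j (t - 1)"
    proof -
      have e: "real j - (t - 1) = real (Suc j) - t" "t - 1 - real j = t - real (Suc j)" by auto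
      show ?thesis unfolding e fact_Suc by (simp add: field_simps del: of_nat_Suc)
    qed
    ultimately show ?thesis by simp
  qed
  have d0: "(?b 0 has_real_derivative ?b 0 t) (at t)"
    by (auto intro!: derivative_eq_intros)
  have "((\<lambda>s. \<Sum>j\<le>N. ?b j s) has_real_derivative (\<Sum>j\<le>N. ?b j t) - (\<Sum>j<N. ?b j (t - 1))) (at t)"
  proof (induction N)
    case 0 show ?case using d0 by simp
  next
    case (Suc n)
    from DERIV_add[OF Suc d[of n]] show ?case by (simp add: algebra_simps)
  qed
  then have "((\<lambda>s. \<Sum>j\<le>N. ?b j s) has_real_derivative renewal_density t) (at t)"
    using eq[of t] eq1 N by (simp add: renewal_density_def)
  then show ?thesis
    by (rule DERIV_cong_ev[THEN iffD1, rotated -1])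
       (use N eq in \<open>auto intro!: eventually_nhds_in_open[of "{real N<..<real N + 1}", THEN eventually_mono]\<close>)
qed

lemma renewal_density_has_integral:
  assumes "0 \<le> c" "c \<le> d"
  shows "(renewal_density has_integral renewal_count d - renewal_count c) {c..d}"
proof (rule fundamental_theorem_of_calculus_interior_strong)
  show "finite (real ` {..nat \<lceil>d\<rceil>})" by simp
  show "continuous_on {c..d} renewal_count"
    by (rule continuous_on_subset[OF renewal_count_continuous]) (use assms in auto)
  fix x assume x: "x \<in> {c<..<d} - real ` {..nat \<lceil>d\<rceil>}"
  have "x \<notin> \<nat>"
  proof
    assume "x \<in> \<nat>"
    then obtain n where n: "x = real n" by (auto elim: Nats_cases)
    have "real n < d" using x n by auto
    then have "n \<le> nat \<lceil>d\<rceil>" by linarith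
    then show False using x n by auto
  qed
  then show "(renewal_count has_vector_derivative renewal_density x) (at x)"
    using renewal_count_deriv[of x] x assms
    by (auto simp: has_real_derivative_iff_has_vector_derivative)
qed (use assms in auto)

lemma renewal_density_neg: "t < 0 \<Longrightarrow> renewal_density t = 0"
  by (simp add: renewal_density_def renewal_count_neg)

lemma renewal_count_borel [measurable]: "renewal_count \<in> borel_measurable borel"
proof -
  have "(\<lambda>x. if x \<in> {0..} then renewal_count x else 0) \<in> borel_measurable borel"
    by (rule borel_measurable_continuous_on_if) (auto intro: renewal_count_continuous)
  also have "(\<lambda>x. if x \<in> {0..} then renewal_count x else 0) = renewal_count"
    using renewal_count_neg by (auto simp: fun_eq_iff not_le)
  finally show ?thesis .
qed

lemma renewal_density_borel [measurable]: "renewal_density \<in> borel_measurable borel"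
  unfolding renewal_density_def[abs_def] by measurable

lemma renewal_density_continuous: "continuous_on {1..} renewal_density"
  unfolding renewal_density_def[abs_def]
  by (intro continuous_intros continuous_on_compose2[OF renewal_count_continuous]) auto

lemma renewal_equation_integral:
  assumes "1 \<le> t" shows "renewal_density t = integral {t - 1..t} renewal_density"
  using renewal_density_has_integral[of "t - 1" t] assms
  by (simp add: integral_unique renewal_density_def)

text \<open>
  The renewal density is the mean of itself over the preceding unit interval. The following lemmas
  show that every such function converges exponentially fast.
\<close>
definition self_averaging :: "real \<Rightarrow> (real \<Rightarrow> real) \<Rightarrow> bool" where
  "self_averaging c y \<longleftrightarrow> continuous_on {c..} y \<and> (\<forall>t\<ge>c + 1. y t = integral {t - 1..t} y)"

lemma self_averaging_integrable:
  assumes "self_averaging c y" "c \<le> a" shows "y integrable_on {a..b}"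
  by (rule integrable_continuous_interval, rule continuous_on_subset[of "{c..}"])
     (use assms in \<open>auto simp: self_averaging_def\<close>)

lemma self_averaging_affine:
  assumes "self_averaging c y"
  shows "self_averaging c (\<lambda>t. \<alpha> * y t + \<beta>)"
proof -
  have "\<alpha> * y t + \<beta> = integral {t - 1..t} (\<lambda>t. \<alpha> * y t + \<beta>)" if "t \<ge> c + 1" for t
  proof -
    have "integral {t - 1..t} (\<lambda>t. \<alpha> * y t + \<beta>) = integral {t-1..t} (\<lambda>t. \<alpha> * y t) + integral {t-1..t} (\<lambda>t. \<beta>)"
      by (rule Henstock_Kurzweil_Integration.integral_add)
         (use assms that in \<open>auto simp: self_averaging_def intro!: integrable_continuous_interval continuous_intros intro: continuous_on_subset\<close>)
    then show ?thesis using assms that by (simp add: self_averaging_def)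
  qed
  then show ?thesis using assms by (auto simp: self_averaging_def intro!: continuous_intros)
qed

text \<open>
  Advancing by steps of length 1/2 lets the minimum principle be applied to an interval whose points
  average over themselves with weight at most 1/2: a negative minimum m on it would satisfy
  \<open>m \<ge> m / 2\<close>.
\<close>
lemma self_averaging_nonneg:
  assumes y: "self_averaging c y" and pos: "\<And>t. c \<le> t \<Longrightarrow> t \<le> c + 1 \<Longrightarrow> 0 \<le> y t" and "c \<le> t"
  shows "0 \<le> y t"
proof -
  have step: "\<forall>t\<in>{c..d + 1/2}. 0 \<le> y t" if d: "d \<ge> c + 1" and IH: "\<forall>t\<in>{c..d}. 0 \<le> y t" for d
  proof -
    have "continuous_on {d..d+1/2} y"
      by (rule continuous_on_subset[of "{c..}"]) (use y d in \<open>auto simp: self_averaging_def\<close>)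
    then obtain s where s: "s \<in> {d..d+1/2}" and min: "\<And>t. t \<in> {d..d+1/2} \<Longrightarrow> y s \<le> y t"
      using continuous_attains_inf[of "{d..d+1/2}" y] by auto
    have "0 \<le> y s"
    proof (rule ccontr)
      assume neg: "\<not> 0 \<le> y s"
      have "y s = integral {s - 1..s} y" using y s d by (auto simp: self_averaging_def)
      moreover have "\<dots> = integral {s - 1..d} y + integral {d..s} y"
        by (rule Henstock_Kurzweil_Integration.integral_combine[symmetric])
           (use s d self_averaging_integrable[OF y] in auto)
      moreover have "integral {s - 1..d} y \<ge> 0"
        by (rule Henstock_Kurzweil_Integration.integral_nonneg)
           (use s d IH self_averaging_integrable[OF y] in auto)
      moreover have "integral {d..s} y \<ge> integral {d..s} (\<lambda>_. y s)"
        by (rule integral_le) (use s d min self_averaging_integrable[OF y] in auto)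
      ultimately have "y s \<ge> (s - d) * y s" using s by simp
      moreover have "(s - d) * y s \<ge> 1/2 * y s"
        by (rule mult_right_mono_neg) (use s neg in auto)
      ultimately show False using neg by simp
    qed
    then show ?thesis using IH min by (smt (verit) atLeastAtMost_iff)
  qed
  have "\<forall>t\<in>{c..c + 1 + real n / 2}. 0 \<le> y t" for n
  proof (induction n)
    case (Suc n)
    from step[OF _ Suc] show ?case by (simp add: field_simps)
  qed (use pos in auto)
  then have "\<forall>t\<in>{c..c + 1 + real (2 * nat \<lceil>t - c\<rceil>) / 2}. 0 \<le> y t" by blast
  moreover have "t \<in> {c..c + 1 + real (2 * nat \<lceil>t - c\<rceil>) / 2}"
    using \<open>c \<le> t\<close> by simp linarith
  ultimately show ?thesis by blast
qed

text \<open>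
  A function with values in \<open>[0, L]\<close> that averages itself is Lipschitz with constant L,
  so the value at least \<open>L / 2\<close> at \<open>c + 2\<close> forces values at least
  \<open>L / 4\<close> within distance 1/4. Each averaging window that ends in the next unit
  interval contains one of the two halves of that neighbourhood, which contributes
  \<open>L / 4\<close> times 1/4.
\<close>
lemma self_averaging_lower:
  assumes y: "self_averaging c y" and bd: "\<And>t. c \<le> t \<Longrightarrow> 0 \<le> y t \<and> y t \<le> L"
    and mid: "y (c + 2) \<ge> L / 2" and t: "c + 2 \<le> t" "t \<le> c + 3"
  shows "L / 16 \<le> y t"
proof -
  note int = self_averaging_integrable[OF y]
  have L: "0 \<le> L" using bd[of c] by auto
  have lip: "y b - y a \<le> L * (b - a) \<and> y a - y b \<le> L * (b - a)" if "c + 1 \<le> a" "a \<le> b" "b \<le> a + 1" for a b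
  proof -
    have "y b = integral {b - 1..a} y + integral {a..b} y"
      using y that by (simp add: self_averaging_def Henstock_Kurzweil_Integration.integral_combine int)
    moreover have "y a = integral {a - 1..b - 1} y + integral {b - 1..a} y"
      using y that by (simp add: self_averaging_def Henstock_Kurzweil_Integration.integral_combine int)
    moreover have "integral {a..b} y \<le> integral {a..b} (\<lambda>_. L)" "integral {a - 1..b - 1} y \<le> integral {a - 1..b - 1} (\<lambda>_. L)"
      by (rule integral_le; use that bd int in auto)+
    moreover have "0 \<le> integral {a..b} y" "0 \<le> integral {a-1..b-1} y"
      by (rule Henstock_Kurzweil_Integration.integral_nonneg; use that bd int in auto)+
    ultimately show ?thesis using that by (simp add: mult.commute)
  qed
  have near: "L / 4 \<le> y s" if s: "c + 7/4 \<le> s" "s \<le> c + 9/4" for s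
  proof (cases "s \<le> c + 2")
    case True
    have "L * (c + 2 - s) \<le> L * (1/4)" by (rule mult_left_mono) (use s L in auto)
    with lip[of s "c + 2"] True s mid show ?thesis by auto
  next
    case False
    have "L * (s - (c + 2)) \<le> L * (1/4)" by (rule mult_left_mono) (use s L in auto)
    with lip[of "c + 2" s] False s mid show ?thesis by auto
  qed
  \<comment> \<open>The half of the neighbourhood of \<open>c + 2\<close> that lies in the window ending at t.\<close>
  define a where "a = (if t \<le> c + 11/4 then c + 7/4 else c + 2)"
  have a: "t - 1 \<le> a" "a + 1/4 \<le> t" "c + 7/4 \<le> a" "a + 1/4 \<le> c + 9/4"
    using t by (auto simp: a_def)
  have "L / 16 = integral {a..a+1/4} (\<lambda>_. L / 4)" by simp
  also have "\<dots> \<le> integral {a..a+1/4} y"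
    by (rule integral_le) (use a near int in auto)
  also have "\<dots> \<le> integral {t - 1..t} y"
    by (rule integral_subset_le) (use a t int bd in auto)
  also have "\<dots> = y t" using y t by (simp add: self_averaging_def)
  finally show ?thesis .
qed

text \<open>
  Either the function or its reflection in the interval of its values is in the upper half at
  \<open>c + 2\<close>. Hence one of the two bounds improves by \<open>L / 16\<close>, and
  positivity propagates the improved bound to all later times.
\<close>
lemma self_averaging_contract:
  assumes y: "self_averaging c y" and bd: "\<And>t. c \<le> t \<Longrightarrow> m \<le> y t \<and> y t \<le> m + L"
  shows "\<exists>m'. \<forall>t\<ge>c + 2. m' \<le> y t \<and> y t \<le> m' + 15/16 * L"
proof -
  have sub: "self_averaging (c + 2) (\<lambda>t. \<alpha> * y t + \<beta>)" for \<alpha> \<beta>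
    using self_averaging_affine[OF y, of \<alpha> \<beta>] 
    by (auto simp: self_averaging_def intro: continuous_on_subset)
  show ?thesis
  proof (cases "y (c + 2) \<ge> m + L / 2")
    case True
    have "L / 16 \<le> 1 * y t + (- m)" if "c + 2 \<le> t" "t \<le> c + 3" for t
      by (rule self_averaging_lower[OF self_averaging_affine[OF y]]) (use bd True that in \<open>auto simp: algebra_simps\<close>)
    then have "0 \<le> 1 * y t + (- m - L/16)" if "c + 2 \<le> t" for t
      using self_averaging_nonneg[OF sub[of 1 "- m - L/16"] _ that] by force
    then show ?thesis using bd by (intro exI[of _ "m + L/16"]) (auto simp: algebra_simps)
  next
    case False
    have "L / 16 \<le> (-1) * y t + (m + L)" if "c + 2 \<le> t" "t \<le> c + 3" for t
      by (rule self_averaging_lower[OF self_averaging_affine[OF y]]) (use bd False that in \<open>auto simp: algebra_simps\<close>)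
    then have "0 \<le> (-1) * y t + (m + 15/16 * L)" if "c + 2 \<le> t" for t
      using self_averaging_nonneg[OF sub[of "-1" "m + 15/16*L"] _ that] by force
    then show ?thesis using bd by (intro exI[of _ "m"]) (auto simp: algebra_simps)
  qed
qed

text \<open>
  The nested intervals from the contraction lemma have lengths that shrink geometrically, so they have
  a common point, which is the limit.
\<close>
lemma self_averaging_converges:
  assumes y: "self_averaging c y"
  obtains l L where "0 \<le> L" "\<And>t n. c + 2 * real n \<le> t \<Longrightarrow> \<bar>y t - l\<bar> \<le> L * (15/16) ^ n"
proof -
  have "compact (y ` {c..c+1})"
    by (rule compact_continuous_image) (use y in \<open>auto simp: self_averaging_def intro: continuous_on_subset\<close>)
  then have "\<exists>B. \<forall>t\<in>{c..c+1}. \<bar>y t\<bar> \<le> B"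
    by (auto dest!: compact_imp_bounded simp: bounded_iff)
  then obtain B where B: "\<And>t. t \<in> {c..c+1} \<Longrightarrow> \<bar>y t\<bar> \<le> B" by blast
  have B0: "0 \<le> B" using B[of c] by auto
  have up: "0 \<le> (-1) * y t + B" if "c \<le> t" for t
    by (rule self_averaging_nonneg[OF self_averaging_affine[OF y, of "-1" B] _ that]) (use B in \<open>auto simp: abs_le_iff\<close>)
  have lo: "0 \<le> 1 * y t + B" if "c \<le> t" for t
    by (rule self_averaging_nonneg[OF self_averaging_affine[OF y, of 1 B] _ that]) (use B in \<open>auto simp: abs_le_iff\<close>, smt (verit) B atLeastAtMost_iff)
  have "\<exists>m. \<forall>t\<ge>c + 2 * real n. m \<le> y t \<and> y t \<le> m + 2 * B * (15/16) ^ n" for n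
  proof (induction n)
    case 0
    show ?case by (rule exI[of _ "- B"]) (use up lo in force)
  next
    case (Suc n)
    then obtain m where m: "\<forall>t\<ge>c + 2 * real n. m \<le> y t \<and> y t \<le> m + 2 * B * (15/16) ^ n" by blast
    have "self_averaging (c + 2 * real n) y"
      using y by (auto simp: self_averaging_def intro: continuous_on_subset)
    from self_averaging_contract[OF this, of m "2 * B * (15/16) ^ n"] m
    obtain m' where "\<forall>t\<ge>c + 2 * real n + 2. m' \<le> y t \<and> y t \<le> m' + 15/16 * (2 * B * (15/16) ^ n)" by blast
    then show ?case by (intro exI[of _ m']) (auto simp: algebra_simps)
  qed
  then obtain m where m: "\<And>n t. c + 2 * real n \<le> t \<Longrightarrow> m n \<le> y t \<and> y t \<le> m n + 2 * B * (15/16) ^ n"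
    by metis
  have cross: "m i \<le> m j + 2 * B * (15/16) ^ j" for i j
    using m[of i "c + 2 * real i + 2 * real j"] m[of j "c + 2 * real i + 2 * real j"] by fastforce
  define l where "l = (SUP i. m i)"
  have bdd: "bdd_above (range m)" by (rule bdd_aboveI2) (rule cross[of _ 0])
  have l: "m n \<le> l" "l \<le> m n + 2 * B * (15/16) ^ n" for n
    unfolding l_def using bdd cross by (auto intro: cSUP_upper cSUP_least)
  show thesis
  proof (rule that[of "2 * B" l])
    fix t n assume "c + 2 * real n \<le> t"
    with m[of n t] l[of n] show "\<bar>y t - l\<bar> \<le> 2 * B * (15/16) ^ n" by auto
  qed (use B0 in auto)
qed

lemma decay_kernel_ge_geometric:
  "\<exists>C>0. \<forall>n t. 0 \<le> t \<and> t \<le> 2 * real n + 3 \<longrightarrow> (15/16) ^ n \<le> C * decay_kernel t"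
proof -
  have "(\<lambda>n. (2 * real n + 4) powr (3/2) * (15/16) ^ n) \<longlonglongrightarrow> 0" by real_asymp
  then have "Bseq (\<lambda>n. (2 * real n + 4) powr (3/2) * (15/16) ^ n)" 
    by (intro convergent_imp_Bseq) (auto simp: convergent_def)
  then obtain K where K: "K > 0" "\<And>n. norm ((2 * real n + 4) powr (3/2) * (15/16) ^ n) \<le> K"
    by (auto simp: Bseq_def)
  show ?thesis
  proof (intro exI[of _ K] conjI allI impI K(1))
    fix n and t :: real assume t: "0 \<le> t \<and> t \<le> 2 * real n + 3"
    have "(1 + t) powr (3/2) * (15/16) ^ n \<le> (2 * real n + 4) powr (3/2) * (15/16) ^ n"
      by (intro mult_right_mono powr_mono2) (use t in auto)
    also have "\<dots> \<le> K" using K(2)[of n] by simp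
    finally have "(15/16) ^ n \<le> K / (1 + t) powr (3/2)" using t by (simp add: field_simps)
    also have "\<dots> = K * decay_kernel t" using t by (simp add: decay_kernel_def powr_minus_divide)
    finally show "(15/16) ^ n \<le> K * decay_kernel t" .
  qed
qed

text \<open>
  Exponential convergence is recorded only as domination by the decay kernel, so that all later
  estimates involve a single kernel.
\<close>
lemma renewal_density_converges:
  "\<exists>l C. 0 < C \<and> (\<forall>t. \<bar>renewal_density t - (if 0 \<le> t then l else 0)\<bar> \<le> C * decay_kernel t)"
proof -
  have "self_averaging 1 renewal_density"
    using renewal_density_continuous renewal_equation_integral by (simp add: self_averaging_def)
  then obtain l L where L: "0 \<le> L" "\<And>t n. 1 + 2 * real n \<le> t \<Longrightarrow> \<bar>renewal_density t - l\<bar> \<le> L * (15/16) ^ n"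
    using self_averaging_converges[of 1 renewal_density] by metis
  obtain C where C: "C > 0" "\<And>n t. 0 \<le> t \<Longrightarrow> t \<le> 2 * real n + 3 \<Longrightarrow> (15/16) ^ n \<le> C * decay_kernel t"
    using decay_kernel_ge_geometric by blast
  have "compact (renewal_count ` {0..1})"
    by (rule compact_continuous_image) (use renewal_count_continuous in \<open>auto intro: continuous_on_subset\<close>)
  then have "\<exists>B. \<forall>t\<in>{0..1}. \<bar>renewal_count t\<bar> \<le> B"
    by (auto dest!: compact_imp_bounded simp: bounded_iff)
  then obtain B where B: "\<And>t. t \<in> {0..1} \<Longrightarrow> \<bar>renewal_count t\<bar> \<le> B" by blast
  have B0: "0 \<le> B" using B[of 0] by auto
  define K where "K = (L + 2 * B + \<bar>l\<bar> + 1) * C"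
  have K: "K > 0" unfolding K_def using C L B0 by (intro mult_pos_pos) auto
  have "\<bar>renewal_density t - (if 0 \<le> t then l else 0)\<bar> \<le> K * decay_kernel t" for t
  proof -
    consider "t < 0" | "0 \<le> t" "t \<le> 1" | "1 < t" by linarith
    then show ?thesis
    proof cases
      case 1
      then show ?thesis using K by (simp add: renewal_density_neg decay_kernel_def)
    next
      case 2
      have "\<bar>renewal_density t\<bar> \<le> 2 * B"
      proof (cases "t = 1")
        case True then show ?thesis using B[of 1] B[of 0] by (simp add: renewal_density_def)
      next
        case False then show ?thesis using B[of t] 2 B0 by (simp add: renewal_density_def renewal_count_neg)
      qed
      then have "\<bar>renewal_density t - l\<bar> \<le> (L + 2 * B + \<bar>l\<bar> + 1) * (15/16) ^ 0" using L(1) by simp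
      also have "\<dots> \<le> (L + 2 * B + \<bar>l\<bar> + 1) * (C * decay_kernel t)"
        by (rule mult_left_mono[OF C(2)]) (use 2 L B0 in auto)
      finally show ?thesis using 2 by (simp add: K_def mult.assoc)
    next
      case 3
      define n where "n = nat \<lfloor>(t - 1) / 2\<rfloor>"
      have n: "1 + 2 * real n \<le> t" "t \<le> 2 * real n + 3"
      proof -
        have "real n = of_int \<lfloor>(t - 1) / 2\<rfloor>" using 3 by (simp add: n_def)
        moreover have "of_int \<lfloor>(t - 1) / 2\<rfloor> \<le> (t - 1) / 2" "(t - 1) / 2 < of_int \<lfloor>(t - 1) / 2\<rfloor> + 1"
          by (rule of_int_floor_le, rule real_of_int_floor_add_one_gt[THEN ord_less_eq_trans], simp)
        ultimately show "1 + 2 * real n \<le> t" "t \<le> 2 * real n + 3" by (auto simp: field_simps)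
      qed
      have "\<bar>renewal_density t - l\<bar> \<le> L * (15/16) ^ n" by (rule L(2)[OF n(1)])
      also have "\<dots> \<le> (L + 2 * B + \<bar>l\<bar> + 1) * (15/16) ^ n" using B0 by (intro mult_right_mono) auto
      also have "\<dots> \<le> (L + 2 * B + \<bar>l\<bar> + 1) * (C * decay_kernel t)"
        by (rule mult_left_mono[OF C(2)]) (use 3 n L B0 in auto)
      finally show ?thesis using 3 by (simp add: K_def mult.assoc)
    qed
  qed
  then show ?thesis using K by blast
qed

section \<open>Translation differences in terms of the mean defect\<close>

text \<open>
  The operator that dominates a translation difference in terms of the mean defect. A shift by t costs
  a kernel dilated to the length \<open>1 + \<bar>t\<bar>\<close>; keeping this dilated kernel,
  instead of passing at once to the unit kernel, is what makes the iterates grow only like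
  \<open>(1 + \<bar>t\<bar>) ^ j\<close> in the next lemma.
\<close>
definition difference_majorant :: "real \<Rightarrow> real \<Rightarrow> (real \<Rightarrow> ennreal) \<Rightarrow> real \<Rightarrow> ennreal" where
  "difference_majorant C t F x = F (x + t) + F x + ennreal (C * (1 + \<bar>t\<bar>)) * kernel_mean (1 + \<bar>t\<bar>) F x"

lemma difference_majorant_mono:
  "(\<And>y. F y \<le> G y) \<Longrightarrow> difference_majorant C t F x \<le> difference_majorant C t G x"
  unfolding difference_majorant_def by (intro add_mono mult_left_mono kernel_mean_mono) auto

lemma difference_majorant_borel [measurable]:
  assumes [measurable]: "F \<in> borel_measurable borel"
  shows "difference_majorant C t F \<in> borel_measurable borel"
  unfolding difference_majorant_def[abs_def] by measurable

text \<open>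
  Expanding the j-th iterate gives pure translations by multiples of t, and terms that contain at
  least one kernel. The latter collapse to a single kernel of the same scale: that kernel absorbs
  shifts by multiples of t (\<open>kernel_mean_shift\<close>) and composition with itself
  (\<open>kernel_mean_iterate\<close>) at the cost of constants, and every further factor contributes
  at most one power of \<open>1 + \<bar>t\<bar>\<close>.
\<close>
lemma difference_majorant_iterate:
  assumes C: "0 \<le> C"
  shows "\<exists>c\<ge>0. \<forall>F t x. F \<in> borel_measurable borel \<longrightarrow>
    (difference_majorant C t ^^ j) F x \<le> 2 ^ j * (\<Sum>i\<le>j. F (x + real i * t)) + ennreal (c * (1 + \<bar>t\<bar>) ^ j) * kernel_mean (1 + \<bar>t\<bar>) F x"
proof (induction j)
  case 0
  show ?case by (intro exI[of _ 0]) auto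
next
  case (Suc j)
  then obtain c where c: "0 \<le> c" and IH: "\<And>F t x. F \<in> borel_measurable borel \<Longrightarrow>
    (difference_majorant C t ^^ j) F x \<le> 2 ^ j * (\<Sum>i\<le>j. F (x + real i * t)) + ennreal (c * (1 + \<bar>t\<bar>) ^ j) * kernel_mean (1 + \<bar>t\<bar>) F x"
    by blast
  define b where "b = (1 + real j) powr (3/2)"
  have b: "0 \<le> b" by (simp add: b_def)
  define d where "d = c * 2 powr (3/2) + c + C * (2 ^ j * (real (Suc j) * b) + c * conv_const)"
  have d0: "0 \<le> d" using c C b conv_const_nonneg by (simp add: d_def)
  show ?case
  proof (intro exI[of _ d] conjI allI impI d0)
    fix F :: "real \<Rightarrow> ennreal" and t x :: real assume F[measurable]: "F \<in> borel_measurable borel"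
    define R where "R = 1 + \<bar>t\<bar>"
    have R: "1 \<le> R" "0 < R" "\<bar>t\<bar> \<le> R" by (auto simp: R_def)
    let ?K = "kernel_mean R F x"
    define B where "B y = 2 ^ j * (\<Sum>i\<le>j. F (y + real i * t)) + ennreal (c * R ^ j) * kernel_mean R F y" for y
    have shift: "kernel_mean R F (x + real i * t) \<le> ennreal b * ?K" if "i \<le> j" for i
    proof -
      have "kernel_mean R F (x + real i * t) \<le> ennreal ((1 + real j) powr (3/2)) * ?K"
        by (rule kernel_mean_shift) (use R that in \<open>auto simp: abs_mult intro!: mult_mono\<close>)
      then show ?thesis by (simp add: b_def)
    qed
    have shift1: "kernel_mean R F (x + t) \<le> ennreal (2 powr (3/2)) * ?K"
      using kernel_mean_shift[OF F R(2), of t 1 x] R by simp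
    have KB: "kernel_mean R B x \<le> ennreal (2 ^ j * (real (Suc j) * b) + c * R ^ j * conv_const) * ?K"
    proof -
      have "kernel_mean R B x = 2 ^ j * (\<Sum>i\<le>j. kernel_mean R F (x + real i * t)) + ennreal (c * R ^ j) * kernel_mean R (kernel_mean R F) x"
      proof -
        have "kernel_mean R B x = (\<integral>\<^sup>+s. 2 ^ j * (\<Sum>i\<le>j. ennreal (decay_kernel (s / R) / R) * F ((x + real i * t) + s)) +
           ennreal (c * R ^ j) * (ennreal (decay_kernel (s / R) / R) * kernel_mean R F (x + s)) \<partial>lborel)"
          unfolding kernel_mean_def[of R B] B_def
          by (intro nn_integral_cong) (simp add: distrib_left sum_distrib_left mult_ac add_ac)
        also have "\<dots> = 2 ^ j * (\<Sum>i\<le>j. \<integral>\<^sup>+s. ennreal (decay_kernel (s / R) / R) * F ((x + real i * t) + s) \<partial>lborel) +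
           ennreal (c * R ^ j) * (\<integral>\<^sup>+s. (ennreal (decay_kernel (s / R) / R) * kernel_mean R F (x + s)) \<partial>lborel)"
          by (simp add: nn_integral_add nn_integral_cmult nn_integral_sum)
        finally show ?thesis by (simp add: kernel_mean_def)
      qed
      also have "\<dots> \<le> 2 ^ j * (\<Sum>i\<le>j. ennreal b * ?K) + ennreal (c * R ^ j) * (ennreal conv_const * ?K)"
        by (intro add_mono mult_left_mono sum_mono shift kernel_mean_iterate F R) auto
      also have "\<dots> = ennreal (2 ^ j * (real (Suc j) * b) + c * R ^ j * conv_const) * ?K"
        using b c R conv_const_nonneg
        by (simp add: ennreal_plus ennreal_mult distrib_right mult.assoc ennreal_of_nat_eq_real_of_nat ennreal_power[symmetric] del: of_nat_Suc)
      finally show ?thesis .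
    qed
    have [measurable]: "B \<in> borel_measurable borel" unfolding B_def by measurable
    have "(difference_majorant C t ^^ Suc j) F x \<le> difference_majorant C t B x"
      unfolding funpow.simps comp_def
      by (rule difference_majorant_mono) (use IH[OF F] in \<open>auto simp: B_def R_def\<close>)
    also have "\<dots> = 2 ^ j * ((\<Sum>i\<le>j. F (x + t + real i * t)) + (\<Sum>i\<le>j. F (x + real i * t)))
        + (ennreal (c * R ^ j) * kernel_mean R F (x + t) + ennreal (c * R ^ j) * ?K + ennreal (C * R) * kernel_mean R B x)"
      unfolding difference_majorant_def R_def[symmetric] by (simp add: B_def distrib_left add_ac)
    also have "\<dots> \<le> 2 ^ j * ((\<Sum>i\<le>Suc j. F (x + real i * t)) + (\<Sum>i\<le>Suc j. F (x + real i * t))) + ennreal (d * R ^ Suc j) * ?K"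
    proof (rule add_mono)
      have "(\<Sum>i\<le>j. F (x + t + real i * t)) = (\<Sum>i\<in>Suc ` {..j}. F (x + real i * t))"
        by (subst sum.reindex) (auto simp: algebra_simps)
      also have "\<dots> \<le> (\<Sum>i\<le>Suc j. F (x + real i * t))" by (rule sum_mono2) auto
      finally show "2 ^ j * ((\<Sum>i\<le>j. F (x + t + real i * t)) + (\<Sum>i\<le>j. F (x + real i * t))) \<le>
         2 ^ j * ((\<Sum>i\<le>Suc j. F (x + real i * t)) + (\<Sum>i\<le>Suc j. F (x + real i * t)))"
        by (intro mult_left_mono add_mono) (auto intro!: sum_mono2)
      have "ennreal (c * R ^ j) * kernel_mean R F (x + t) + ennreal (c * R ^ j) * ?K + ennreal (C * R) * kernel_mean R B x
        \<le> ennreal (c * R ^ j) * (ennreal (2 powr (3/2)) * ?K) + ennreal (c * R ^ j) * ?K +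
          ennreal (C * R) * (ennreal (2 ^ j * (real (Suc j) * b) + c * R ^ j * conv_const) * ?K)"
        by (intro add_mono mult_left_mono shift1 KB order_refl) auto
      also have "\<dots> = ennreal (c * R ^ j * 2 powr (3/2) + c * R ^ j + C * R * (2 ^ j * (real (Suc j) * b) + c * R ^ j * conv_const)) * ?K"
        using b c C R conv_const_nonneg
        by (simp add: ennreal_plus ennreal_mult distrib_right distrib_left mult.assoc del: of_nat_Suc)
      also have "\<dots> \<le> ennreal (d * R ^ Suc j) * ?K"
      proof (intro mult_right_mono ennreal_leI)
        have R1: "R ^ j \<le> R ^ Suc j" "R * 1 \<le> R * R ^ j" using R by (auto simp: mult_left_mono intro: mult_right_mono)
        have "c * R ^ j * 2 powr (3/2) + c * R ^ j = (c * 2 powr (3/2) + c) * R ^ j" by (simp add: algebra_simps)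
        also have "\<dots> \<le> (c * 2 powr (3/2) + c) * R ^ Suc j" by (rule mult_left_mono[OF R1(1)]) (use c in auto)
        finally have 1: "c * R ^ j * 2 powr (3/2) + c * R ^ j \<le> (c * 2 powr (3/2) + c) * R ^ Suc j" .
        have "C * R * (2 ^ j * (real (Suc j) * b)) \<le> C * (2 ^ j * (real (Suc j) * b)) * R ^ Suc j"
          using mult_left_mono[OF R1(2), of "C * (2 ^ j * (real (Suc j) * b))"] C b by (simp add: mult_ac del: of_nat_Suc)
        with 1 show "c * R ^ j * 2 powr (3/2) + c * R ^ j + C * R * (2 ^ j * (real (Suc j) * b) + c * R ^ j * conv_const) \<le> d * R ^ Suc j"
          by (simp add: d_def algebra_simps del: of_nat_Suc)
      qed auto
      finally show "ennreal (c * R ^ j) * kernel_mean R F (x + t) + ennreal (c * R ^ j) * ?K + ennreal (C * R) * kernel_mean R B x \<le> ennreal (d * R ^ Suc j) * ?K" .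
    qed
    also have "2 ^ j * ((\<Sum>i\<le>Suc j. F (x + real i * t)) + (\<Sum>i\<le>Suc j. F (x + real i * t))) = 2 ^ Suc j * (\<Sum>i\<le>Suc j. F (x + real i * t))"
      by (simp only: power_Suc mult_2[symmetric] mult_ac)
    finally show "(difference_majorant C t ^^ Suc j) F x \<le> 2 ^ Suc j * (\<Sum>i\<le>Suc j. F (x + real i * t)) + ennreal (d * (1 + \<bar>t\<bar>) ^ Suc j) * kernel_mean (1 + \<bar>t\<bar>) F x"
      by (simp only: R_def)
  qed
qed

text \<open>
  For these functions the convolutions with kernels dominated by the decay kernel converge absolutely
  at every point. Finiteness at the origin suffices, since the kernels centred at two points are
  comparable.
\<close>
definition tempered :: "(real \<Rightarrow> complex) \<Rightarrow> bool" where
  "tempered f \<longleftrightarrow> f \<in> borel_measurable borel \<and> kernel_mean 1 (ennorm f) 0 < \<infinity>"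

lemma tempered_borel: "tempered f \<Longrightarrow> f \<in> borel_measurable borel"
  by (simp add: tempered_def)

lemma tempered_kernel_mean_finite:
  assumes "tempered f" shows "kernel_mean 1 (ennorm f) x < \<infinity>"
proof -
  have [measurable]: "f \<in> borel_measurable borel" using assms by (rule tempered_borel)
  have "kernel_mean 1 (ennorm f) (0 + x) \<le> ennreal ((1 + \<bar>x\<bar>) powr (3/2)) * kernel_mean 1 (ennorm f) 0"
    by (rule kernel_mean_shift) auto
  also have "\<dots> < \<infinity>" using assms by (simp add: tempered_def ennreal_mult_less_top)
  finally show ?thesis by simp
qed

lemma tempered_shift:
  assumes "tempered f" shows "tempered (\<lambda>x. f (x + a))"
proof -
  have [measurable]: "f \<in> borel_measurable borel" using assms by (rule tempered_borel)
  have "kernel_mean 1 (\<lambda>y. ennreal (norm (f (y + a)))) 0 = kernel_mean 1 (ennorm f) a"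
    by (simp add: kernel_mean_def add.commute)
  then show ?thesis using tempered_kernel_mean_finite[OF assms, of a] by (simp add: tempered_def)
qed

lemma tempered_diff:
  assumes "tempered f" "tempered h" shows "tempered (\<lambda>x. f x - h x)"
proof -
  have [measurable]: "f \<in> borel_measurable borel" "h \<in> borel_measurable borel" using assms by (simp_all add: tempered_borel)
  have "kernel_mean 1 (\<lambda>y. ennreal (norm (f y - h y))) 0 \<le> kernel_mean 1 (\<lambda>y. ennreal (norm (f y)) + ennreal (norm (h y))) 0"
    by (intro kernel_mean_mono) (simp add: norm_triangle_ineq4 flip: ennreal_plus)
  also have "\<dots> = kernel_mean 1 (ennorm f) 0 + kernel_mean 1 (ennorm h) 0"
    unfolding kernel_mean_def by (simp add: distrib_left nn_integral_add)
  also have "\<dots> < \<infinity>" using assms by (simp add: tempered_def)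
  finally show ?thesis by (simp add: tempered_def)
qed

lemma nn_integral_dominated_kernel:
  assumes f: "tempered f" and g: "\<And>s. \<bar>g s\<bar> \<le> C * decay_kernel s" and C: "0 \<le> C"
  shows "(\<integral>\<^sup>+s. ennreal (norm (complex_of_real (g s) * f (x + s))) \<partial>lborel) \<le> ennreal C * kernel_mean 1 (ennorm f) x"
proof -
  have [measurable]: "f \<in> borel_measurable borel" using f by (rule tempered_borel)
  have "(\<integral>\<^sup>+s. ennreal (norm (complex_of_real (g s) * f (x + s))) \<partial>lborel) \<le>
    (\<integral>\<^sup>+s. ennreal C * (ennreal (decay_kernel (s / 1) / 1) * ennreal (norm (f (x + s)))) \<partial>lborel)"
  proof (rule nn_integral_mono)
    fix s
    have "norm (complex_of_real (g s) * f (x + s)) \<le> (C * decay_kernel s) * norm (f (x + s))"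
      unfolding norm_mult by (rule mult_right_mono) (use g[of s] in auto)
    then show "ennreal (norm (complex_of_real (g s) * f (x + s))) \<le> ennreal C * (ennreal (decay_kernel (s / 1) / 1) * ennreal (norm (f (x + s))))"
      using C by (simp add: ennreal_mult[symmetric] mult.assoc ennreal_leI)
  qed
  also have "\<dots> = ennreal C * kernel_mean 1 (ennorm f) x"
    unfolding kernel_mean_def by (rule nn_integral_cmult) auto
  finally show ?thesis .
qed

lemma integrable_dominated_kernel:
  assumes f: "tempered f" and [measurable]: "g \<in> borel_measurable borel"
    and g: "\<And>s. \<bar>g s\<bar> \<le> C * decay_kernel s" and C: "0 \<le> C"
  shows "integrable lborel (\<lambda>s. complex_of_real (g s) * f (x + s))"
proof (rule integrableI_bounded)
  have [measurable]: "f \<in> borel_measurable borel" using f by (rule tempered_borel)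
  show "(\<lambda>s. complex_of_real (g s) * f (x + s)) \<in> borel_measurable lborel" by measurable
  show "(\<integral>\<^sup>+s. ennreal (norm (complex_of_real (g s) * f (x + s))) \<partial>lborel) < \<infinity>"
    using nn_integral_dominated_kernel[OF f g C, of x] tempered_kernel_mean_finite[OF f, of x]
    by (simp add: order_le_less_trans ennreal_mult_less_top)
qed

text \<open>
  The Steklov mean of step 1, written as an integral over the whole line so that it falls under the
  bounds for dominated kernels.
\<close>
definition unit_mean :: "(real \<Rightarrow> complex) \<Rightarrow> real \<Rightarrow> complex" where
  "unit_mean f x = (LINT s|lborel. complex_of_real (indicator {0..1} s) * f (x + s))"

lemma indicator_le_decay_kernel: "\<bar>indicator {0..1} s :: real\<bar> \<le> 2 powr (3/2) * decay_kernel s"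
proof (cases "s \<in> {0..1}")
  case True
  have "decay_kernel 0 \<le> 2 powr (3/2) * decay_kernel s"
    by (rule decay_kernel_comparison) (use True in auto)
  then show ?thesis using True by (simp add: decay_kernel_def)
qed simp

lemma unit_mean_integrable:
  "tempered f \<Longrightarrow> integrable lborel (\<lambda>s. complex_of_real (indicator {0..1} s) * f (x + s))"
  by (rule integrable_dominated_kernel[OF _ _ indicator_le_decay_kernel]) auto

lemma norm_unit_mean_le:
  assumes f: "tempered f"
  shows "ennreal (norm (unit_mean f x)) \<le> ennreal (2 powr (3/2)) * kernel_mean 1 (ennorm f) x"
proof -
  have "ennreal (norm (unit_mean f x)) \<le> (\<integral>\<^sup>+s. ennreal (norm (complex_of_real (indicator {0..1} s) * f (x + s))) \<partial>lborel)"
    unfolding unit_mean_def by (rule integral_norm_bound_ennreal[OF unit_mean_integrable[OF f]])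
  also have "\<dots> \<le> ennreal (2 powr (3/2)) * kernel_mean 1 (ennorm f) x"
    by (rule nn_integral_dominated_kernel[OF f indicator_le_decay_kernel]) simp
  finally show ?thesis .
qed

lemma tempered_unit_mean:
  assumes f: "tempered f" shows "tempered (unit_mean f)"
proof -
  have [measurable]: "f \<in> borel_measurable borel" using f by (rule tempered_borel)
  have m[measurable]: "unit_mean f \<in> borel_measurable borel"
    unfolding unit_mean_def[abs_def] by measurable
  have "kernel_mean 1 (ennorm (unit_mean f)) 0 \<le> kernel_mean 1 (\<lambda>x. ennreal (2 powr (3/2)) * kernel_mean 1 (ennorm f) x) 0"
    by (rule kernel_mean_mono) (rule norm_unit_mean_le[OF f])
  also have "\<dots> = ennreal (2 powr (3/2)) * kernel_mean 1 (kernel_mean 1 (ennorm f)) 0"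
    unfolding kernel_mean_def[of 1 _ 0] by (subst nn_integral_cmult[symmetric]) (auto simp: mult.left_commute)
  also have "\<dots> \<le> ennreal (2 powr (3/2)) * (ennreal conv_const * kernel_mean 1 (ennorm f) 0)"
    by (intro mult_left_mono kernel_mean_iterate) auto
  also have "\<dots> < \<infinity>" using f by (simp add: tempered_def ennreal_mult_less_top)
  finally show ?thesis using m by (simp add: tempered_def)
qed

definition mean_defect :: "(real \<Rightarrow> complex) \<Rightarrow> real \<Rightarrow> complex" where
  "mean_defect f x = f x - unit_mean f x"

lemma tempered_mean_defect: "tempered f \<Longrightarrow> tempered (mean_defect f)"
  unfolding mean_defect_def[abs_def] by (intro tempered_diff tempered_unit_mean)

lemma tempered_mean_defect_iterate: "tempered f \<Longrightarrow> tempered ((mean_defect ^^ k) f)"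
  by (induction k) (auto intro: tempered_mean_defect)

lemma renewal_density_bounded: "\<exists>B. \<forall>t. \<bar>renewal_density t\<bar> \<le> B"
proof -
  obtain l C where C: "0 < C" and l: "\<And>t. \<bar>renewal_density t - (if 0 \<le> t then l else 0)\<bar> \<le> C * decay_kernel t"
    using renewal_density_converges by blast
  have "\<bar>renewal_density t\<bar> \<le> C + \<bar>l\<bar>" for t
  proof -
    have "C * decay_kernel t \<le> C * 1" using C decay_kernel_le_1[of t] by (intro mult_left_mono) auto
    then show ?thesis using l[of t] by (auto split: if_splits)
  qed
  then show ?thesis by blast
qed

lemma renewal_density_interval_integrable: "integrable lborel (\<lambda>s. indicator {a..b} s * renewal_density s)"
proof -
  obtain B where "\<And>t. \<bar>renewal_density t\<bar> \<le> B" using renewal_density_bounded by blast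
  then have "set_integrable lborel {a..b} renewal_density"
    unfolding set_integrable_def
    by (intro integrableI_bounded_set_indicator[where B = B]) (auto simp: emeasure_lborel_Icc_eq)
  then show ?thesis by (simp add: set_integrable_def)
qed

lemma renewal_density_integral:
  assumes "0 \<le> c" "c \<le> d"
  shows "(LINT s|lborel. indicator {c..d} s * renewal_density s) = renewal_count d - renewal_count c"
proof -
  define J where "J = (LINT s|lborel. indicator {c..d} s * renewal_density s)"
  have "((\<lambda>s. indicator {c..d} s * renewal_density s) has_integral J) UNIV"
    unfolding J_def by (rule has_integral_integral_lborel[OF renewal_density_interval_integrable])
  also have "(\<lambda>s. indicator {c..d} s * renewal_density s) = (\<lambda>s. if s \<in> {c..d} then renewal_density s else 0)"
    by (auto simp: indicator_def)
  finally have "(renewal_density has_integral J) {c..d}"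
    by (simp only: has_integral_restrict_UNIV)
  then have "J = renewal_count d - renewal_count c"
    using renewal_density_has_integral[OF assms] by (rule has_integral_unique)
  then show ?thesis by (simp only: J_def)
qed

text \<open>
  Convolving the renewal density with the uniform distribution removes exactly the term for one
  summand, whose density is the indicator of the unit interval. For \<open>y \<ge> 1\<close> that
  indicator vanishes and the integral is \<open>a y - a (y - 1)\<close>; for y in
  \<open>[0, 1)\<close> it is \<open>a y - a 0\<close>, with \<open>a 0 = 1\<close>.
\<close>
lemma renewal_equation:
  "(LINT s|lborel. indicator {y - 1..y} s * renewal_density s) = renewal_density y - indicator {0..<1} y"
proof -
  consider "y < 0" | "0 \<le> y" "y < 1" | "1 \<le> y" by linarith
  then show ?thesis
  proof cases
    case 1
    then have "(\<lambda>s. indicator {y - 1..y} s * renewal_density s) = (\<lambda>s. 0)"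
      by (auto simp: indicator_def renewal_density_neg)
    then show ?thesis using 1 by (simp add: renewal_density_neg)
  next
    case 2
    then have "(\<lambda>s. indicator {y - 1..y} s * renewal_density s) = (\<lambda>s. indicator {0..y} s * renewal_density s)"
      by (auto simp: indicator_def fun_eq_iff renewal_density_neg)
    then show ?thesis using 2 renewal_density_integral[of 0 y]
      by (simp add: renewal_count_0 renewal_density_def renewal_count_neg)
  next
    case 3
    then show ?thesis using renewal_density_integral[of "y - 1" y] by (simp add: renewal_density_def)
  qed
qed

text \<open>
  The renewal density is the absolutely continuous part of the formal inverse of
  \<open>I - T\<close>, where T is the unit mean. It is not integrable since it does not decay; the
  difference with its translate is.
\<close>
definition renewal_shift :: "real \<Rightarrow> real \<Rightarrow> real" where
  "renewal_shift t s = renewal_density (s - t) - renewal_density s"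

lemma renewal_shift_borel [measurable]: "renewal_shift t \<in> borel_measurable borel"
  unfolding renewal_shift_def[abs_def] by measurable

lemma renewal_shift_equation:
  "(LINT s|lborel. renewal_shift t s * indicator {0..1} (y - s)) =
    renewal_shift t y - (indicator {0..<1} (y - t) - indicator {0..<1} y)"
proof -
  have i1: "integrable lborel (\<lambda>s. indicator {y - 1..y} s * renewal_density (s - t))"
    using lborel_integrable_real_affine[OF renewal_density_interval_integrable[of "y - 1 - t" "y - t"], of 1 "-t"]
    by (simp add: indicator_def cong: if_cong)
  have "(LINT s|lborel. indicator {y - 1 - t..y - t} s * renewal_density s) =
      (LINT s|lborel. indicator {y - 1 - t..y - t} (- t + 1 * s) * renewal_density (- t + 1 * s))"
    by (subst lborel_integral_real_affine[of 1 _ "-t"]) auto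
  also have "\<dots> = (LINT s|lborel. indicator {y - 1..y} s * renewal_density (s - t))"
    by (simp add: indicator_def cong: if_cong)
  finally have e1: "(LINT s|lborel. indicator {y - 1..y} s * renewal_density (s - t)) = renewal_density (y - t) - indicator {0..<1} (y - t)"
    using renewal_equation[of "y - t"] by (simp add: algebra_simps)
  have "(LINT s|lborel. renewal_shift t s * indicator {0..1} (y - s)) =
     (LINT s|lborel. indicator {y - 1..y} s * renewal_density (s - t) - indicator {y - 1..y} s * renewal_density s)"
    by (intro Bochner_Integration.integral_cong) (auto simp: renewal_shift_def indicator_def)
  also have "\<dots> = (LINT s|lborel. indicator {y - 1..y} s * renewal_density (s - t)) - (LINT s|lborel. indicator {y - 1..y} s * renewal_density s)"
    by (rule Bochner_Integration.integral_diff[OF i1 renewal_density_interval_integrable])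
  finally show ?thesis by (simp add: e1 renewal_equation renewal_shift_def)
qed

text \<open>
  Up to decaying errors the renewal density is a step function, so the difference of two translates is
  large only between 0 and t, where the kernel dilated to length \<open>1 + \<bar>t\<bar>\<close> is
  bounded below.
\<close>
lemma renewal_shift_bound:
  obtains C where "0 < C" "\<And>t s. \<bar>renewal_shift t s\<bar> \<le> C * decay_kernel (s / (1 + \<bar>t\<bar>))"
proof -
  obtain l C where C: "0 < C" and l: "\<And>t. \<bar>renewal_density t - (if 0 \<le> t then l else 0)\<bar> \<le> C * decay_kernel t"
    using renewal_density_converges by blast
  show thesis
  proof (rule that[of "(C + \<bar>l\<bar>) * 2 powr (3/2) + C"])
    show "0 < (C + \<bar>l\<bar>) * 2 powr (3/2) + C" using C by (simp add: add_pos_pos mult_pos_pos add_pos_nonneg add_nonneg_pos)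
    fix t s :: real
    define R where "R = 1 + \<bar>t\<bar>"
    have R: "1 \<le> R" "\<bar>t\<bar> \<le> R" "0 < R" by (auto simp: R_def)
    let ?K = "decay_kernel (s / R)"
    have sR: "\<bar>s / R\<bar> \<le> \<bar>s\<bar>" using R by (simp add: abs_divide divide_le_eq mult_le_cancel_left1)
    have k1: "decay_kernel s \<le> ?K" by (rule decay_kernel_antimono[OF sR])
    have k2: "decay_kernel (s - t) \<le> 2 powr (3/2) * ?K"
    proof -
      have "decay_kernel (s - t) \<le> decay_kernel ((s - t) / R)"
        by (rule decay_kernel_antimono) (use R in \<open>simp add: abs_divide divide_le_eq mult_le_cancel_left1\<close>)
      also have "\<dots> \<le> 2 powr (3/2) * ?K"
      proof (rule decay_kernel_comparison)
        have "s / R = (s - t) / R + t / R" by (simp add: add_divide_distrib[symmetric])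
        then have "\<bar>s / R\<bar> \<le> \<bar>(s - t) / R\<bar> + \<bar>t / R\<bar>" by (simp only: abs_triangle_ineq)
        moreover have "\<bar>t / R\<bar> \<le> 1" using R by (simp add: abs_divide)
        moreover have "1 + a \<le> 2 * (1 + b)" if "a \<le> b + c" "c \<le> 1" "0 \<le> b" for a b c :: real
          using that by (simp add: distrib_left)
        ultimately show "1 + \<bar>s / R\<bar> \<le> 2 * (1 + \<bar>(s - t) / R\<bar>)" by (meson abs_ge_zero)
      qed simp
      finally show ?thesis .
    qed
    have step: "\<bar>(if 0 \<le> s - t then l else 0) - (if 0 \<le> s then l else 0)\<bar> \<le> \<bar>l\<bar> * (2 powr (3/2) * ?K)"
    proof (cases "0 \<le> s - t \<longleftrightarrow> 0 \<le> s")
      case False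
      then have "\<bar>s\<bar> \<le> R" using R by auto
      then have "decay_kernel 0 \<le> 2 powr (3/2) * ?K"
        using R by (intro decay_kernel_comparison) (auto simp: abs_divide)
      then have "\<bar>l\<bar> * 1 \<le> \<bar>l\<bar> * (2 powr (3/2) * ?K)"
        by (intro mult_left_mono) (simp_all add: decay_kernel_def)
      then show ?thesis using False by (auto split: if_splits)
    qed (auto split: if_splits)
    have "\<bar>renewal_shift t s\<bar> \<le> C * decay_kernel (s - t) + C * decay_kernel s + \<bar>l\<bar> * (2 powr (3/2) * ?K)"
      using l[of "s - t"] l[of s] step unfolding renewal_shift_def by linarith
    also have "\<dots> \<le> C * (2 powr (3/2) * ?K) + C * ?K + \<bar>l\<bar> * (2 powr (3/2) * ?K)"
      using C k1 k2 by (intro add_mono mult_left_mono) auto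
    also have "\<dots> = ((C + \<bar>l\<bar>) * 2 powr (3/2) + C) * ?K" by (simp add: algebra_simps)
    finally show "\<bar>renewal_shift t s\<bar> \<le> ((C + \<bar>l\<bar>) * 2 powr (3/2) + C) * decay_kernel (s / (1 + \<bar>t\<bar>))"
      by (simp add: R_def)
  qed
qed

lemma renewal_shift_dominated: "\<exists>C\<ge>0. \<forall>s. \<bar>renewal_shift t s\<bar> \<le> C * decay_kernel s"
proof -
  obtain C where C: "0 < C" "\<And>t s. \<bar>renewal_shift t s\<bar> \<le> C * decay_kernel (s / (1 + \<bar>t\<bar>))"
    using renewal_shift_bound by blast
  have "decay_kernel (s / (1 + \<bar>t\<bar>)) \<le> (1 + \<bar>t\<bar>) powr (3/2) * decay_kernel s" for s
    by (rule decay_kernel_comparison) (auto simp: distrib_left)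
  then have "\<bar>renewal_shift t s\<bar> \<le> C * ((1 + \<bar>t\<bar>) powr (3/2) * decay_kernel s)" for s
    using C by (meson mult_left_mono order_trans less_imp_le)
  then show ?thesis using C by (intro exI[of _ "C * (1 + \<bar>t\<bar>) powr (3/2)"]) (auto simp: mult.assoc)
qed

lemma renewal_shift_unit_mean:
  assumes f: "tempered f"
  shows "(LINT s|lborel. complex_of_real (renewal_shift t s) * unit_mean f (x + s)) =
    (LINT y|lborel. complex_of_real (LINT s|lborel. renewal_shift t s * indicator {0..1} (y - s)) * f (x + y))"
proof -
  have [measurable]: "f \<in> borel_measurable borel" using f by (rule tempered_borel)
  obtain C where C: "0 \<le> C" "\<And>s. \<bar>renewal_shift t s\<bar> \<le> C * decay_kernel s"
    using renewal_shift_dominated by blast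
  let ?h = "\<lambda>s y. complex_of_real (renewal_shift t s * indicator {0..1} (y - s)) * f (x + y)"
  have aff: "(LINT y|lborel. ?h s y) = complex_of_real (renewal_shift t s) * unit_mean f (x + s)" for s
  proof -
    have "(LINT y|lborel. ?h s y) = (LINT y|lborel. ?h s (s + 1 * y))"
      by (subst lborel_integral_real_affine[of 1 _ s]) auto
    also have "\<dots> = (LINT y|lborel. complex_of_real (renewal_shift t s) * (complex_of_real (indicator {0..1} y) * f ((x + s) + y)))"
      by (simp add: mult.assoc add.assoc)
    finally show ?thesis by (simp add: unit_mean_def)
  qed
  have naff: "(\<integral>\<^sup>+y. ennreal (norm (?h s y)) \<partial>lborel) \<le> ennreal C * ennreal (decay_kernel s) * (ennreal (2 powr (3/2)) * kernel_mean 1 (ennorm f) (x + s))" for s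
  proof -
    have "(\<integral>\<^sup>+y. ennreal (norm (?h s y)) \<partial>lborel) = (\<integral>\<^sup>+y. ennreal (norm (?h s (s + 1 * y))) \<partial>lborel)"
      by (subst nn_integral_real_affine[of _ 1 s]) auto
    also have "\<dots> = (\<integral>\<^sup>+y. ennreal \<bar>renewal_shift t s\<bar> * ennreal (norm (complex_of_real (indicator {0..1} y) * f ((x + s) + y))) \<partial>lborel)"
      by (simp add: norm_mult ennreal_mult mult.assoc add.assoc)
    also have "\<dots> = ennreal \<bar>renewal_shift t s\<bar> * (\<integral>\<^sup>+y. ennreal (norm (complex_of_real (indicator {0..1} y) * f ((x + s) + y))) \<partial>lborel)"
      by (rule nn_integral_cmult) measurable
    also have "\<dots> \<le> (ennreal C * ennreal (decay_kernel s)) * (ennreal (2 powr (3/2)) * kernel_mean 1 (ennorm f) (x + s))"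
      using C by (intro mult_mono nn_integral_dominated_kernel[OF f indicator_le_decay_kernel])
        (auto simp: ennreal_mult[symmetric] ennreal_leI)
    finally show ?thesis .
  qed
  have int: "integrable (lborel \<Otimes>\<^sub>M lborel) (case_prod ?h)"
  proof (rule integrableI_bounded)
    show "case_prod ?h \<in> borel_measurable (lborel \<Otimes>\<^sub>M lborel)" unfolding indicator_def by measurable
    have "(\<integral>\<^sup>+z. ennreal (norm (case_prod ?h z)) \<partial>(lborel \<Otimes>\<^sub>M lborel)) = (\<integral>\<^sup>+s. \<integral>\<^sup>+y. ennreal (norm (?h s y)) \<partial>lborel \<partial>lborel)"
    proof -
      have [measurable]: "case_prod ?h \<in> borel_measurable (lborel \<Otimes>\<^sub>M lborel)" unfolding indicator_def by measurable
      show ?thesis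
        by (subst lborel.nn_integral_fst[symmetric]) auto
    qed
    also have "\<dots> \<le> (\<integral>\<^sup>+s. ennreal C * ennreal (decay_kernel s) * (ennreal (2 powr (3/2)) * kernel_mean 1 (ennorm f) (x + s)) \<partial>lborel)"
      by (rule nn_integral_mono) (rule naff)
    also have "\<dots> = (\<integral>\<^sup>+s. ennreal C * ennreal (2 powr (3/2)) * (ennreal (decay_kernel s) * kernel_mean 1 (ennorm f) (x + s)) \<partial>lborel)"
      by (simp add: mult_ac)
    also have "\<dots> = ennreal C * ennreal (2 powr (3/2)) * kernel_mean 1 (kernel_mean 1 (ennorm f)) x"
      unfolding kernel_mean_def[of 1 _ x] by (subst nn_integral_cmult) auto
    also have "\<dots> \<le> ennreal C * ennreal (2 powr (3/2)) * (ennreal conv_const * kernel_mean 1 (ennorm f) x)"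
      by (intro mult_left_mono kernel_mean_iterate) auto
    also have "\<dots> < \<infinity>" using tempered_kernel_mean_finite[OF f, of x] by (simp add: ennreal_mult_less_top)
    finally show "(\<integral>\<^sup>+z. ennreal (norm (case_prod ?h z)) \<partial>(lborel \<Otimes>\<^sub>M lborel)) < \<infinity>" .
  qed
  have "(LINT s|lborel. complex_of_real (renewal_shift t s) * unit_mean f (x + s)) = (LINT s|lborel. LINT y|lborel. ?h s y)"
    by (simp only: aff)
  also have "\<dots> = (LINT y|lborel. LINT s|lborel. ?h s y)"
    by (rule lborel_pair.Fubini_integral[symmetric]) (use int in \<open>simp add: split_beta'\<close>)
  also have "\<dots> = (LINT y|lborel. complex_of_real (LINT s|lborel. renewal_shift t s * indicator {0..1} (y - s)) * f (x + y))"
    by (simp only: integral_mult_left_zero integral_complex_of_real)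
  finally show ?thesis .
qed

text \<open>
  This is the factorisation of the translation difference through \<open>I - T\<close>. Convolving
  \<open>I - T\<close> applied to f with the difference of renewal densities leaves, by the renewal
  equation, only the unit means at \<open>x + t\<close> and at x, and these cancel the means inside
  the two mean defects. Moving the mean from f to the density (\<open>renewal_shift_unit_mean\<close>)
  is an application of Fubini's theorem.
\<close>
lemma shift_difference_identity:
  assumes f: "tempered f"
  shows "f (x + t) - f x = mean_defect f (x + t) - mean_defect f x +
    (LINT s|lborel. complex_of_real (renewal_shift t s) * mean_defect f (x + s))"
proof -
  obtain C where C: "0 \<le> C" "\<And>s. \<bar>renewal_shift t s\<bar> \<le> C * decay_kernel s"
    using renewal_shift_dominated by blast
  note int = integrable_dominated_kernel[OF _ renewal_shift_borel C(2) C(1)]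
  let ?e = "\<lambda>y::real. indicator {0..<1} (y - t) - indicator {0..<1} y :: real"
  let ?w = "renewal_shift t"
  have ib: "\<bar>indicator {0..<1} s :: real\<bar> \<le> 2 powr (3/2) * decay_kernel s" for s
    using indicator_le_decay_kernel[of s] by (auto simp: indicator_def split: if_splits)
  \<comment> \<open>The renewal equation produces the half-open unit interval, the mean uses the closed one.\<close>
  have m1: "(LINT y|lborel. complex_of_real (indicator {0..<1} y) * f (x + y)) = unit_mean f x" for x
    unfolding unit_mean_def
  proof (rule integral_cong_AE)
    have [measurable]: "f \<in> borel_measurable borel" using f by (rule tempered_borel)
    show "(\<lambda>y. complex_of_real (indicator {0..<1} y) * f (x + y)) \<in> borel_measurable lborel"
      "(\<lambda>y. complex_of_real (indicator {0..1} y) * f (x + y)) \<in> borel_measurable lborel" by measurable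
    show "AE y in lborel. complex_of_real (indicator {0..<1} y) * f (x + y) = complex_of_real (indicator {0..1} y) * f (x + y)"
      using AE_lborel_singleton[of "1::real"] by eventually_elim (auto simp: indicator_def)
  qed
  have i0: "integrable lborel (\<lambda>y. complex_of_real (indicator {0..<1} y) * f (x + y))" for x
    by (rule integrable_dominated_kernel[OF f _ ib]) auto
  have it: "integrable lborel (\<lambda>y. complex_of_real (indicator {0..<1} (y - t)) * f (x + y))"
    using lborel_integrable_real_affine[OF i0[of "x + t"], of 1 "-t"] by simp
  have m2: "(LINT y|lborel. complex_of_real (indicator {0..<1} (y - t)) * f (x + y)) = unit_mean f (x + t)"
    using lborel_integral_real_affine[of 1 "\<lambda>y. complex_of_real (indicator {0..<1} (y - t)) * f (x + y)" t] m1[of "x + t"]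
    by (simp add: add.assoc)
  have "(LINT s|lborel. complex_of_real (?w s) * mean_defect f (x + s)) =
     (LINT s|lborel. complex_of_real (?w s) * f (x + s)) - (LINT s|lborel. complex_of_real (?w s) * unit_mean f (x + s))"
    unfolding mean_defect_def right_diff_distrib
    by (rule Bochner_Integration.integral_diff[OF int[OF f] int[OF tempered_unit_mean[OF f]]])
  also have "\<dots> = (LINT s|lborel. complex_of_real (?w s) * f (x + s)) - (LINT y|lborel. complex_of_real (?w y - ?e y) * f (x + y))"
    unfolding renewal_shift_unit_mean[OF f] renewal_shift_equation ..
  also have "(LINT y|lborel. complex_of_real (?w y - ?e y) * f (x + y)) =
     (LINT y|lborel. complex_of_real (?w y) * f (x + y) - (complex_of_real (indicator {0..<1} (y - t)) * f (x + y) - complex_of_real (indicator {0..<1} y) * f (x + y)))"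
    by (simp add: algebra_simps)
  also have "\<dots> = (LINT s|lborel. complex_of_real (?w s) * f (x + s)) - (unit_mean f (x + t) - unit_mean f x)"
    by (subst Bochner_Integration.integral_diff[OF int[OF f] Bochner_Integration.integrable_diff[OF it i0]])
       (simp add: Bochner_Integration.integral_diff[OF it i0] m1 m2)
  finally show ?thesis by (simp add: mean_defect_def)
qed

definition shift_difference :: "real \<Rightarrow> (real \<Rightarrow> complex) \<Rightarrow> real \<Rightarrow> complex" where
  "shift_difference t f x = f (x + t) - f x"

lemma tempered_shift_difference: "tempered f \<Longrightarrow> tempered (shift_difference t f)"
  unfolding shift_difference_def[abs_def] by (intro tempered_diff tempered_shift)

lemma tempered_shift_difference_iterate: "tempered f \<Longrightarrow> tempered ((shift_difference t ^^ k) f)"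
  by (induction k) (auto intro: tempered_shift_difference)

lemma mean_defect_shift_difference:
  assumes f: "tempered f"
  shows "mean_defect (shift_difference t f) = shift_difference t (mean_defect f)"
proof
  fix x
  have "unit_mean (shift_difference t f) x = unit_mean f (x + t) - unit_mean f x"
    using Bochner_Integration.integral_diff[OF unit_mean_integrable[OF f, of "x + t"] unit_mean_integrable[OF f, of x]]
    by (simp add: unit_mean_def shift_difference_def right_diff_distrib add_ac)
  then show "mean_defect (shift_difference t f) x = shift_difference t (mean_defect f) x"
    by (simp add: mean_defect_def shift_difference_def)
qed

lemma mean_defect_shift_difference_iterate:
  "tempered f \<Longrightarrow> mean_defect ((shift_difference t ^^ k) f) = (shift_difference t ^^ k) (mean_defect f)"
  by (induction k) (simp_all add: mean_defect_shift_difference tempered_shift_difference_iterate)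

lemma shift_difference_bound:
  obtains C where "0 < C" "\<And>f t x. tempered f \<Longrightarrow>
    ennreal (norm (shift_difference t f x)) \<le> difference_majorant C t (ennorm (mean_defect f)) x"
proof -
  obtain C where C: "0 < C" "\<And>t s. \<bar>renewal_shift t s\<bar> \<le> C * decay_kernel (s / (1 + \<bar>t\<bar>))"
    using renewal_shift_bound by blast
  show thesis
  proof (rule that[OF C(1)])
    fix f and t x :: real assume f: "tempered f"
    let ?g = "mean_defect f"
    have g: "tempered ?g" using f by (rule tempered_mean_defect)
    have [measurable]: "?g \<in> borel_measurable borel" using g by (rule tempered_borel)
    define R where "R = 1 + \<bar>t\<bar>"
    have R: "0 < R" by (simp add: R_def)
    obtain C' where C': "0 \<le> C'" "\<And>s. \<bar>renewal_shift t s\<bar> \<le> C' * decay_kernel s"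
      using renewal_shift_dominated by blast
    have int: "integrable lborel (\<lambda>s. complex_of_real (renewal_shift t s) * ?g (x + s))"
      by (rule integrable_dominated_kernel[OF g renewal_shift_borel C'(2) C'(1)])
    let ?I = "LINT s|lborel. complex_of_real (renewal_shift t s) * ?g (x + s)"
    have "ennreal (norm ?I) \<le> (\<integral>\<^sup>+s. ennreal (norm (complex_of_real (renewal_shift t s) * ?g (x + s))) \<partial>lborel)"
      by (rule integral_norm_bound_ennreal[OF int])
    also have "\<dots> \<le> (\<integral>\<^sup>+s. ennreal (C * R) * (ennreal (decay_kernel (s / R) / R) * ennreal (norm (?g (x + s)))) \<partial>lborel)"
    proof (rule nn_integral_mono)
      fix s
      have "norm (complex_of_real (renewal_shift t s) * ?g (x + s)) \<le> (C * decay_kernel (s / R)) * norm (?g (x + s))"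
        unfolding norm_mult by (rule mult_right_mono) (use C(2)[of t s] in \<open>auto simp: R_def\<close>)
      also have "\<dots> = (C * R) * (decay_kernel (s / R) / R * norm (?g (x + s)))" using R by simp
      finally show "ennreal (norm (complex_of_real (renewal_shift t s) * ?g (x + s))) \<le> ennreal (C * R) * (ennreal (decay_kernel (s / R) / R) * ennreal (norm (?g (x + s))))"
        using C R by (simp add: ennreal_mult[symmetric] ennreal_leI)
    qed
    also have "\<dots> = ennreal (C * R) * kernel_mean R (ennorm ?g) x"
      unfolding kernel_mean_def by (rule nn_integral_cmult) measurable
    finally have I: "ennreal (norm ?I) \<le> ennreal (C * R) * kernel_mean R (ennorm ?g) x" .
    have "norm (shift_difference t f x) \<le> norm (?g (x + t)) + norm (?g x) + norm ?I"
      unfolding shift_difference_def shift_difference_identity[OF f]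
      by (meson norm_triangle_ineq norm_triangle_ineq4 add_right_mono order_trans)
    then have "ennreal (norm (shift_difference t f x)) \<le> ennreal (norm (?g (x + t))) + ennreal (norm (?g x)) + ennreal (norm ?I)"
      by (simp flip: ennreal_plus)
    also have "\<dots> \<le> difference_majorant C t (ennorm ?g) x"
      unfolding difference_majorant_def R_def[symmetric] by (intro add_mono order_refl I)
    finally show "ennreal (norm (shift_difference t f x)) \<le> difference_majorant C t (ennorm ?g) x" .
  qed
qed

text \<open>
  Translation differences commute with the mean defect, so each of the k differences can be exchanged
  for one mean defect and one application of the majorant.
\<close>
lemma shift_difference_iterate_bound:
  obtains C where "0 < C" "\<And>f t x k. tempered f \<Longrightarrow>
    ennreal (norm ((shift_difference t ^^ k) f x)) \<le> (difference_majorant C t ^^ k) (ennorm ((mean_defect ^^ k) f)) x"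
proof -
  obtain C where C: "0 < C" "\<And>f t x. tempered f \<Longrightarrow>
    ennreal (norm (shift_difference t f x)) \<le> difference_majorant C t (ennorm (mean_defect f)) x"
    using shift_difference_bound by blast
  show thesis
  proof (rule that[OF C(1)])
    fix f and t x :: real and k assume "tempered f"
    then show "ennreal (norm ((shift_difference t ^^ k) f x)) \<le> (difference_majorant C t ^^ k) (ennorm ((mean_defect ^^ k) f)) x"
    proof (induction k arbitrary: f x)
      case (Suc k)
      note f = \<open>tempered f\<close>
      have "ennreal (norm ((shift_difference t ^^ Suc k) f x)) \<le>
        difference_majorant C t (\<lambda>y. ennreal (norm (mean_defect ((shift_difference t ^^ k) f) y))) x"
        using C(2)[OF tempered_shift_difference_iterate[OF f]] by simp
      also have "\<dots> \<le> difference_majorant C t ((difference_majorant C t ^^ k) (ennorm ((mean_defect ^^ k) (mean_defect f)))) x"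
        unfolding mean_defect_shift_difference_iterate[OF f]
        by (rule difference_majorant_mono) (rule Suc.IH[OF tempered_mean_defect[OF f]])
      finally show ?case by (simp add: funpow_swap1)
    qed simp
  qed
qed

lemma shift_difference_iterate_sum:
  "(shift_difference t ^^ k) f x = (\<Sum>v\<le>k. (- 1) ^ (k - v) * of_nat (k choose v) * f (x + real v * t))"
proof (induction k arbitrary: x)
  case (Suc k)
  let ?c = "\<lambda>k v. (- 1) ^ (k - v) * of_nat (k choose v) :: complex"
  have "(shift_difference t ^^ Suc k) f x = (\<Sum>v\<le>k. ?c k v * f (x + t + real v * t)) - (\<Sum>v\<le>k. ?c k v * f (x + real v * t))"
    by (simp add: shift_difference_def Suc)
  also have "(\<Sum>v\<le>k. ?c k v * f (x + real v * t)) = (\<Sum>v\<le>Suc k. ?c k v * f (x + real v * t))"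
    by simp
  also have "\<dots> = ?c k 0 * f x + (\<Sum>v\<le>k. ?c k (Suc v) * f (x + real (Suc v) * t))"
    by (subst sum.atMost_Suc_shift) simp
  also have "(\<Sum>v\<le>k. ?c k v * f (x + t + real v * t)) - \<dots> = - ?c k 0 * f x + (\<Sum>v\<le>k. (?c k v - ?c k (Suc v)) * f (x + real (Suc v) * t))"
    by (simp add: sum_subtractf[symmetric] algebra_simps)
  also have "(\<Sum>v\<le>k. (?c k v - ?c k (Suc v)) * f (x + real (Suc v) * t)) = (\<Sum>v\<le>k. ?c (Suc k) (Suc v) * f (x + real (Suc v) * t))"
  proof (rule sum.cong[OF refl])
    fix v assume "v \<in> {..k}"
    have "?c k v - ?c k (Suc v) = ?c (Suc k) (Suc v)"
    proof (cases "v = k")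
      case False
      then have "k - v = Suc (k - Suc v)" using \<open>v \<in> {..k}\<close> by simp
      then show ?thesis by (simp add: algebra_simps)
    qed simp
    then show "(?c k v - ?c k (Suc v)) * f (x + real (Suc v) * t) = ?c (Suc k) (Suc v) * f (x + real (Suc v) * t)" by simp
  qed
  also have "- ?c k 0 * f x + \<dots> = (\<Sum>v\<le>Suc k. ?c (Suc k) v * f (x + real v * t))"
    by (subst sum.atMost_Suc_shift) simp
  finally show ?case .
qed simp

section \<open>A pointwise bound for the approximation error\<close>

text \<open>
  Substitution: the kernel dilated by R is the unit kernel for the function rescaled by R.
\<close>
lemma kernel_mean_dilate:
  assumes [measurable]: "F \<in> borel_measurable borel" and R: "0 < R"
  shows "(\<integral>\<^sup>+s. ennreal (decay_kernel s) * F (x + R * s) \<partial>lborel) = kernel_mean R F x"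
proof -
  have "kernel_mean R F x = ennreal \<bar>R\<bar> * (\<integral>\<^sup>+s. ennreal (decay_kernel ((0 + R * s) / R) / R) * F (x + (0 + R * s)) \<partial>lborel)"
    unfolding kernel_mean_def by (rule nn_integral_real_affine) (use R in auto)
  also have "\<dots> = (\<integral>\<^sup>+s. ennreal R * (ennreal (decay_kernel s / R) * F (x + R * s)) \<partial>lborel)"
    using R by (simp add: nn_integral_cmult)
  also have "\<dots> = (\<integral>\<^sup>+s. ennreal (decay_kernel s) * F (x + R * s) \<partial>lborel)"
    using R by (simp add: mult.assoc[symmetric] ennreal_mult[symmetric])
  finally show ?thesis ..
qed

lemma bernstein_g_nonneg [simp]: "0 \<le> bernstein_g \<sigma> r t"
  by (simp add: bernstein_g_def)

lemma bernstein_g_borel [measurable]: "bernstein_g \<sigma> r \<in> borel_measurable borel"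
  unfolding bernstein_g_def[abs_def] by measurable

lemma bernstein_G_borel [measurable]: "bernstein_G \<sigma> r k \<in> borel_measurable borel"
  unfolding bernstein_G_def[abs_def] by measurable

lemma bernstein_g_le:
  assumes r: "1 \<le> r" and n: "n \<le> 2 * r"
  shows "bernstein_g 1 r t \<le> 4 ^ r / (1 + \<bar>t\<bar>) ^ n"
proof -
  have "\<bar>1 / t * sin (1 * t / (2 * real r))\<bar> \<le> 2 / (1 + \<bar>t\<bar>)"
  proof (cases "\<bar>t\<bar> < 1")
    case False
    have "\<bar>1 / t * sin (1 * t / (2 * real r))\<bar> \<le> 1 / \<bar>t\<bar>"
      using abs_sin_le_one[of "t / (2 * real r)"] False by (simp add: abs_mult divide_right_mono)
    also have "\<dots> \<le> 2 / (1 + \<bar>t\<bar>)" using False by (simp add: field_simps)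
    finally show ?thesis .
  next
    case True
    have "\<bar>1 / t * sin (1 * t / (2 * real r))\<bar> \<le> 1 / \<bar>t\<bar> * \<bar>t / (2 * real r)\<bar>"
      unfolding abs_mult by (intro mult_mono) (use abs_sin_x_le_abs_x[of "t / (2 * real r)"] in auto)
    also have "\<dots> \<le> 1" using r by (cases "t = 0") (auto simp: abs_divide field_simps)
    also have "1 \<le> 2 / (1 + \<bar>t\<bar>)" using True by (simp add: field_simps)
    finally show ?thesis .
  qed
  then have "\<bar>1 / t * sin (1 * t / (2 * real r))\<bar> ^ (2 * r) \<le> (2 / (1 + \<bar>t\<bar>)) ^ (2 * r)"
    by (rule power_mono) simp
  then have "bernstein_g 1 r t \<le> (2 / (1 + \<bar>t\<bar>)) ^ (2 * r)"
    unfolding bernstein_g_def by (subst (asm) power_even_abs) auto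
  also have "\<dots> = 4 ^ r / (1 + \<bar>t\<bar>) ^ (2 * r)"
    unfolding power_divide by (simp add: power_mult)
  also have "\<dots> \<le> 4 ^ r / (1 + \<bar>t\<bar>) ^ n"
    by (intro divide_left_mono power_increasing n mult_pos_pos) auto
  finally show ?thesis .
qed

lemma bernstein_g_le_decay_kernel:
  assumes "1 \<le> r" shows "bernstein_g 1 r t \<le> 4 ^ r * decay_kernel t"
proof -
  have "bernstein_g 1 r t \<le> 4 ^ r / (1 + \<bar>t\<bar>) ^ 2" using assms by (intro bernstein_g_le) auto
  also have "\<dots> = 4 ^ r * (1 + \<bar>t\<bar>) powr (-2)"
    by (simp add: powr_minus_divide powr_numeral)
  also have "\<dots> \<le> 4 ^ r * (1 + \<bar>t\<bar>) powr (-3/2)"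
    by (intro mult_left_mono powr_mono) auto
  finally show ?thesis by (simp add: decay_kernel_def)
qed

lemma bernstein_g_integrable: assumes "1 \<le> r" shows "integrable lborel (bernstein_g 1 r)"
proof (rule integrableI_bounded)
  have "(\<integral>\<^sup>+t. ennreal (norm (bernstein_g 1 r t)) \<partial>lborel) \<le> (\<integral>\<^sup>+t. ennreal (4 ^ r) * ennreal (decay_kernel t) \<partial>lborel)"
    by (intro nn_integral_mono) (use bernstein_g_le_decay_kernel[OF assms] in \<open>simp add: ennreal_mult[symmetric] ennreal_leI\<close>)
  also have "\<dots> < \<infinity>" using kernel_mass by (simp add: nn_integral_cmult ennreal_mult_less_top)
  finally show "(\<integral>\<^sup>+t. ennreal (norm (bernstein_g 1 r t)) \<partial>lborel) < \<infinity>" .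
qed simp

lemma bernstein_gamma_eq: "bernstein_gamma r \<sigma> = (LINT t|lborel. bernstein_g \<sigma> r t)"
  unfolding bernstein_gamma_def bernstein_g_def by (rule integral_completion) simp

lemma bernstein_gamma_pos: assumes r: "1 \<le> r" shows "0 < bernstein_gamma r 1"
proof -
  have "bernstein_gamma r 1 \<noteq> 0"
  proof
    assume "bernstein_gamma r 1 = 0"
    then have "AE t in lborel. bernstein_g 1 r t = 0"
      unfolding bernstein_gamma_eq
      by (subst (asm) integral_nonneg_eq_0_iff_AE[OF bernstein_g_integrable[OF r]]) auto
    moreover have "bernstein_g 1 r t \<noteq> 0" if "t \<in> {0<..<1}" for t
    proof -
      have "t / (2 * real r) \<le> t / 1" using that r by (intro divide_left_mono) auto
      then have "t / (2 * real r) < pi" using that pi_gt3 by simp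
      then have "0 < sin (t / (2 * real r))" using that r by (intro sin_gt_zero) auto
      then show ?thesis using that by (simp add: bernstein_g_def)
    qed
    ultimately have "AE t in lborel. t \<notin> {0<..<1::real}" by (auto elim!: eventually_mono)
    then have "emeasure lborel {0<..<1::real} = 0"
      by (subst (asm) AE_iff_measurable[of "{0<..<1}"]) auto
    then show False by simp
  qed
  moreover have "0 \<le> bernstein_gamma r 1" unfolding bernstein_gamma_eq by (rule integral_nonneg_AE) auto
  ultimately show ?thesis by simp
qed

lemma bernstein_dilate_integrable:
  assumes r: "1 \<le> r" and f: "tempered f"
  shows "integrable lborel (\<lambda>t. complex_of_real (bernstein_g 1 r t) * f (x + real v * t))"
proof (cases "v = 0")
  case True
  then show ?thesis using bernstein_g_integrable[OF r] by simp
next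
  case False
  have "integrable lborel (\<lambda>s. complex_of_real (bernstein_g 1 r (s / real v)) * f (x + s))"
  proof (rule integrable_dominated_kernel[OF f])
    fix s
    have "bernstein_g 1 r (s / real v) \<le> 4 ^ r * decay_kernel (s / real v)"
      by (rule bernstein_g_le_decay_kernel[OF r])
    also have "\<dots> \<le> 4 ^ r * (real v powr (3/2) * decay_kernel s)"
      by (intro mult_left_mono decay_kernel_comparison) (use False in \<open>auto simp: distrib_left abs_divide\<close>)
    finally show "\<bar>bernstein_g 1 r (s / real v)\<bar> \<le> (4 ^ r * real v powr (3/2)) * decay_kernel s"
      by (simp add: mult.assoc)
  qed auto
  from lborel_integrable_real_affine[OF this, of "real v" 0] False show ?thesis by simp
qed

text \<open>
  Substituting \<open>u = x + v * t\<close> in the v-th summand of \<open>G\<close> turns it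
  into a binomial coefficient times f at \<open>x + v * t\<close>, integrated against the one
  kernel g. The missing term \<open>v = 0\<close> of the k-th difference is f itself, since
  \<open>\<gamma>\<close> is the integral of g.
\<close>
lemma bernstein_D_representation:
  assumes r: "1 \<le> r" and f: "tempered f"
  shows "f x - bernstein_D r 1 k f x = complex_of_real ((- 1) ^ k / bernstein_gamma r 1) *
    (LINT t|lborel. complex_of_real (bernstein_g 1 r t) * (shift_difference t ^^ k) f x)"
proof -
  have [measurable]: "f \<in> borel_measurable borel" using f by (rule tempered_borel)
  let ?g = "bernstein_g 1 r"
  define \<gamma> where "\<gamma> = bernstein_gamma r 1"
  have \<gamma>: "0 < \<gamma>" using bernstein_gamma_pos[OF r] by (simp add: \<gamma>_def)
  define J where "J v = (LINT t|lborel. complex_of_real (?g t) * f (x + real v * t))" for v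
  define c where "c v = (- 1) ^ (k - v) * complex_of_nat (k choose v)" for v
  have J0: "J 0 = complex_of_real \<gamma> * f x"
    by (simp add: J_def \<gamma>_def bernstein_gamma_eq)
  have aff: "integrable lborel (\<lambda>u. f u * complex_of_real (?g ((u - x) / real v)))"
    "(LINT u|lborel. f u * complex_of_real (?g ((u - x) / real v))) = of_nat v * J v" if "v \<noteq> 0" for v
  proof -
    have e: "(\<lambda>t. f (x + real v * t) * complex_of_real (?g ((x + real v * t - x) / real v))) = (\<lambda>t. complex_of_real (?g t) * f (x + real v * t))"
      using that by (simp add: mult.commute)
    have "integrable lborel (\<lambda>t. f (x + real v * t) * complex_of_real (?g ((x + real v * t - x) / real v)))"
      unfolding e by (rule bernstein_dilate_integrable[OF r f])
    then show "integrable lborel (\<lambda>u. f u * complex_of_real (?g ((u - x) / real v)))"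
      using lborel_integrable_real_affine_iff[of "real v" "\<lambda>u. f u * complex_of_real (?g ((u - x) / real v))" x] that by simp
    show "(LINT u|lborel. f u * complex_of_real (?g ((u - x) / real v))) = of_nat v * J v"
      using lborel_integral_real_affine[of "real v" "\<lambda>u. f u * complex_of_real (?g ((u - x) / real v))" x] that
      unfolding e J_def by (simp add: scaleR_conv_of_real)
  qed
  have "(LINT t|lborel. complex_of_real (?g t) * (shift_difference t ^^ k) f x) =
    (LINT t|lborel. (\<Sum>v\<le>k. c v * (complex_of_real (?g t) * f (x + real v * t))))"
    unfolding shift_difference_iterate_sum c_def by (simp add: sum_distrib_left mult_ac)
  also have "\<dots> = (\<Sum>v\<le>k. c v * J v)"
    unfolding J_def
    by (subst Bochner_Integration.integral_sum)
       (auto intro!: Bochner_Integration.integrable_mult_right bernstein_dilate_integrable r f)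
  also have "\<dots> = c 0 * J 0 + (\<Sum>v = 1..k. c v * J v)"
  proof -
    have "{..k} = insert 0 {1..k}" by auto
    then show ?thesis by simp
  qed
  finally have lhs: "(LINT t|lborel. complex_of_real (?g t) * (shift_difference t ^^ k) f x) = (- 1) ^ k * complex_of_real \<gamma> * f x + (\<Sum>v = 1..k. c v * J v)"
    by (simp add: J0 c_def)
  have "(LINT u|lebesgue. f u * complex_of_real (bernstein_G 1 r k (u - x))) = (LINT u|lborel. f u * complex_of_real (bernstein_G 1 r k (u - x)))"
    by (rule integral_completion) simp
  also have "\<dots> = (LINT u|lborel. (\<Sum>v = 1..k. c v / of_nat v * (f u * complex_of_real (?g ((u - x) / real v)))))"
    by (simp add: bernstein_G_def c_def sum_distrib_left mult_ac)
  also have "\<dots> = (\<Sum>v = 1..k. c v / of_nat v * (of_nat v * J v))"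
    by (subst Bochner_Integration.integral_sum)
       (auto intro!: Bochner_Integration.integrable_mult_right sum.cong aff simp: aff(2))
  also have "\<dots> = (\<Sum>v = 1..k. c v * J v)"
    by (intro sum.cong) auto
  finally have D: "bernstein_D r 1 k f x = complex_of_real ((- 1) ^ (k + 1) / \<gamma>) * (\<Sum>v = 1..k. c v * J v)"
    by (simp add: bernstein_D_def \<gamma>_def)
  \<comment> \<open>The sign in front of f is the product of that of the operator and that of the \<open>v = 0\<close> term.\<close>
  have sq: "(- 1) ^ k * (- 1) ^ k = (1::complex)" by (simp add: power_add[symmetric])
  show ?thesis
    unfolding lhs D \<gamma>_def[symmetric] using \<gamma> sq by (simp add: field_simps)
qed

text \<open>
  The translates in the majorant of the k-th difference integrate against g to dilated decay kernels.
  The remaining term grows like \<open>(1 + \<bar>t\<bar>) ^ k\<close> times the square root of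
  \<open>1 + \<bar>t\<bar>\<close> that is paid for replacing the dilated kernel by the unit one,
  while g decays like \<open>(1 + \<bar>t\<bar>) ^ (k + 2)\<close>; the quotient is again the
  integrable decay kernel.
\<close>
lemma bernstein_D_pointwise_bound:
  assumes r: "1 \<le> r" and kr: "k + 2 \<le> 2 * r"
  obtains B where "0 < B" "\<And>f x. tempered f \<Longrightarrow> ennreal (norm (f x - bernstein_D r 1 k f x)) \<le>
    ennreal B * (ennreal (norm ((mean_defect ^^ k) f x)) + kernel_mean 1 (ennorm ((mean_defect ^^ k) f)) x)"
proof -
  obtain C where C: "0 < C" "\<And>f t x k. tempered f \<Longrightarrow>
    ennreal (norm ((shift_difference t ^^ k) f x)) \<le> (difference_majorant C t ^^ k) (ennorm ((mean_defect ^^ k) f)) x"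
    using shift_difference_iterate_bound by blast
  obtain c where c: "0 \<le> c" and maj: "\<And>F t x. F \<in> borel_measurable borel \<Longrightarrow>
    (difference_majorant C t ^^ k) F x \<le> 2 ^ k * (\<Sum>i\<le>k. F (x + real i * t)) + ennreal (c * (1 + \<bar>t\<bar>) ^ k) * kernel_mean (1 + \<bar>t\<bar>) F x"
    using difference_majorant_iterate[of C k] C(1) by (metis less_imp_le)
  define \<gamma> where "\<gamma> = bernstein_gamma r 1"
  have \<gamma>: "0 < \<gamma>" using bernstein_gamma_pos[OF r] by (simp add: \<gamma>_def)
  define A where "A = 2 ^ k * (real (Suc k) * (4 ^ r * (kernel_mass + real k + 1))) + 4 ^ r * c * kernel_mass"
  have "0 < kernel_mass + real k + 1" using kernel_mass by simp
  then have "0 < 2 ^ k * (real (Suc k) * (4 ^ r * (kernel_mass + real k + 1)))"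
    by (intro mult_pos_pos) auto
  then have A: "0 < A" unfolding A_def by (rule add_pos_nonneg) (use c kernel_mass in simp)
  show thesis
  proof (rule that[of "A / \<gamma>"])
    show "0 < A / \<gamma>" using A \<gamma> by simp
    fix f and x :: real assume f: "tempered f"
    let ?g = "bernstein_g 1 r"
    define F where "F y = ennreal (norm ((mean_defect ^^ k) f y))" for y
    have [measurable]: "F \<in> borel_measurable borel"
      unfolding F_def using tempered_borel[OF tempered_mean_defect_iterate[OF f, of k]] by simp
    have iter: "ennreal (norm ((shift_difference t ^^ k) f x)) \<le> (difference_majorant C t ^^ k) F x" for t
      using C(2)[OF f, of k t x] by (simp only: F_def[abs_def])
    define K where "K = kernel_mean 1 F x"
    have gk: "ennreal (?g t) \<le> ennreal (4 ^ r) * ennreal (decay_kernel t)" for t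
      using bernstein_g_le_decay_kernel[OF r, of t] by (simp add: ennreal_mult[symmetric] ennreal_leI)
    have shifts: "(\<integral>\<^sup>+t. ennreal (?g t) * F (x + real i * t) \<partial>lborel) \<le> ennreal (4 ^ r * (kernel_mass + real k + 1)) * (F x + K)" if "i \<le> k" for i
    proof -
      have "(\<integral>\<^sup>+t. ennreal (?g t) * F (x + real i * t) \<partial>lborel) \<le> (\<integral>\<^sup>+t. ennreal (4 ^ r) * (ennreal (decay_kernel t) * F (x + real i * t)) \<partial>lborel)"
        by (intro nn_integral_mono) (use mult_right_mono[OF gk] in \<open>simp add: mult.assoc\<close>)
      also have "\<dots> = ennreal (4 ^ r) * (\<integral>\<^sup>+t. ennreal (decay_kernel t) * F (x + real i * t) \<partial>lborel)"
        by (rule nn_integral_cmult) measurable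
      also have "(\<integral>\<^sup>+t. ennreal (decay_kernel t) * F (x + real i * t) \<partial>lborel) \<le> ennreal (kernel_mass + real k + 1) * (F x + K)"
      proof (cases "i = 0")
        case True
        then have "(\<integral>\<^sup>+t. ennreal (decay_kernel t) * F (x + real i * t) \<partial>lborel) = ennreal kernel_mass * F x"
          by (simp add: nn_integral_multc kernel_mass)
        also have "\<dots> \<le> ennreal (kernel_mass + real k + 1) * (F x + K)"
          by (intro mult_mono ennreal_leI) (auto intro: add_increasing2)
        finally show ?thesis .
      next
        case False
        then have "(\<integral>\<^sup>+t. ennreal (decay_kernel t) * F (x + real i * t) \<partial>lborel) = kernel_mean (real i) F x"
          by (intro kernel_mean_dilate) auto
        also have "\<dots> \<le> ennreal (real i powr (1/2)) * K"
          unfolding K_def by (rule kernel_mean_le_unit_scale) (use False in auto)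
        also have "\<dots> \<le> ennreal (kernel_mass + real k + 1) * (F x + K)"
        proof (intro mult_mono ennreal_leI)
          have "real i powr (1/2) \<le> real i powr 1" using False by (intro powr_mono) auto
          then show "real i powr (1/2) \<le> kernel_mass + real k + 1" using that kernel_mass by simp
        qed (auto intro: add_increasing)
        finally show ?thesis .
      qed
      finally show ?thesis using kernel_mass by (simp add: ennreal_mult mult.assoc mult_left_mono)
    qed
    have tail: "(\<integral>\<^sup>+t. ennreal (?g t) * (ennreal (c * (1 + \<bar>t\<bar>) ^ k) * kernel_mean (1 + \<bar>t\<bar>) F x) \<partial>lborel) \<le> ennreal (4 ^ r * c * kernel_mass) * K"
    proof -
      have "(\<integral>\<^sup>+t. ennreal (?g t) * (ennreal (c * (1 + \<bar>t\<bar>) ^ k) * kernel_mean (1 + \<bar>t\<bar>) F x) \<partial>lborel) \<le> (\<integral>\<^sup>+t. ennreal (4 ^ r * c) * ennreal (decay_kernel t) * K \<partial>lborel)"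
      proof (rule nn_integral_mono)
        fix t :: real
        define R where "R = 1 + \<bar>t\<bar>"
        have R: "1 \<le> R" by (simp add: R_def)
        have "?g t * (c * R ^ k * R powr (1/2)) \<le> 4 ^ r / R ^ (k + 2) * (c * R ^ k * R powr (1/2))"
          unfolding R_def by (rule mult_right_mono[OF bernstein_g_le[OF r kr]]) (use c in auto)
        also have "\<dots> = 4 ^ r * c * (R powr (1/2) / R ^ 2)"
          using R by (simp add: power_add field_simps power2_eq_square)
        also have "R powr (1/2) / R ^ 2 = R powr (-3/2)"
          using R powr_diff[of R "1/2" 2] by (simp add: powr_numeral)
        finally have b: "?g t * (c * R ^ k * R powr (1/2)) \<le> 4 ^ r * c * decay_kernel t" by (simp add: decay_kernel_def R_def)
        have "ennreal (?g t) * (ennreal (c * R ^ k) * kernel_mean R F x) \<le> ennreal (?g t) * (ennreal (c * R ^ k) * (ennreal (R powr (1/2)) * K))"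
          unfolding K_def by (intro mult_left_mono kernel_mean_le_unit_scale R) auto
        also have "\<dots> = ennreal (?g t * (c * R ^ k * R powr (1/2))) * K"
          using c R by (simp add: ennreal_mult mult.assoc)
        also have "\<dots> \<le> ennreal (4 ^ r * c * decay_kernel t) * K" by (intro mult_right_mono ennreal_leI b) auto
        finally show "ennreal (?g t) * (ennreal (c * (1 + \<bar>t\<bar>) ^ k) * kernel_mean (1 + \<bar>t\<bar>) F x) \<le> ennreal (4 ^ r * c) * ennreal (decay_kernel t) * K"
          using c by (simp add: R_def ennreal_mult)
      qed
      also have "\<dots> = ennreal (4 ^ r * c * kernel_mass) * K"
        using c kernel_mass by (simp add: nn_integral_cmult nn_integral_multc ennreal_mult)
      finally show ?thesis .
    qed
    have int: "integrable lborel (\<lambda>t. complex_of_real (?g t) * (shift_difference t ^^ k) f x)"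
    proof -
      have "integrable lborel (\<lambda>t. \<Sum>v\<le>k. ((- 1) ^ (k - v) * of_nat (k choose v)) * (complex_of_real (?g t) * f (x + real v * t)))"
        by (intro Bochner_Integration.integrable_sum Bochner_Integration.integrable_mult_right bernstein_dilate_integrable r f)
      then show ?thesis unfolding shift_difference_iterate_sum by (simp add: sum_distrib_left mult_ac)
    qed
    have "ennreal (norm (LINT t|lborel. complex_of_real (?g t) * (shift_difference t ^^ k) f x)) \<le>
       (\<integral>\<^sup>+t. ennreal (norm (complex_of_real (?g t) * (shift_difference t ^^ k) f x)) \<partial>lborel)"
      by (rule integral_norm_bound_ennreal[OF int])
    also have "\<dots> \<le> (\<integral>\<^sup>+t. 2 ^ k * (\<Sum>i\<le>k. ennreal (?g t) * F (x + real i * t)) + ennreal (?g t) * (ennreal (c * (1 + \<bar>t\<bar>) ^ k) * kernel_mean (1 + \<bar>t\<bar>) F x) \<partial>lborel)"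
    proof (rule nn_integral_mono)
      fix t
      have "ennreal (norm (complex_of_real (?g t) * (shift_difference t ^^ k) f x)) = ennreal (?g t) * ennreal (norm ((shift_difference t ^^ k) f x))"
        by (simp add: norm_mult ennreal_mult)
      also have "\<dots> \<le> ennreal (?g t) * (2 ^ k * (\<Sum>i\<le>k. F (x + real i * t)) + ennreal (c * (1 + \<bar>t\<bar>) ^ k) * kernel_mean (1 + \<bar>t\<bar>) F x)"
        by (rule mult_left_mono[OF order_trans[OF iter maj]]) auto
      finally show "ennreal (norm (complex_of_real (?g t) * (shift_difference t ^^ k) f x)) \<le> 2 ^ k * (\<Sum>i\<le>k. ennreal (?g t) * F (x + real i * t)) + ennreal (?g t) * (ennreal (c * (1 + \<bar>t\<bar>) ^ k) * kernel_mean (1 + \<bar>t\<bar>) F x)"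
        by (simp add: distrib_left sum_distrib_left mult_ac)
    qed
    also have "\<dots> = 2 ^ k * (\<Sum>i\<le>k. \<integral>\<^sup>+t. ennreal (?g t) * F (x + real i * t) \<partial>lborel) + (\<integral>\<^sup>+t. ennreal (?g t) * (ennreal (c * (1 + \<bar>t\<bar>) ^ k) * kernel_mean (1 + \<bar>t\<bar>) F x) \<partial>lborel)"
    proof -
      have [measurable]: "(\<lambda>t. kernel_mean (1 + \<bar>t\<bar>) F x) \<in> borel_measurable borel"
        unfolding kernel_mean_def by measurable
      show ?thesis by (simp add: nn_integral_add nn_integral_cmult nn_integral_sum)
    qed
    also have "\<dots> \<le> 2 ^ k * (\<Sum>i\<le>k. ennreal (4 ^ r * (kernel_mass + real k + 1)) * (F x + K)) + ennreal (4 ^ r * c * kernel_mass) * (F x + K)"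
      by (intro add_mono mult_left_mono sum_mono shifts order_trans[OF tail]) (auto intro: add_increasing)
    also have "\<dots> = ennreal A * (F x + K)"
      unfolding A_def using c kernel_mass
      by (simp add: ennreal_plus ennreal_mult distrib_right mult.assoc ennreal_of_nat_eq_real_of_nat ennreal_power[symmetric] del: of_nat_Suc)
    finally have main: "ennreal (norm (LINT t|lborel. complex_of_real (?g t) * (shift_difference t ^^ k) f x)) \<le> ennreal A * (F x + K)" .
    have "ennreal (norm (f x - bernstein_D r 1 k f x)) = ennreal (1 / \<gamma>) * ennreal (norm (LINT t|lborel. complex_of_real (?g t) * (shift_difference t ^^ k) f x))"
      unfolding bernstein_D_representation[OF r f] \<gamma>_def[symmetric] using \<gamma>
      by (simp add: norm_mult norm_divide norm_power ennreal_mult[symmetric])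
    also have "\<dots> \<le> ennreal (1 / \<gamma>) * (ennreal A * (F x + K))" by (rule mult_left_mono[OF main]) simp
    also have "\<dots> = ennreal (A / \<gamma>) * (F x + K)" using A \<gamma> by (simp add: ennreal_mult[symmetric] mult.assoc[symmetric])
    finally show "ennreal (norm (f x - bernstein_D r 1 k f x)) \<le>
      ennreal (A / \<gamma>) * (ennreal (norm ((mean_defect ^^ k) f x)) + kernel_mean 1 (ennorm ((mean_defect ^^ k) f)) x)"
      by (simp only: F_def[abs_def] K_def)
  qed
qed

lemma bernstein_g_scale:
  assumes "0 < \<sigma>" shows "bernstein_g \<sigma> r x = \<sigma> ^ (2 * r) * bernstein_g 1 r (\<sigma> * x)"
  using assms unfolding bernstein_g_def power_mult_distrib[symmetric] by (simp add: mult.assoc[symmetric])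

lemma bernstein_G_scale:
  assumes "0 < \<sigma>" shows "bernstein_G \<sigma> r k x = \<sigma> ^ (2 * r) * bernstein_G 1 r k (\<sigma> * x)"
  unfolding bernstein_G_def bernstein_g_scale[OF assms] by (simp add: sum_distrib_left mult_ac)

lemma bernstein_gamma_scale:
  assumes "0 < \<sigma>" shows "\<sigma> * bernstein_gamma r \<sigma> = \<sigma> ^ (2 * r) * bernstein_gamma r 1"
  unfolding bernstein_gamma_eq bernstein_g_scale[OF assms]
  using lborel_integral_real_affine[of \<sigma> "bernstein_g 1 r" 0] assms by simp

text \<open>
  With this lemma and the next one it suffices to treat the scale 1. The bounds at scale 1 are
  pointwise and do not mention the exponent p, which is not invariant under dilation.
\<close>
lemma bernstein_D_scale:
  assumes \<sigma>: "0 < \<sigma>" and [measurable]: "f \<in> borel_measurable borel"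
  shows "bernstein_D r \<sigma> k f x = bernstein_D r 1 k (\<lambda>y. f (y / \<sigma>)) (\<sigma> * x)"
proof -
  have "(LINT u|lborel. f (u / \<sigma>) * complex_of_real (bernstein_G 1 r k (u - \<sigma> * x))) =
     \<sigma> *\<^sub>R (LINT u|lborel. f u * complex_of_real (bernstein_G 1 r k (\<sigma> * (u - x))))"
    using lborel_integral_real_affine[of \<sigma> "\<lambda>u. f (u / \<sigma>) * complex_of_real (bernstein_G 1 r k (u - \<sigma> * x))" 0] \<sigma>
    by (simp add: right_diff_distrib)
  moreover have "(LINT u|lborel. f u * complex_of_real (bernstein_G \<sigma> r k (u - x))) =
     complex_of_real (\<sigma> ^ (2 * r)) * (LINT u|lborel. f u * complex_of_real (bernstein_G 1 r k (\<sigma> * (u - x))))"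
    unfolding bernstein_G_scale[OF \<sigma>] by (simp add: mult.left_commute flip: integral_mult_right_zero)
  moreover have "complex_of_real ((- 1) ^ (k + 1) / bernstein_gamma r \<sigma>) * complex_of_real (\<sigma> ^ (2 * r)) =
     complex_of_real ((- 1) ^ (k + 1) / bernstein_gamma r 1) * complex_of_real \<sigma>"
  proof -
    have "(- 1) ^ (k + 1) / bernstein_gamma r \<sigma> * \<sigma> ^ (2 * r) = (- 1) ^ (k + 1) / bernstein_gamma r 1 * \<sigma>"
    proof (cases "bernstein_gamma r 1 = 0")
      case True
      then have "bernstein_gamma r \<sigma> = 0" using bernstein_gamma_scale[OF \<sigma>, of r] \<sigma> by simp
      then show ?thesis using True by simp
    next
      case False
      then have "bernstein_gamma r \<sigma> \<noteq> 0" using bernstein_gamma_scale[OF \<sigma>, of r] \<sigma> by auto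
      then show ?thesis using False bernstein_gamma_scale[OF \<sigma>, of r] by (simp add: frac_eq_eq mult_ac)
    qed
    then show ?thesis by (simp only: of_real_mult[symmetric])
  qed
  ultimately show ?thesis
    unfolding bernstein_D_def by (simp add: integral_completion scaleR_conv_of_real mult.assoc[symmetric])
qed

lemma steklov_scale:
  assumes \<sigma>: "0 < \<sigma>" and [measurable]: "f \<in> borel_measurable borel"
  shows "steklov (1 / \<sigma>) f x = unit_mean (\<lambda>y. f (y / \<sigma>)) (\<sigma> * x)"
proof -
  have i: "(s / \<sigma> \<in> {0..1 / \<sigma>}) = (s \<in> {0..1})" for s using \<sigma> by (auto simp: field_simps)
  have "(LINT t:{0..1 / \<sigma>}|lebesgue. f (x + t)) = (LINT t|lborel. indicator {0..1 / \<sigma>} t *\<^sub>R f (x + t))"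
    unfolding set_lebesgue_integral_def by (rule integral_completion) simp
  also have "\<dots> = \<bar>1 / \<sigma>\<bar> *\<^sub>R (LINT s|lborel. indicator {0..1 / \<sigma>} (0 + 1 / \<sigma> * s) *\<^sub>R f (x + (0 + 1 / \<sigma> * s)))"
    by (rule lborel_integral_real_affine) (use \<sigma> in auto)
  also have "(\<lambda>s. indicator {0..1 / \<sigma>} (0 + 1 / \<sigma> * s) *\<^sub>R f (x + (0 + 1 / \<sigma> * s))) = (\<lambda>s. complex_of_real (indicator {0..1} s) * f ((\<sigma> * x + s) / \<sigma>))"
    using i \<sigma> by (auto simp: fun_eq_iff indicator_def scaleR_conv_of_real add_divide_distrib)
  finally show ?thesis using \<sigma> unfolding steklov_def unit_mean_def by (simp add: scaleR_conv_of_real)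
qed

section \<open>Averages under a variable exponent\<close>

lemma powr_tangent_ineq:
  fixes a b q :: real
  assumes "0 \<le> a" "0 < b" "1 \<le> q"
  shows "q * b powr (q - 1) * a + b powr q \<le> a powr q + q * b powr q"
proof (cases "a = 0")
  case True
  have "1 * b powr q \<le> q * b powr q" using assms by (intro mult_right_mono) auto
  then show ?thesis using True by simp
next
  case False
  have "a powr q - b powr q \<ge> (q * b powr (q - 1)) * (a - b)"
    by (rule convex_on_imp_above_tangent[OF powr_convex[OF assms(3)]])
       (use assms False in \<open>auto intro!: derivative_eq_intros simp: interior_open\<close>)
  moreover have "q * b powr (q - 1) * (a - b) = q * b powr (q - 1) * a - q * b powr q"
    using assms by (simp add: powr_diff right_diff_distrib)
  ultimately show ?thesis by linarith
qed

text \<open>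
  Jensen's inequality by integrating the tangent inequality. With a lower bound b in place of the mean
  itself, no integrability of a has to be known in advance.
\<close>
lemma (in prob_space) powr_le_nn_integral_powr:
  assumes [measurable]: "a \<in> borel_measurable M" and a: "\<And>s. 0 \<le> a s" and q: "1 \<le> q" and b: "0 \<le> b"
    and le: "ennreal b \<le> (\<integral>\<^sup>+s. ennreal (a s) \<partial>M)"
  shows "ennreal (b powr q) \<le> (\<integral>\<^sup>+s. ennreal (a s powr q) \<partial>M)"
proof (cases "b = 0")
  case False
  then have b: "0 < b" using b by simp
  have "ennreal (q * b powr q) + ennreal (b powr q) = ennreal (q * b powr (q - 1)) * ennreal b + ennreal (b powr q)"
    using b q by (simp add: ennreal_mult[symmetric] powr_diff)
  also have "\<dots> \<le> ennreal (q * b powr (q - 1)) * (\<integral>\<^sup>+s. ennreal (a s) \<partial>M) + ennreal (b powr q)"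
    by (intro add_mono mult_left_mono le) auto
  also have "\<dots> = (\<integral>\<^sup>+s. ennreal (q * b powr (q - 1)) * ennreal (a s) + ennreal (b powr q) \<partial>M)"
    by (simp add: nn_integral_add nn_integral_cmult emeasure_space_1)
  also have "\<dots> \<le> (\<integral>\<^sup>+s. ennreal (a s powr q) + ennreal (q * b powr q) \<partial>M)"
  proof (rule nn_integral_mono)
    fix s
    show "ennreal (q * b powr (q - 1)) * ennreal (a s) + ennreal (b powr q) \<le> ennreal (a s powr q) + ennreal (q * b powr q)"
      using powr_tangent_ineq[OF a[of s] b q] a[of s] b q
      by (simp add: ennreal_mult[symmetric] ennreal_plus[symmetric] del: ennreal_plus)
  qed
  also have "\<dots> = ennreal (q * b powr q) + (\<integral>\<^sup>+s. ennreal (a s powr q) \<partial>M)"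
    by (simp add: nn_integral_add emeasure_space_1 add.commute)
  finally show ?thesis
    by (simp add: ennreal_add_left_cancel_le)
qed (use q in auto)

definition decay_weight :: "real \<Rightarrow> real" where
  "decay_weight y = (exp 1 + \<bar>y\<bar>) powr (-2)"

lemma decay_weight_borel [measurable]: "decay_weight \<in> borel_measurable borel"
  unfolding decay_weight_def[abs_def] by measurable

lemma decay_weight_nonneg [simp]: "0 \<le> decay_weight y"
  by (simp add: decay_weight_def)

lemma decay_weight_le_kernel: "decay_weight y \<le> decay_kernel y"
proof -
  have "decay_weight y \<le> (1 + \<bar>y\<bar>) powr (-2)" unfolding decay_weight_def
    by (rule powr_mono2') auto
  also have "\<dots> \<le> (1 + \<bar>y\<bar>) powr (-3/2)" by (rule powr_mono) auto
  finally show ?thesis by (simp add: decay_kernel_def)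
qed

text \<open>
  If a is at least the weight, then the logarithm of a is at most twice the logarithm of
  \<open>exp 1 + \<bar>y\<bar>\<close> in absolute value, and the decay condition bounds the effect
  of changing the exponent. A smaller a is covered by the integrable weight because
  \<open>q \<ge> 1\<close>.
\<close>
lemma powr_exchange_exponent:
  fixes a p q c y :: real
  assumes a: "0 \<le> a" "a \<le> 1" and q: "1 \<le> q" and d: "\<bar>p - q\<bar> * ln (exp 1 + \<bar>y\<bar>) \<le> c"
  shows "a powr q \<le> exp (2 * c) * a powr p + decay_weight y"
proof (cases "decay_weight y \<le> a")
  case True
  let ?e = "exp 1 + \<bar>y\<bar>"
  have e: "1 < ?e" using exp_gt_one[of 1] abs_ge_zero[of y] by linarith
  have w: "0 < decay_weight y" using e by (simp add: decay_weight_def)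
  then have a0: "0 < a" using True by simp
  have "ln (decay_weight y) \<le> ln a" using True w a0 by simp
  then have l: "\<bar>ln a\<bar> \<le> 2 * ln ?e" using a a0 e by (simp add: decay_weight_def ln_powr)
  have "(q - p) * ln a \<le> \<bar>q - p\<bar> * \<bar>ln a\<bar>" by (simp add: abs_mult[symmetric])
  also have "\<dots> \<le> \<bar>q - p\<bar> * (2 * ln ?e)" by (rule mult_left_mono[OF l]) auto
  also have "\<dots> \<le> 2 * c" using d by (simp add: abs_minus_commute mult.commute)
  finally have "a powr (q - p) \<le> exp (2 * c)" using a0 by (simp add: powr_def)
  then have "a powr (q - p) * a powr p \<le> exp (2 * c) * a powr p" by (rule mult_right_mono) auto
  moreover have "a powr (q - p) * a powr p = a powr q" by (simp add: powr_add[symmetric])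
  ultimately show ?thesis using w by simp
next
  case False
  have "a powr q \<le> a powr 1" using a q by (intro powr_mono') auto
  then show ?thesis using False a by (smt (verit) powr_ge_zero mult_nonneg_nonneg exp_ge_zero powr_one)
qed

definition unit_uniform :: "real measure" where
  "unit_uniform = uniform_measure lborel {-1..1}"

lemma sets_unit_uniform [measurable_cong, simp]: "sets unit_uniform = sets borel"
  by (simp add: unit_uniform_def)

lemma prob_space_unit_uniform: "prob_space unit_uniform"
  unfolding unit_uniform_def by (rule prob_space_uniform_measure) auto

lemma nn_integral_unit_uniform:
  assumes [measurable]: "F \<in> borel_measurable borel" and "0 < \<rho>"
  shows "(\<integral>\<^sup>+s. F (x + \<rho> * s) \<partial>unit_uniform) = ennreal (1 / (2 * \<rho>)) * (\<integral>\<^sup>+s. F (x + s) * indicator {-\<rho>..\<rho>} s \<partial>lborel)"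
proof -
  have "(\<integral>\<^sup>+s. F (x + s) * indicator {-\<rho>..\<rho>} s \<partial>lborel) =
    ennreal \<bar>\<rho>\<bar> * (\<integral>\<^sup>+s. F (x + (0 + \<rho> * s)) * indicator {-\<rho>..\<rho>} (0 + \<rho> * s) \<partial>lborel)"
    by (rule nn_integral_real_affine) (use assms in auto)
  also have "(\<lambda>s. F (x + (0 + \<rho> * s)) * indicator {-\<rho>..\<rho>} (0 + \<rho> * s)) = (\<lambda>s. F (x + \<rho> * s) * indicator {-1..1} s)"
  proof
    fix s
    have "-\<rho> \<le> \<rho> * s \<longleftrightarrow> -1 \<le> s" "\<rho> * s \<le> \<rho> \<longleftrightarrow> s \<le> 1"
      using assms(2) mult_le_cancel_left_pos[of \<rho> "-1" s] mult_le_cancel_left_pos[of \<rho> s 1] by auto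
    then show "F (x + (0 + \<rho> * s)) * indicator {-\<rho>..\<rho>} (0 + \<rho> * s) = F (x + \<rho> * s) * indicator {-1..1} s"
      by (simp add: indicator_def)
  qed
  finally have *: "(\<integral>\<^sup>+s. F (x + s) * indicator {-\<rho>..\<rho>} s \<partial>lborel) = ennreal \<rho> * (\<integral>\<^sup>+s. F (x + \<rho> * s) * indicator {-1..1} s \<partial>lborel)"
    using assms by simp
  have "(\<integral>\<^sup>+s. F (x + \<rho> * s) \<partial>unit_uniform) = (\<integral>\<^sup>+s. F (x + \<rho> * s) * indicator {-1..1} s \<partial>lborel) / 2"
    unfolding unit_uniform_def by (subst nn_integral_uniform_measure) auto
  also have "\<dots> = inverse (ennreal 2) * (\<integral>\<^sup>+s. F (x + \<rho> * s) * indicator {-1..1} s \<partial>lborel)"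
    by (simp add: divide_ennreal_def mult.commute)
  also have "inverse (ennreal 2) = ennreal (1/2)"
    by (subst inverse_ennreal) (auto simp: inverse_eq_divide)
  also have "ennreal (1/2) = ennreal (1 / (2 * \<rho>)) * ennreal \<rho>"
    using assms by (simp add: ennreal_mult[symmetric])
  finally show ?thesis by (simp add: * mult.assoc)
qed

locale log_hoelder_exponent =
  fixes p :: "real \<Rightarrow> real" and c1 c2 c3 :: real
  assumes p_borel [measurable]: "p \<in> borel_measurable borel"
    and p_ge_1: "1 \<le> p x"
    and local_log: "\<bar>p x - p y\<bar> * ln (exp 1 + 1 / \<bar>x - y\<bar>) \<le> c1"
    and decay_log: "\<bar>p x - c3\<bar> * ln (exp 1 + \<bar>x\<bar>) \<le> c2"
    and c1_pos: "0 < c1" and c2_pos: "0 < c2"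
begin

lemma ln_e_ge_1: "0 \<le> a \<Longrightarrow> 1 \<le> ln (exp 1 + a :: real)"
  by (subst ln_ge_iff) (auto intro: add_pos_nonneg)

lemma p_le: "p x \<le> c3 + c2"
proof -
  have "\<bar>p x - c3\<bar> * 1 \<le> \<bar>p x - c3\<bar> * ln (exp 1 + \<bar>x\<bar>)"
    by (intro mult_left_mono ln_e_ge_1) auto
  then have "\<bar>p x - c3\<bar> \<le> c2" using decay_log[of x] by simp
  then show ?thesis by linarith
qed

text \<open>
  The constant is the limit of p at infinity.
\<close>
lemma c3_ge_1: "1 \<le> c3"
proof (rule ccontr)
  assume "\<not> 1 \<le> c3"
  then have d: "0 < 1 - c3" by simp
  define x where "x = exp (c2 / (1 - c3))"
  have "c2 / (1 - c3) = ln x" by (simp add: x_def)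
  also have "\<dots> < ln (exp 1 + \<bar>x\<bar>)" by (subst ln_less_cancel_iff) (auto simp: x_def add_pos_pos)
  finally have "c2 < (1 - c3) * ln (exp 1 + \<bar>x\<bar>)" using d by (simp add: field_simps)
  also have "\<dots> \<le> \<bar>p x - c3\<bar> * ln (exp 1 + \<bar>x\<bar>)"
    by (intro mult_right_mono) (use p_ge_1[of x] ln_e_ge_1[of "\<bar>x\<bar>"] in auto)
  finally show False using decay_log[of x] by simp
qed

definition average_const :: real where
  "average_const = 2 powr (c3 + c2) * (exp c1 + exp (4 * c2))"

lemma average_const_nonneg: "0 \<le> average_const"
  by (simp add: average_const_def)

text \<open>
  Jensen's inequality needs a constant exponent. For values that are 0 or at least 1, the infimum q of
  p over the interval serves, since raising to a smaller power does not increase them. The average is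
  at most \<open>1 / (2 * \<rho>)\<close> because the modular is at most 1, and for small
  \<open>\<rho>\<close> the local condition bounds the oscillation of p over the interval by a
  multiple of the inverse of the logarithm of \<open>1 / \<rho>\<close>. Hence going from q back to
  \<open>p x\<close> costs a bounded factor.
\<close>
lemma large_part_average:
  assumes [measurable]: "F \<in> borel_measurable borel" and F: "\<And>s. F s = 0 \<or> 1 \<le> F s"
    and mod: "(\<integral>\<^sup>+s. ennreal (F s powr p s) \<partial>lborel) \<le> 1"
    and \<rho>: "0 < \<rho>" and b: "0 \<le> b" "ennreal b \<le> (\<integral>\<^sup>+s. ennreal (F (x + \<rho> * s)) \<partial>unit_uniform)"
  shows "ennreal (b powr p x) \<le> ennreal (exp c1) * (\<integral>\<^sup>+s. ennreal (F (x + \<rho> * s) powr p (x + \<rho> * s)) \<partial>unit_uniform)"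
proof -
  interpret prob_space unit_uniform by (rule prob_space_unit_uniform)
  define q where "q = Inf (p ` {x - \<rho>..x + \<rho>})"
  have bdd: "bdd_below (p ` {x - \<rho>..x + \<rho>})" using p_ge_1 by (intro bdd_belowI2[where m = 1])
  have q1: "1 \<le> q" unfolding q_def using \<rho> p_ge_1 by (intro cInf_greatest) auto
  have qle: "q \<le> p y" if "\<bar>y - x\<bar> \<le> \<rho>" for y
    unfolding q_def by (rule cInf_lower[OF imageI bdd]) (use that in \<open>auto simp: abs_le_iff\<close>)
  have F0: "0 \<le> F s" for s using F[of s] by auto
  have le: "F s powr a \<le> F s powr c" if "a \<le> c" for s a c
    using F[of s] that by (auto intro: powr_mono)
  let ?L = "ln (exp 1 + 1 / \<rho>)"
  have L: "1 \<le> ?L" using \<rho> by (intro ln_e_ge_1) auto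
  have "p x - c1 / ?L \<le> q"
    unfolding q_def
  proof (rule cInf_greatest)
    fix z assume "z \<in> p ` {x - \<rho>..x + \<rho>}"
    then obtain y where y: "z = p y" "\<bar>x - y\<bar> \<le> \<rho>" by auto
    show "p x - c1 / ?L \<le> z"
    proof (cases "x = y")
      case True then show ?thesis using y L c1_pos by simp
    next
      case False
      have "\<bar>p x - p y\<bar> * ?L \<le> \<bar>p x - p y\<bar> * ln (exp 1 + 1 / \<bar>x - y\<bar>)"
        using False y \<rho> by (intro mult_left_mono) (auto simp: frac_le add_pos_pos)
      also have "\<dots> \<le> c1" by (rule local_log)
      finally have "\<bar>p x - p y\<bar> \<le> c1 / ?L" using L by (simp add: field_simps)
      then show ?thesis using y by auto
    qed
  qed (use \<rho> in auto)
  then have gap: "(p x - q) * ?L \<le> c1" using L by (simp add: field_simps)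
  have h1: "F s \<le> F s powr p s" for s using le[of 1 "p s" s] p_ge_1 F0[of s] by simp
  have b_le: "b \<le> 1 / (2 * \<rho>)"
  proof -
    have "ennreal b \<le> (\<integral>\<^sup>+s. ennreal (F (x + \<rho> * s) powr p (x + \<rho> * s)) \<partial>unit_uniform)"
      by (rule order_trans[OF b(2) nn_integral_mono]) (intro ennreal_leI h1)
    also have "\<dots> = ennreal (1 / (2 * \<rho>)) * (\<integral>\<^sup>+s. ennreal (F (x + s) powr p (x + s)) * indicator {-\<rho>..\<rho>} s \<partial>lborel)"
      by (rule nn_integral_unit_uniform[OF _ \<rho>]) auto
    also have "(\<integral>\<^sup>+s. ennreal (F (x + s) powr p (x + s)) * indicator {-\<rho>..\<rho>} s \<partial>lborel) \<le> (\<integral>\<^sup>+s. ennreal (F (x + s) powr p (x + s)) \<partial>lborel)"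
      by (rule nn_integral_mono) (auto simp: indicator_def)
    also have "\<dots> = (\<integral>\<^sup>+s. ennreal (F s powr p s) \<partial>lborel)"
      using nn_integral_real_affine[of "\<lambda>s. ennreal (F s powr p s)" 1 x] by simp
    finally have "ennreal b \<le> ennreal (1 / (2 * \<rho>)) * 1" using mod
      by (meson mult_left_mono order_trans zero_le)
    then show ?thesis using \<rho> by simp
  qed
  have "b powr (p x - q) \<le> exp c1"
  proof (cases "b \<le> 1")
    case True
    have "b powr (p x - q) \<le> 1" using True b qle[of x] \<rho> by (intro powr_le1) auto
    also have "1 \<le> exp c1" using c1_pos by simp
    finally show ?thesis .
  next
    case False
    have "b powr (p x - q) = exp ((p x - q) * ln b)" using False by (simp add: powr_def)
    also have "(p x - q) * ln b \<le> (p x - q) * ?L"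
    proof (rule mult_left_mono)
      have "b \<le> 1 / \<rho>" using b_le \<rho> b(1) by (simp add: field_simps)
      also have "\<dots> \<le> exp 1 + 1 / \<rho>" by simp
      finally show "ln b \<le> ?L" using False by (subst ln_le_cancel_iff) auto
    qed (use qle[of x] \<rho> in auto)
    also have "\<dots> \<le> c1" by (rule gap)
    finally show ?thesis by simp
  qed
  then have "b powr p x \<le> exp c1 * b powr q"
    using mult_right_mono[of "b powr (p x - q)" "exp c1" "b powr q"] by (simp add: powr_add[symmetric])
  then have "ennreal (b powr p x) \<le> ennreal (exp c1) * ennreal (b powr q)"
    by (simp add: ennreal_mult[symmetric] ennreal_leI)
  also have "ennreal (b powr q) \<le> (\<integral>\<^sup>+s. ennreal (F (x + \<rho> * s) powr q) \<partial>unit_uniform)"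
    by (rule powr_le_nn_integral_powr) (use F0 q1 b in auto)
  also have "\<dots> \<le> (\<integral>\<^sup>+s. ennreal (F (x + \<rho> * s) powr p (x + \<rho> * s)) \<partial>unit_uniform)"
  proof (rule nn_integral_mono_AE)
    show "AE s in unit_uniform. ennreal (F (x + \<rho> * s) powr q) \<le> ennreal (F (x + \<rho> * s) powr p (x + \<rho> * s))"
      unfolding unit_uniform_def
    proof (rule AE_uniform_measureI)
      show "AE s in lborel. s \<in> {-1..1} \<longrightarrow> ennreal (F (x + \<rho> * s) powr q) \<le> ennreal (F (x + \<rho> * s) powr p (x + \<rho> * s))"
      proof (rule AE_I2, rule impI)
        fix s :: real assume "s \<in> {-1..1}"
        then have "\<bar>\<rho> * s\<bar> \<le> \<rho> * 1" unfolding abs_mult using \<rho> by (intro mult_mono) auto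
        then show "ennreal (F (x + \<rho> * s) powr q) \<le> ennreal (F (x + \<rho> * s) powr p (x + \<rho> * s))"
          by (intro ennreal_leI le qle) auto
      qed
    qed auto
  qed
  finally show ?thesis by (simp add: mult_left_mono)
qed

text \<open>
  For values at most 1 the constant exponent for Jensen's inequality is the limit \<open>c3\<close> of
  p at infinity, and the exponent is exchanged twice: from \<open>p x\<close> to \<open>c3\<close>
  outside and from \<open>c3\<close> to \<open>p y\<close> inside the average. Each exchange costs a
  factor and a weight that does not depend on F.
\<close>
lemma small_part_average:
  assumes [measurable]: "F \<in> borel_measurable borel" and F: "\<And>s. 0 \<le> F s" "\<And>s. F s \<le> 1"
    and b: "0 \<le> b" "ennreal b \<le> (\<integral>\<^sup>+s. ennreal (F (x + \<rho> * s)) \<partial>unit_uniform)"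
  shows "ennreal (b powr p x) \<le> ennreal (exp (4 * c2)) *
    ((\<integral>\<^sup>+s. ennreal (F (x + \<rho> * s) powr p (x + \<rho> * s)) + ennreal (decay_weight (x + \<rho> * s)) \<partial>unit_uniform) + ennreal (decay_weight x))"
proof -
  interpret prob_space unit_uniform by (rule prob_space_unit_uniform)
  define A where "A = (\<integral>\<^sup>+s. ennreal (F (x + \<rho> * s) powr p (x + \<rho> * s)) + ennreal (decay_weight (x + \<rho> * s)) \<partial>unit_uniform)"
  have "ennreal b \<le> (\<integral>\<^sup>+s. 1 \<partial>unit_uniform)"
    by (rule order_trans[OF b(2) nn_integral_mono]) (use F in auto)
  then have b1: "b \<le> 1" by (simp add: emeasure_space_1)
  have e: "1 \<le> exp (2 * c2)" using c2_pos by simp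
  have "ennreal (b powr c3) \<le> (\<integral>\<^sup>+s. ennreal (F (x + \<rho> * s) powr c3) \<partial>unit_uniform)"
    by (rule powr_le_nn_integral_powr) (use F c3_ge_1 b in auto)
  also have "\<dots> \<le> (\<integral>\<^sup>+s. ennreal (exp (2 * c2)) * (ennreal (F (x + \<rho> * s) powr p (x + \<rho> * s)) + ennreal (decay_weight (x + \<rho> * s))) \<partial>unit_uniform)"
  proof (rule nn_integral_mono)
    fix s
    let ?y = "x + \<rho> * s"
    have "F ?y powr c3 \<le> exp (2 * c2) * F ?y powr p ?y + decay_weight ?y"
      by (rule powr_exchange_exponent) (use F c3_ge_1 decay_log in auto)
    also have "\<dots> \<le> exp (2 * c2) * F ?y powr p ?y + exp (2 * c2) * decay_weight ?y"
      using mult_right_mono[OF e, of "decay_weight ?y"] by simp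
    finally show "ennreal (F ?y powr c3) \<le> ennreal (exp (2 * c2)) * (ennreal (F ?y powr p ?y) + ennreal (decay_weight ?y))"
      by (simp add: ennreal_mult[symmetric] ennreal_plus[symmetric] algebra_simps ennreal_leI del: ennreal_plus)
  qed
  also have "\<dots> = ennreal (exp (2 * c2)) * A" unfolding A_def by (rule nn_integral_cmult) auto
  finally have c: "ennreal (b powr c3) \<le> ennreal (exp (2 * c2)) * A" .
  have "b powr p x \<le> exp (2 * c2) * b powr c3 + decay_weight x"
    by (rule powr_exchange_exponent) (use b b1 p_ge_1 decay_log[of x] in \<open>auto simp: abs_minus_commute\<close>)
  then have "ennreal (b powr p x) \<le> ennreal (exp (2 * c2)) * ennreal (b powr c3) + 1 * ennreal (decay_weight x)"
    by (simp add: ennreal_mult[symmetric] ennreal_plus[symmetric] ennreal_leI del: ennreal_plus)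
  also have "\<dots> \<le> ennreal (exp (2 * c2)) * (ennreal (exp (2 * c2)) * A) + ennreal (exp (4 * c2)) * ennreal (decay_weight x)"
    by (intro add_mono mult_left_mono c mult_right_mono) (use c2_pos in auto)
  also have "\<dots> = ennreal (exp (4 * c2)) * (A + ennreal (decay_weight x))"
    by (simp add: mult.assoc[symmetric] ennreal_mult[symmetric] exp_add[symmetric] distrib_left)
  finally show ?thesis unfolding A_def .
qed

text \<open>
  Splitting F at height 1 gives an estimate of Diening's type on intervals of any length. The
  right-hand side has an integral that is bounded independently of \<open>\<rho>\<close>, which gives
  uniform bounds for averages even when p takes the value 1, in which case the maximal operator is
  unbounded.
\<close>
lemma average_powr_le:
  assumes [measurable]: "F \<in> borel_measurable borel" and F: "\<And>s. 0 \<le> F s"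
    and mod: "(\<integral>\<^sup>+s. ennreal (F s powr p s) \<partial>lborel) \<le> 1"
    and \<rho>: "0 < \<rho>"
  shows "(\<integral>\<^sup>+s. ennreal (F (x + \<rho> * s)) \<partial>unit_uniform) < \<infinity>" (is "?fin")
    and "ennreal (enn2real (\<integral>\<^sup>+s. ennreal (F (x + \<rho> * s)) \<partial>unit_uniform) powr p x) \<le>
     ennreal average_const *
    ((\<integral>\<^sup>+s. ennreal (F (x + \<rho> * s) powr p (x + \<rho> * s)) + ennreal (decay_weight (x + \<rho> * s)) \<partial>unit_uniform) + ennreal (decay_weight x))" (is "?le")
proof -
  interpret prob_space unit_uniform by (rule prob_space_unit_uniform)
  define F1 where "F1 = (\<lambda>s. if 1 < F s then F s else 0)"
  define F2 where "F2 = (\<lambda>s. if 1 < F s then 0 else F s)"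
  have [measurable]: "F1 \<in> borel_measurable borel" "F2 \<in> borel_measurable borel"
    unfolding F1_def F2_def by measurable
  have F1: "F1 s = 0 \<or> 1 \<le> F1 s" "0 \<le> F1 s" "F1 s powr p s \<le> F s powr p s" for s using F[of s] by (auto simp: F1_def)
  have F2: "0 \<le> F2 s" "F2 s \<le> 1" "F2 s powr p s \<le> F s powr p s" for s using F[of s] by (auto simp: F2_def)
  have F12: "F s = F1 s + F2 s" for s by (auto simp: F1_def F2_def)
  define m where "m G = (\<integral>\<^sup>+s. ennreal (G (x + \<rho> * s)) \<partial>unit_uniform)" for G :: "real \<Rightarrow> real"
  have mm: "m F = m F1 + m F2"
    unfolding m_def F12 using F1 F2 by (simp add: nn_integral_add)
  have m2: "m F2 \<le> 1"
  proof -
    have "m F2 \<le> (\<integral>\<^sup>+s. 1 \<partial>unit_uniform)" unfolding m_def by (rule nn_integral_mono) (use F2 in auto)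
    then show ?thesis by (simp add: emeasure_space_1)
  qed
  have mod1: "(\<integral>\<^sup>+s. ennreal (F1 s powr p s) \<partial>lborel) \<le> 1"
    by (rule order_trans[OF nn_integral_mono mod]) (use F1 in \<open>auto intro: ennreal_leI\<close>)
  have m1: "m F1 < \<infinity>"
  proof -
    have "m F1 = ennreal (1 / (2 * \<rho>)) * (\<integral>\<^sup>+s. ennreal (F1 (x + s)) * indicator {-\<rho>..\<rho>} s \<partial>lborel)"
      unfolding m_def by (rule nn_integral_unit_uniform[OF _ \<rho>]) auto
    also have "(\<integral>\<^sup>+s. ennreal (F1 (x + s)) * indicator {-\<rho>..\<rho>} s \<partial>lborel) \<le> (\<integral>\<^sup>+s. ennreal (F1 (x + s) powr p (x + s)) \<partial>lborel)"
    proof (rule nn_integral_mono)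
      fix s
      have "F1 (x + s) \<le> F1 (x + s) powr p (x + s)"
        using F1(1)[of "x + s"] powr_mono[of 1 "p (x + s)" "F1 (x + s)"] p_ge_1[of "x + s"] by auto
      then show "ennreal (F1 (x + s)) * indicator {-\<rho>..\<rho>} s \<le> ennreal (F1 (x + s) powr p (x + s))"
        by (auto simp: indicator_def intro: ennreal_leI)
    qed
    also have "\<dots> = (\<integral>\<^sup>+s. ennreal (F1 s powr p s) \<partial>lborel)"
      using nn_integral_real_affine[of "\<lambda>s. ennreal (F1 s powr p s)" 1 x] by simp
    also have "\<dots> \<le> 1" by (rule mod1)
    finally have "m F1 \<le> ennreal (1 / (2 * \<rho>)) * 1" by (simp add: mult_left_mono)
    then show ?thesis by (simp add: order_le_less_trans)
  qed
  have m2': "m F2 < \<infinity>" using order_le_less_trans[OF m2] by simp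
  show fin: ?fin using m1 m2' mm unfolding m_def by simp
  define b1 where "b1 = enn2real (m F1)"
  define b2 where "b2 = enn2real (m F2)"
  have b: "0 \<le> b1" "0 \<le> b2" "ennreal b1 = m F1" "ennreal b2 = m F2"
    using m1 m2' by (auto simp: b1_def b2_def)
  have bb: "enn2real (m F) = b1 + b2"
    using m1 m2' by (simp add: mm b1_def b2_def enn2real_plus)
  define R where "R = (\<integral>\<^sup>+s. ennreal (F (x + \<rho> * s) powr p (x + \<rho> * s)) + ennreal (decay_weight (x + \<rho> * s)) \<partial>unit_uniform) + ennreal (decay_weight x)"
  have "ennreal (b1 powr p x) \<le> ennreal (exp c1) * (\<integral>\<^sup>+s. ennreal (F1 (x + \<rho> * s) powr p (x + \<rho> * s)) \<partial>unit_uniform)"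
    by (rule large_part_average) (use F1 mod1 \<rho> b in \<open>auto simp: m_def\<close>)
  also have "\<dots> \<le> ennreal (exp c1) * R"
    unfolding R_def by (intro mult_left_mono order_trans[OF nn_integral_mono add_increasing2[OF _ order_refl]])
       (use F1 in \<open>auto intro: add_increasing2 ennreal_leI\<close>)
  finally have r1: "ennreal (b1 powr p x) \<le> ennreal (exp c1) * R" .
  have "ennreal (b2 powr p x) \<le> ennreal (exp (4 * c2)) *
    ((\<integral>\<^sup>+s. ennreal (F2 (x + \<rho> * s) powr p (x + \<rho> * s)) + ennreal (decay_weight (x + \<rho> * s)) \<partial>unit_uniform) + ennreal (decay_weight x))"
    by (rule small_part_average) (use F2 b in \<open>auto simp: m_def\<close>)
  also have "\<dots> \<le> ennreal (exp (4 * c2)) * R"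
    unfolding R_def by (intro mult_left_mono add_mono nn_integral_mono ennreal_leI F2 order_refl) auto
  finally have r2: "ennreal (b2 powr p x) \<le> ennreal (exp (4 * c2)) * R" .
  have "(b1 + b2) powr p x \<le> (2 * max b1 b2) powr p x"
    using b p_ge_1[of x] by (intro powr_mono2) auto
  also have "\<dots> = 2 powr p x * max b1 b2 powr p x" using b by (simp add: powr_mult)
  also have "\<dots> \<le> 2 powr (c3 + c2) * (b1 powr p x + b2 powr p x)"
    using p_le[of x] by (intro mult_mono powr_mono) (auto simp: max_def)
  finally have "ennreal ((b1 + b2) powr p x) \<le> ennreal (2 powr (c3 + c2)) * (ennreal (b1 powr p x) + ennreal (b2 powr p x))"
    by (simp add: ennreal_mult[symmetric] ennreal_plus[symmetric] ennreal_leI del: ennreal_plus)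
  also have "\<dots> \<le> ennreal (2 powr (c3 + c2)) * (ennreal (exp c1) * R + ennreal (exp (4 * c2)) * R)"
    by (intro mult_left_mono add_mono r1 r2) auto
  also have "\<dots> = ennreal (2 powr (c3 + c2) * (exp c1 + exp (4 * c2))) * R"
    by (simp add: ennreal_mult ennreal_plus[symmetric] distrib_right mult.assoc del: ennreal_plus) (simp add: distrib_right)
  finally show ?le using bb unfolding R_def m_def average_const_def by simp
qed

end

text \<open>
  The decay kernel will be dominated by a mixture of uniform distributions on centred intervals of
  random radius \<open>4 ^ j\<close>, where j has the geometric distribution with parameter 1/2: the
  interval \<open>4 ^ j\<close> then contributes to the density an amount of order
  \<open>2 ^ (- j) * 4 ^ (- j)\<close>, which is the power -3/2 of its radius.
\<close>
definition random_scale :: "nat measure" where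
  "random_scale = measure_pmf (geometric_pmf (1/2))"

lemma sets_random_scale [measurable_cong, simp]: "sets random_scale = sets (count_space UNIV)"
  by (simp add: random_scale_def)

lemma prob_space_random_scale: "prob_space random_scale"
  by (simp add: random_scale_def measure_pmf.prob_space_axioms)

definition scale_size :: "nat \<Rightarrow> real" where "scale_size j = 4 ^ j"

lemma scale_size_pos: "0 < scale_size j" by (simp add: scale_size_def)

lemma scale_size_measurable [measurable]: "scale_size \<in> borel_measurable (count_space UNIV)"
  by simp

lemma pair_sigma_finite_random_scale:
  "pair_sigma_finite random_scale lborel" "pair_sigma_finite unit_uniform lborel"
  by (simp_all add: pair_sigma_finite_def prob_space_random_scale prob_space_unit_uniform
    prob_space_imp_sigma_finite lborel.sigma_finite_measure_axioms)

lemma sigma_finite_unit_uniform: "sigma_finite_measure unit_uniform"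
  by (simp add: prob_space_unit_uniform prob_space_imp_sigma_finite)

lemma random_scale_average_borel [measurable]:
  assumes [measurable]: "F \<in> borel_measurable borel"
  shows "(\<lambda>(j, x). \<integral>\<^sup>+s. F (x + \<delta> * scale_size j * s) \<partial>unit_uniform) \<in> borel_measurable (random_scale \<Otimes>\<^sub>M borel)"
proof -
  interpret sigma_finite_measure unit_uniform by (rule sigma_finite_unit_uniform)
  show ?thesis unfolding split_beta by measurable
qed

definition mixture_average :: "real \<Rightarrow> (real \<Rightarrow> ennreal) \<Rightarrow> real \<Rightarrow> ennreal" where
  "mixture_average \<delta> F x =
     (\<integral>\<^sup>+j. \<integral>\<^sup>+s. F (x + \<delta> * scale_size j * s) \<partial>unit_uniform \<partial>random_scale)"

lemma mixture_average_borel [measurable]: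
  assumes [measurable]: "F \<in> borel_measurable borel"
  shows "mixture_average \<delta> F \<in> borel_measurable borel"
proof -
  interpret prob_space random_scale by (rule prob_space_random_scale)
  have [measurable]: "(\<lambda>(x, j). \<integral>\<^sup>+s. F (x + \<delta> * scale_size j * s) \<partial>unit_uniform) \<in> borel_measurable (borel \<Otimes>\<^sub>M random_scale)"
    using measurable_compose[OF measurable_pair_swap' random_scale_average_borel[of F \<delta>]]
    by (simp add: split_beta')
  show ?thesis unfolding mixture_average_def[abs_def] by measurable
qed

text \<open>
  The single term of the mixture with the least interval that contains s is large enough.
\<close>
lemma decay_kernel_le_mixture:
  assumes \<delta>: "0 < \<delta>"
  shows "ennreal (decay_kernel (s / \<delta>) / \<delta>) \<le>
    32 * (\<integral>\<^sup>+j. ennreal (1 / (2 * (\<delta> * scale_size j))) * indicator {-(\<delta> * scale_size j)..\<delta> * scale_size j} s \<partial>random_scale)"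
proof -
  define j where "j = (LEAST j. \<bar>s / \<delta>\<bar> \<le> 4 ^ j)"
  obtain n where "\<bar>s / \<delta>\<bar> \<le> 4 ^ n" using real_arch_pow[of 4 "\<bar>s / \<delta>\<bar>"] by (auto intro: less_imp_le)
  then have j1: "\<bar>s / \<delta>\<bar> \<le> 4 ^ j" unfolding j_def by (rule LeastI)
  have j2: "(4::real) ^ j \<le> 4 * (1 + \<bar>s / \<delta>\<bar>)"
  proof (cases j)
    case (Suc i)
    then have "\<not> \<bar>s / \<delta>\<bar> \<le> 4 ^ i" unfolding j_def using not_less_Least lessI by metis
    then show ?thesis using Suc by simp
  qed simp
  have "decay_kernel (s / \<delta>) \<le> ((4::real) ^ j / 4) powr (-3/2)"
    unfolding decay_kernel_def
  proof (rule powr_mono2')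
    show "4 ^ j / 4 \<le> 1 + \<bar>s / \<delta>\<bar>" using divide_right_mono[OF j2, of 4] by (simp add: mult.commute)
  qed auto
  also have "\<dots> = 8 * (1/8) ^ j"
  proof -
    have "((4::real) ^ j / 4) powr (-3/2) = ((2 powr 2) powr (real j - 1)) powr (-3/2)"
      by (simp add: powr_diff powr_realpow)
    also have "\<dots> = (2 powr 3) * (2 powr (-3)) powr real j"
      unfolding powr_powr powr_add[symmetric] by (simp add: algebra_simps)
    also have "\<dots> = 8 * (1/8) ^ j" by (simp add: powr_realpow powr_minus_divide)
    finally show ?thesis .
  qed
  \<comment> \<open>The weight of j is \<open>(1/2) ^ j * (1/2)\<close>, and the uniform density on its interval is half of the inverse of \<open>\<delta> * 4 ^ j\<close>.\<close>
  finally have "decay_kernel (s / \<delta>) / \<delta> \<le> 8 * (1/8) ^ j / \<delta>" using \<delta> by (simp add: divide_right_mono)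
  also have "\<dots> = 32 * ((1/2) ^ j * (1/2) * (1 / (2 * (\<delta> * scale_size j))))"
    using \<delta> by (simp add: scale_size_def field_simps power_mult_distrib[symmetric])
  finally have "ennreal (decay_kernel (s / \<delta>) / \<delta>) \<le> 32 * (ennreal (pmf (geometric_pmf (1/2)) j) * ennreal (1 / (2 * (\<delta> * scale_size j))))"
    using \<delta> scale_size_pos[of j] by (simp add: ennreal_mult[symmetric] ennreal_leI flip: ennreal_numeral)
  also have "ennreal (1 / (2 * (\<delta> * scale_size j))) = ennreal (1 / (2 * (\<delta> * scale_size j))) * indicator {-(\<delta> * scale_size j)..\<delta> * scale_size j} s"
  proof -
    have "\<bar>s\<bar> \<le> \<delta> * scale_size j" using j1 \<delta> by (simp add: scale_size_def abs_divide field_simps)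
    then show ?thesis by (simp add: indicator_def abs_le_iff)
  qed
  also have "ennreal (pmf (geometric_pmf (1/2)) j) * (ennreal (1 / (2 * (\<delta> * scale_size j))) * indicator {-(\<delta> * scale_size j)..\<delta> * scale_size j} s)
     \<le> (\<integral>\<^sup>+j. ennreal (1 / (2 * (\<delta> * scale_size j))) * indicator {-(\<delta> * scale_size j)..\<delta> * scale_size j} s \<partial>random_scale)"
    unfolding random_scale_def nn_integral_measure_pmf by (rule nn_integral_ge_point) simp
  finally show ?thesis by (simp add: mult_left_mono)
qed

lemma decay_kernel_conv_le_mixture:
  assumes [measurable]: "F \<in> borel_measurable borel" and \<delta>: "0 < \<delta>"
  shows "kernel_mean \<delta> F x \<le> 32 * mixture_average \<delta> F x"
proof -
  interpret pair_sigma_finite random_scale lborel by (rule pair_sigma_finite_random_scale)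
  interpret R: prob_space random_scale by (rule prob_space_random_scale)
  let ?k = "\<lambda>j s. ennreal (1 / (2 * (\<delta> * scale_size j))) * indicator {-(\<delta> * scale_size j)..\<delta> * scale_size j} s"
  have [measurable]: "(\<lambda>(j, s). ?k j s) \<in> borel_measurable (random_scale \<Otimes>\<^sub>M borel)"
    unfolding split_beta indicator_def by measurable
  have [measurable]: "?k j \<in> borel_measurable borel" for j by measurable
  have [measurable]: "(\<lambda>j. ?k j s) \<in> borel_measurable random_scale" for s
    by (simp add: random_scale_def)
  have [measurable]: "(\<lambda>s. \<integral>\<^sup>+j. ?k j s \<partial>random_scale) \<in> borel_measurable borel"
    unfolding indicator_def by measurable
  have "kernel_mean \<delta> F x \<le> (\<integral>\<^sup>+s. 32 * (\<integral>\<^sup>+j. ?k j s \<partial>random_scale) * F (x + s) \<partial>lborel)"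
    unfolding kernel_mean_def by (intro nn_integral_mono mult_right_mono decay_kernel_le_mixture \<delta>) auto
  also have "\<dots> = 32 * (\<integral>\<^sup>+s. (\<integral>\<^sup>+j. ?k j s \<partial>random_scale) * F (x + s) \<partial>lborel)"
    by (simp add: mult.assoc nn_integral_cmult)
  also have "(\<integral>\<^sup>+s. (\<integral>\<^sup>+j. ?k j s \<partial>random_scale) * F (x + s) \<partial>lborel) = (\<integral>\<^sup>+s. (\<integral>\<^sup>+j. ?k j s * F (x + s) \<partial>random_scale) \<partial>lborel)"
    by (simp add: nn_integral_multc)
  also have "\<dots> = (\<integral>\<^sup>+j. (\<integral>\<^sup>+s. ?k j s * F (x + s) \<partial>lborel) \<partial>random_scale)"
    by (rule Fubini') measurable
  also have "\<dots> = (\<integral>\<^sup>+j. (\<integral>\<^sup>+s. F (x + \<delta> * scale_size j * s) \<partial>unit_uniform) \<partial>random_scale)"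
  proof (rule nn_integral_cong)
    fix j
    have "(\<integral>\<^sup>+s. ?k j s * F (x + s) \<partial>lborel) = (\<integral>\<^sup>+s. ennreal (1 / (2 * (\<delta> * scale_size j))) * (F (x + s) * indicator {-(\<delta> * scale_size j)..\<delta> * scale_size j} s) \<partial>lborel)"
      by (simp add: mult_ac)
    also have "\<dots> = (\<integral>\<^sup>+s. F (x + \<delta> * scale_size j * s) \<partial>unit_uniform)"
      using nn_integral_unit_uniform[of F "\<delta> * scale_size j" x] \<delta> scale_size_pos[of j]
      by (subst nn_integral_cmult) auto
    finally show "(\<integral>\<^sup>+s. ?k j s * F (x + s) \<partial>lborel) = (\<integral>\<^sup>+s. F (x + \<delta> * scale_size j * s) \<partial>unit_uniform)" .
  qed
  finally show ?thesis unfolding mixture_average_def .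
qed

lemma nn_integral_translation:
  fixes F :: "real \<Rightarrow> ennreal"
  assumes "F \<in> borel_measurable borel"
  shows "(\<integral>\<^sup>+x. F (x + a) \<partial>lborel) = (\<integral>\<^sup>+x. F x \<partial>lborel)"
  using nn_integral_real_affine[OF assms, of 1 a] by (simp add: add.commute)

text \<open>
  An average of translates has the same integral as the function.
\<close>
lemma nn_integral_mixture:
  fixes F :: "real \<Rightarrow> ennreal"
  assumes [measurable]: "F \<in> borel_measurable borel"
  shows "(\<integral>\<^sup>+x. mixture_average \<delta> F x \<partial>lborel) = (\<integral>\<^sup>+x. F x \<partial>lborel)"
proof -
  interpret A: pair_sigma_finite random_scale lborel by (rule pair_sigma_finite_random_scale)
  interpret B: pair_sigma_finite unit_uniform lborel by (rule pair_sigma_finite_random_scale)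
  interpret R: prob_space random_scale by (rule prob_space_random_scale)
  interpret U: prob_space unit_uniform by (rule prob_space_unit_uniform)
  have "(\<integral>\<^sup>+x. mixture_average \<delta> F x \<partial>lborel)
     = (\<integral>\<^sup>+j. \<integral>\<^sup>+x. \<integral>\<^sup>+s. F (x + \<delta> * scale_size j * s) \<partial>unit_uniform \<partial>lborel \<partial>random_scale)"
    unfolding mixture_average_def
    by (rule A.Fubini') (use random_scale_average_borel[of F \<delta>] in \<open>simp add: split_beta' cong: measurable_cong_sets\<close>)
  also have "\<dots> = (\<integral>\<^sup>+j. \<integral>\<^sup>+s. \<integral>\<^sup>+x. F (x + \<delta> * scale_size j * s) \<partial>lborel \<partial>unit_uniform \<partial>random_scale)"
    by (intro nn_integral_cong B.Fubini') measurable
  also have "\<dots> = (\<integral>\<^sup>+x. F x \<partial>lborel)"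
    by (simp add: nn_integral_translation U.emeasure_space_1 R.emeasure_space_1)
  finally show ?thesis .
qed

context log_hoelder_exponent
begin

definition weight_mass :: real where
  "weight_mass = enn2real (\<integral>\<^sup>+y. ennreal (decay_weight y) \<partial>lborel)"

lemma weight_mass: "(\<integral>\<^sup>+y. ennreal (decay_weight y) \<partial>lborel) = ennreal weight_mass" "0 \<le> weight_mass"
proof -
  have "(\<integral>\<^sup>+y. ennreal (decay_weight y) \<partial>lborel) < \<infinity>"
    by (rule order_le_less_trans[OF nn_integral_mono decay_kernel_integral_finite])
       (intro ennreal_leI decay_weight_le_kernel)
  then show "(\<integral>\<^sup>+y. ennreal (decay_weight y) \<partial>lborel) = ennreal weight_mass" "0 \<le> weight_mass"
    by (auto simp: weight_mass_def)
qed

text \<open>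
  The integrable function that dominates the modular density of every function below a mixture of
  averages of F.
\<close>
definition modular_majorant :: "real \<Rightarrow> (real \<Rightarrow> real) \<Rightarrow> real \<Rightarrow> ennreal" where
  "modular_majorant \<delta> F x = ennreal average_const *
     (mixture_average \<delta> (\<lambda>y. ennreal (F y powr p y) + ennreal (decay_weight y)) x + ennreal (decay_weight x))"

lemma modular_majorant_borel [measurable]:
  assumes [measurable]: "F \<in> borel_measurable borel"
  shows "modular_majorant \<delta> F \<in> borel_measurable borel"
  unfolding modular_majorant_def[abs_def] by measurable

definition modular_const :: real where
  "modular_const = average_const * (1 + weight_mass + weight_mass)"

lemma modular_const_nonneg: "0 \<le> modular_const"
  using weight_mass average_const_nonneg by (simp add: modular_const_def)

lemma nn_integral_modular_majorant:
  assumes [measurable]: "F \<in> borel_measurable borel"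
    and mod: "(\<integral>\<^sup>+s. ennreal (F s powr p s) \<partial>lborel) \<le> 1"
  shows "(\<integral>\<^sup>+x. modular_majorant \<delta> F x \<partial>lborel) \<le> ennreal modular_const"
proof -
  let ?W = weight_mass
  have "(\<integral>\<^sup>+x. modular_majorant \<delta> F x \<partial>lborel) =
      ennreal average_const * ((\<integral>\<^sup>+s. ennreal (F s powr p s) \<partial>lborel) + ennreal ?W + ennreal ?W)"
    unfolding modular_majorant_def
    by (simp add: nn_integral_cmult nn_integral_add nn_integral_mixture weight_mass)
  also have "\<dots> \<le> ennreal average_const * (1 + ennreal ?W + ennreal ?W)"
    by (intro mult_left_mono add_right_mono mod) auto
  also have "\<dots> = ennreal modular_const"
  proof -
    have "ennreal (1 + ?W + ?W) = 1 + ennreal ?W + ennreal ?W"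
      using weight_mass(2) by (subst ennreal_plus, simp, simp, subst ennreal_plus, simp_all)
    moreover have "ennreal modular_const = ennreal average_const * ennreal (1 + ?W + ?W)"
      unfolding modular_const_def using average_const_nonneg weight_mass(2) by (intro ennreal_mult) auto
    ultimately show ?thesis by (simp only:)
  qed
  finally show ?thesis .
qed

text \<open>
  The interval estimate holds for each scale j with the same constant. The exponent
  \<open>p x\<close> is constant in j, so Jensen's inequality over j combines the scales.
\<close>
lemma powr_le_modular_majorant:
  assumes F: "F \<in> borel_measurable borel" "\<And>s. 0 \<le> F s"
    and mod: "(\<integral>\<^sup>+s. ennreal (F s powr p s) \<partial>lborel) \<le> 1"
    and \<delta>: "0 < \<delta>" and h: "0 \<le> h" "ennreal h \<le> mixture_average \<delta> (\<lambda>y. ennreal (F y)) x"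
  shows "ennreal (h powr p x) \<le> modular_majorant \<delta> F x"
proof -
  interpret R: prob_space random_scale by (rule prob_space_random_scale)
  let ?\<Phi> = "\<lambda>y. ennreal (F y powr p y) + ennreal (decay_weight y)"
  define a where "a j = enn2real (\<integral>\<^sup>+s. ennreal (F (x + \<delta> * scale_size j * s)) \<partial>unit_uniform)" for j
  have pos: "0 < \<delta> * scale_size j" for j using \<delta> scale_size_pos by simp
  have a: "ennreal (a j) = (\<integral>\<^sup>+s. ennreal (F (x + \<delta> * scale_size j * s)) \<partial>unit_uniform)" for j
    using average_powr_le(1)[OF F mod pos] by (simp add: a_def)
  have "ennreal (h powr p x) \<le> (\<integral>\<^sup>+j. ennreal (a j powr p x) \<partial>random_scale)"
    by (rule R.powr_le_nn_integral_powr)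
       (use h a p_ge_1 in \<open>auto simp: random_scale_def a_def mixture_average_def\<close>)
  also have "\<dots> \<le> (\<integral>\<^sup>+j. ennreal average_const *
      ((\<integral>\<^sup>+s. ?\<Phi> (x + \<delta> * scale_size j * s) \<partial>unit_uniform) + ennreal (decay_weight x)) \<partial>random_scale)"
    unfolding a_def by (intro nn_integral_mono average_powr_le(2) F mod pos)
  also have "\<dots> = modular_majorant \<delta> F x"
  proof -
    have "(\<lambda>j. \<integral>\<^sup>+s. ?\<Phi> (x + \<delta> * scale_size j * s) \<partial>unit_uniform) \<in> borel_measurable random_scale"
      by (simp add: random_scale_def)
    then show ?thesis
      unfolding modular_majorant_def mixture_average_def
      by (simp add: nn_integral_cmult nn_integral_add R.emeasure_space_1)
  qed
  finally show ?thesis .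
qed

definition norm_const :: "real \<Rightarrow> real" where
  "norm_const B = 64 * (modular_const + 2) * B"

lemma norm_const_pos: "0 < B \<Longrightarrow> 0 < norm_const B"
  using modular_const_nonneg by (simp add: norm_const_def)

text \<open>
  If \<open>\<phi> / \<eta>\<close> has modular below 1, then \<open>H / (B * \<eta>)\<close> is
  at most F plus a multiple of a mixture of averages of F, where F is the absolute value of
  \<open>\<phi> / \<eta>\<close>, and so has modular bounded by a constant. As
  \<open>p \<ge> 1\<close>, dividing by a large \<open>\<Lambda>\<close> brings the modular below 1.
\<close>
lemma norm_var_bound:
  assumes B: "0 < B" and \<delta>: "0 < \<delta>"
    and \<phi>[measurable]: "\<phi> \<in> borel_measurable borel" and \<phi>L: "\<phi> \<in> Lp_var p"
    and H: "H \<in> borel_measurable lebesgue"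
    and dom: "AE x in lebesgue. ennreal (norm (H x)) \<le>
      ennreal B * (ennreal (norm (\<phi> x)) + kernel_mean \<delta> (ennorm \<phi>) x)"
  shows "H \<in> Lp_var p" "norm_var p H \<le> norm_const B * norm_var p \<phi>"
proof -
  let ?K = modular_const
  define \<Lambda> where "\<Lambda> = 64 * (?K + 2)"
  have K: "0 \<le> ?K" by (rule modular_const_nonneg)
  have \<Lambda>: "128 \<le> \<Lambda>" "0 < \<Lambda>" using K by (auto simp: \<Lambda>_def)
  let ?S = "\<lambda>f. {\<eta>. 0 < \<eta> \<and> modular p (\<lambda>y. f y / complex_of_real \<eta>) < 1}"
  have key: "\<Lambda> * B * \<eta> \<in> ?S H" if \<eta>: "\<eta> \<in> ?S \<phi>" for \<eta>
  proof -
    from \<eta> have \<eta>0: "0 < \<eta>" and m: "modular p (\<lambda>y. \<phi> y / complex_of_real \<eta>) < 1" by auto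
    define F where "F y = norm (\<phi> y) / \<eta>" for y
    have F[measurable]: "F \<in> borel_measurable borel" unfolding F_def by measurable
    have F0: "0 \<le> F y" for y using \<eta>0 by (simp add: F_def)
    have modF: "(\<integral>\<^sup>+s. ennreal (F s powr p s) \<partial>lborel) < 1"
      using m \<eta>0 by (simp add: modular_def nn_integral_completion F_def norm_divide)
    let ?G = "modular_majorant \<delta> F"
    note G1 = nn_integral_modular_majorant[OF F less_imp_le[OF modF], of \<delta>]
    have pt: "ennreal (norm (H x / complex_of_real (\<Lambda> * B * \<eta>)) powr p x) \<le> ennreal (64 / \<Lambda>) * (ennreal (F x powr p x) + ?G x)"
      if d: "ennreal (norm (H x)) \<le> ennreal B * (ennreal (norm (\<phi> x)) +
        kernel_mean \<delta> (ennorm \<phi>) x)" for x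
    proof -
      define u where "u = norm (H x) / (B * \<eta>)"
      \<comment> \<open>The part of u that exceeds F is below 32 times the mixture, the factor in \<open>decay_kernel_conv_le_mixture\<close>.\<close>
      define h where "h = max 0 (u - F x) / 32"
      define M where "M = mixture_average \<delta> (\<lambda>y. ennreal (F y)) x"
      have "ennreal (norm (\<phi> y)) = ennreal \<eta> * ennreal (F y)" for y
        using \<eta>0 by (simp add: F_def ennreal_mult[symmetric])
      then have "ennreal (norm (H x)) \<le> ennreal B * (ennreal \<eta> * ennreal (F x) + (\<integral>\<^sup>+s. ennreal \<eta> * (ennreal (decay_kernel (s / \<delta>) / \<delta>) * ennreal (F (x + s))) \<partial>lborel))"
        using d unfolding kernel_mean_def by (simp add: mult_ac)
      also have "\<dots> = ennreal (B * \<eta>) * (ennreal (F x) + kernel_mean \<delta> (\<lambda>y. ennreal (F y)) x)"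
        unfolding kernel_mean_def using B \<eta>0 by (subst nn_integral_cmult) (auto simp: ennreal_mult distrib_left mult.assoc)
      also have "\<dots> \<le> ennreal (B * \<eta>) * (ennreal (F x) + 32 * M)"
        unfolding M_def by (intro mult_left_mono add_left_mono decay_kernel_conv_le_mixture \<delta>) auto
      finally have "ennreal (B * \<eta>) * ennreal u \<le> ennreal (B * \<eta>) * (ennreal (F x) + 32 * M)"
        using B \<eta>0 by (simp add: u_def ennreal_mult[symmetric])
      then have uM: "ennreal u \<le> ennreal (F x) + 32 * M"
        using B \<eta>0 by (subst (asm) ennreal_mult_le_mult_iff) auto
      have "ennreal h \<le> M"
      proof (cases "u \<le> F x")
        case False
        then have "u = F x + 32 * h" by (simp add: h_def max_def field_simps)
        moreover have "0 \<le> h" by (simp add: h_def)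
        ultimately have "ennreal (F x) + 32 * ennreal h = ennreal u"
          using F0[of x] by (simp add: ennreal_mult)
        then have "ennreal (F x) + 32 * ennreal h \<le> ennreal (F x) + 32 * M" using uM by (simp only:)
        then have "32 * ennreal h \<le> 32 * M" by (simp only: ennreal_add_left_cancel_le) simp
        then show ?thesis by (simp add: ennreal_mult_le_mult_iff)
      qed (simp add: h_def)
      then have hG: "ennreal (h powr p x) \<le> ?G x"
        unfolding M_def
        by (intro powr_le_modular_majorant[OF F F0 less_imp_le[OF modF] \<delta>]) (auto simp: h_def)
      have h0: "0 \<le> h" by (simp add: h_def)
      have u0: "0 \<le> u" using B \<eta>0 by (simp add: u_def)
      have "u \<le> F x + 32 * h" by (simp add: h_def)
      then have ule: "u \<le> 64 * max (F x) h" using F0[of x] h0 by (auto simp: max_def)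
      have "norm (H x / complex_of_real (\<Lambda> * B * \<eta>)) powr p x = (u / \<Lambda>) powr p x"
        using B \<eta>0 \<Lambda> by (simp add: u_def norm_divide norm_mult mult_ac)
      also have "\<dots> \<le> ((64 / \<Lambda>) * max (F x) h) powr p x"
        using ule u0 \<Lambda> p_ge_1[of x] by (intro powr_mono2) (auto simp: field_simps)
      also have "\<dots> = (64 / \<Lambda>) powr p x * max (F x) h powr p x"
        by (rule powr_mult)
      also have "\<dots> \<le> (64 / \<Lambda>) powr 1 * (F x powr p x + h powr p x)"
        using \<Lambda> p_ge_1[of x] by (intro mult_mono powr_mono') (auto simp: max_def)
      finally have "ennreal (norm (H x / complex_of_real (\<Lambda> * B * \<eta>)) powr p x) \<le> ennreal (64 / \<Lambda>) * (ennreal (F x powr p x) + ennreal (h powr p x))"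
        using \<Lambda> by (simp add: ennreal_mult[symmetric] ennreal_plus[symmetric] ennreal_leI del: ennreal_plus)
      also have "\<dots> \<le> ennreal (64 / \<Lambda>) * (ennreal (F x powr p x) + ?G x)"
        by (intro mult_left_mono add_left_mono hG) auto
      finally show ?thesis .
    qed
    have "modular p (\<lambda>y. H y / complex_of_real (\<Lambda> * B * \<eta>)) \<le> (\<integral>\<^sup>+x. ennreal (64 / \<Lambda>) * (ennreal (F x powr p x) + ?G x) \<partial>lebesgue)"
      unfolding modular_def by (rule nn_integral_mono_AE) (use dom in eventually_elim, rule pt)
    also have "\<dots> = ennreal (64 / \<Lambda>) * ((\<integral>\<^sup>+x. ennreal (F x powr p x) \<partial>lborel) + (\<integral>\<^sup>+x. ?G x \<partial>lborel))"
      by (simp add: nn_integral_completion nn_integral_cmult nn_integral_add)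
    also have "\<dots> \<le> ennreal (64 / \<Lambda>) * (1 + ennreal ?K)"
      by (intro mult_left_mono add_mono G1 less_imp_le[OF modF]) auto
    also have "\<dots> = ennreal (64 / \<Lambda> * (1 + ?K))"
    proof -
      have "1 + ennreal ?K = ennreal (1 + ?K)" using K by simp
      moreover have "ennreal (64 / \<Lambda>) * ennreal (1 + ?K) = ennreal (64 / \<Lambda> * (1 + ?K))"
        by (rule ennreal_mult[symmetric]) (use K \<Lambda> in auto)
      ultimately show ?thesis by (simp only:)
    qed
    also have "\<dots> < 1"
    proof -
      have "64 / \<Lambda> * (1 + ?K) < 1" using K by (simp add: \<Lambda>_def field_simps)
      then show ?thesis by (metis ennreal_1 ennreal_lessI zero_less_one)
    qed
    finally show ?thesis using \<Lambda> B \<eta>0 by simp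
  qed
  \<comment> \<open>The infimum that defines the norm of \<open>\<phi>\<close> is over a nonempty set, by the same scaling.\<close>
  obtain \<mu> where \<mu>: "\<mu> > 0" "modular p (\<lambda>y. \<phi> y / complex_of_real \<mu>) < \<infinity>"
    using \<phi>L by (auto simp: Lp_var_def)
  have ne: "?S \<phi> \<noteq> {}"
  proof -
    define m where "m = enn2real (modular p (\<lambda>y. \<phi> y / complex_of_real \<mu>))"
    have m: "0 \<le> m" "modular p (\<lambda>y. \<phi> y / complex_of_real \<mu>) = ennreal m" using \<mu> by (auto simp: m_def)
    have "modular p (\<lambda>y. \<phi> y / complex_of_real (\<mu> * (m + 1))) \<le> (\<integral>\<^sup>+y. ennreal (1 / (m + 1)) * ennreal (norm (\<phi> y / complex_of_real \<mu>) powr p y) \<partial>lborel)"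
      unfolding modular_def nn_integral_completion
    proof (rule nn_integral_mono)
      fix y
      have "norm (\<phi> y / complex_of_real (\<mu> * (m + 1))) powr p y = (1 / (m + 1) * norm (\<phi> y / complex_of_real \<mu>)) powr p y"
        using m \<mu> by (simp add: norm_divide norm_of_real abs_mult field_simps del: of_real_mult of_real_add)
      also have "\<dots> = (1 / (m + 1)) powr p y * norm (\<phi> y / complex_of_real \<mu>) powr p y"
        by (rule powr_mult)
      also have "\<dots> \<le> (1 / (m + 1)) powr 1 * norm (\<phi> y / complex_of_real \<mu>) powr p y"
        using m p_ge_1[of y] by (intro mult_right_mono powr_mono') auto
      finally show "ennreal (norm (\<phi> y / complex_of_real (\<mu> * (m + 1))) powr p y) \<le> ennreal (1 / (m + 1)) * ennreal (norm (\<phi> y / complex_of_real \<mu>) powr p y)"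
        using m by (simp add: ennreal_mult[symmetric] ennreal_leI)
    qed
    also have "\<dots> = ennreal (1 / (m + 1)) * ennreal m"
      using m(2) by (simp add: nn_integral_cmult modular_def nn_integral_completion)
    also have "\<dots> < 1" using m by (simp add: ennreal_mult[symmetric])
    finally have "\<mu> * (m + 1) \<in> ?S \<phi>" using m \<mu> by simp
    then show ?thesis by blast
  qed
  obtain \<eta> where "\<eta> \<in> ?S \<phi>" using ne by blast
  from key[OF this] have "0 < \<Lambda> * B * \<eta>" and less1: "modular p (\<lambda>y. H y / complex_of_real (\<Lambda> * B * \<eta>)) < 1"
    by blast+
  moreover have "modular p (\<lambda>y. H y / complex_of_real (\<Lambda> * B * \<eta>)) < \<infinity>"
    using less_trans[OF less1, of \<infinity>] by simp
  ultimately show "H \<in> Lp_var p" using H unfolding Lp_var_def by blast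
  have "norm_var p H / (\<Lambda> * B) \<le> norm_var p \<phi>"
    unfolding norm_var_def[of p \<phi>]
  proof (rule cInf_greatest[OF ne])
    fix \<eta> assume "\<eta> \<in> ?S \<phi>"
    from key[OF this] have "norm_var p H \<le> \<Lambda> * B * \<eta>"
      unfolding norm_var_def by (rule cInf_lower) (auto intro: bdd_belowI[of _ 0])
    then show "norm_var p H / (\<Lambda> * B) \<le> \<eta>" using \<Lambda> B by (simp add: field_simps)
  qed
  moreover have "norm_const B = \<Lambda> * B" by (simp add: norm_const_def \<Lambda>_def)
  ultimately show "norm_var p H \<le> norm_const B * norm_var p \<phi>"
    using \<Lambda> B by (simp add: field_simps)
qed

end

section \<open>The approximation theorem\<close>

definition steklov_defect :: "real \<Rightarrow> (real \<Rightarrow> complex) \<Rightarrow> real \<Rightarrow> complex" where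
  "steklov_defect \<delta> h x = h x - steklov \<delta> h x"

lemma Omega_var_eq: "Omega_var p k f \<delta> = norm_var p ((steklov_defect \<delta> ^^ k) f)"
  by (simp add: Omega_var_def steklov_defect_def[abs_def])

lemma steklov_borel [measurable]:
  assumes [measurable]: "f \<in> borel_measurable borel"
  shows "steklov \<delta> f \<in> borel_measurable borel"
proof -
  have "steklov \<delta> f x = complex_of_real (1 / \<delta>) * (LINT t|lborel. indicator {0..\<delta>} t *\<^sub>R f (x + t))" for x
    unfolding steklov_def set_lebesgue_integral_def by (subst integral_completion) auto
  then have "steklov \<delta> f = (\<lambda>x. complex_of_real (1 / \<delta>) * (LINT t|lborel. indicator {0..\<delta>} t *\<^sub>R f (x + t)))" by auto
  then show ?thesis by simp
qed

lemma bernstein_D_borel [measurable]: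
  assumes [measurable]: "f \<in> borel_measurable borel"
  shows "bernstein_D r \<sigma> k f \<in> borel_measurable borel"
proof -
  have "bernstein_D r \<sigma> k f x = complex_of_real ((- 1) ^ (k + 1) / bernstein_gamma r \<sigma>) *
     (LINT u|lborel. f u * complex_of_real (bernstein_G \<sigma> r k (u - x)))" for x
    unfolding bernstein_D_def by (subst integral_completion) auto
  then have "bernstein_D r \<sigma> k f = (\<lambda>x. complex_of_real ((- 1) ^ (k + 1) / bernstein_gamma r \<sigma>) *
     (LINT u|lborel. f u * complex_of_real (bernstein_G \<sigma> r k (u - x))))" by auto
  then show ?thesis by simp
qed

lemma steklov_defect_borel [measurable]:
  "f \<in> borel_measurable borel \<Longrightarrow> steklov_defect \<delta> f \<in> borel_measurable borel"
  unfolding steklov_defect_def[abs_def] by (intro borel_measurable_diff steklov_borel)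

lemma steklov_defect_iterate_borel [measurable]:
  "f \<in> borel_measurable borel \<Longrightarrow> (steklov_defect \<delta> ^^ k) f \<in> borel_measurable borel"
  by (induction k) auto

lemma steklov_defect_iterate_scale:
  assumes \<sigma>: "0 < \<sigma>" and f: "f \<in> borel_measurable borel"
  shows "(mean_defect ^^ k) (\<lambda>y. f (y / \<sigma>)) = (\<lambda>y. (steklov_defect (1 / \<sigma>) ^^ k) f (y / \<sigma>))"
proof (induction k)
  case (Suc k)
  show ?case
  proof
    fix y
    have "steklov (1 / \<sigma>) ((steklov_defect (1 / \<sigma>) ^^ k) f) (y / \<sigma>) = unit_mean (\<lambda>y. (steklov_defect (1 / \<sigma>) ^^ k) f (y / \<sigma>)) y"
      using steklov_scale[OF \<sigma> steklov_defect_iterate_borel[OF f], where x = "y / \<sigma>"] \<sigma> by simp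
    then show "(mean_defect ^^ Suc k) (\<lambda>y. f (y / \<sigma>)) y = (steklov_defect (1 / \<sigma>) ^^ Suc k) f (y / \<sigma>)"
      by (simp add: Suc mean_defect_def steklov_defect_def[of _ "(steklov_defect (1 / \<sigma>) ^^ k) f"])
  qed
qed simp

lemma kernel_mean_scale:
  assumes [measurable]: "F \<in> borel_measurable borel" and \<sigma>: "0 < \<sigma>"
  shows "kernel_mean 1 (\<lambda>y. F (y / \<sigma>)) (\<sigma> * x) = kernel_mean (1 / \<sigma>) F x"
proof -
  have "kernel_mean (1 / \<sigma>) F x = (\<integral>\<^sup>+s. ennreal (decay_kernel s) * F (x + 1 / \<sigma> * s) \<partial>lborel)"
    by (rule kernel_mean_dilate[symmetric]) (use \<sigma> in auto)
  then show ?thesis using \<sigma> by (simp add: kernel_mean_def add_divide_distrib)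
qed

text \<open>
  Joint measurability of \<open>f (x + t)\<close> in both variables, needed for Fubini's theorem,
  is available for Borel functions. The lemmas below show that the operators, the norm and membership
  see f only up to null sets.
\<close>
lemma lebesgue_borel_representative:
  assumes "f \<in> borel_measurable lebesgue"
  obtains f0 :: "real \<Rightarrow> complex" where "f0 \<in> borel_measurable borel" "AE x in lborel. f x = f0 x"
proof -
  have re: "(\<lambda>x. Re (f x)) \<in> borel_measurable lebesgue" and im: "(\<lambda>x. Im (f x)) \<in> borel_measurable lebesgue"
    using assms by measurable
  obtain a where a: "a \<in> borel_measurable borel" "AE x in lborel. Re (f x) = a x"
    using completion_ex_borel_measurable_real[OF re] by auto
  obtain b where b: "b \<in> borel_measurable borel" "AE x in lborel. Im (f x) = b x"
    using completion_ex_borel_measurable_real[OF im] by auto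
  show thesis
  proof (rule that[of "\<lambda>x. complex_of_real (a x) + \<i> * complex_of_real (b x)"])
    show "(\<lambda>x. complex_of_real (a x) + \<i> * complex_of_real (b x)) \<in> borel_measurable borel"
      using a(1) b(1) by measurable
    show "AE x in lborel. f x = complex_of_real (a x) + \<i> * complex_of_real (b x)"
      using a(2) b(2) by eventually_elim (simp add: complex_eq_iff)
  qed
qed

lemma modular_cong_AE:
  assumes "AE x in lborel. f x = h x"
  shows "modular p f = modular p h"
  unfolding modular_def nn_integral_completion
  by (rule nn_integral_cong_AE) (use assms in eventually_elim, simp)

lemma norm_var_cong_AE:
  assumes ae: "AE x in lborel. f x = h x"
  shows "norm_var p f = norm_var p h"
proof -
  have "modular p (\<lambda>y. f y / complex_of_real \<eta>) = modular p (\<lambda>y. h y / complex_of_real \<eta>)" for \<eta>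
    by (rule modular_cong_AE) (use ae in eventually_elim, simp)
  then show ?thesis by (simp add: norm_var_def)
qed

lemma Lp_var_cong_AE:
  assumes ae: "AE x in lborel. f x = h x" and "f \<in> Lp_var p" and h: "h \<in> borel_measurable lebesgue"
  shows "h \<in> Lp_var p"
proof -
  have "modular p (\<lambda>y. f y / complex_of_real \<eta>) = modular p (\<lambda>y. h y / complex_of_real \<eta>)" for \<eta>
    by (rule modular_cong_AE) (use ae in eventually_elim, simp)
  then show ?thesis using assms by (simp add: Lp_var_def)
qed

lemma lebesgue_measurable_shift:
  assumes "f \<in> borel_measurable lebesgue" shows "(\<lambda>t. f (x + t :: real)) \<in> borel_measurable lebesgue"
  using measurable_compose[OF lebesgue_affine_measurable[of "\<lambda>_. 1" x] assms] by simp

lemma AE_lborel_shift: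
  assumes "AE y in lborel. Q (y :: real)" shows "AE t in lborel. Q (x + t)"
proof -
  obtain N where N: "N \<in> null_sets lborel" "{y \<in> space lborel. \<not> Q y} \<subseteq> N" using assms by (auto elim!: AE_E simp: null_sets_def)
  have "AE y in lborel. y \<notin> N" by (rule AE_not_in[OF N(1)])
  moreover have [measurable]: "N \<in> sets borel" using N(1) by auto
  ultimately have "AE t in lborel. x + 1 * t \<notin> N"
    by (intro AE_borel_affine) auto
  then show ?thesis by eventually_elim (use N(2) in auto)
qed

lemma steklov_cong_AE:
  assumes f: "f \<in> borel_measurable lebesgue" and f0[measurable]: "f0 \<in> borel_measurable borel" and ae: "AE x in lborel. f x = f0 x"
  shows "steklov \<delta> f x = steklov \<delta> f0 x"
proof -
  have "(LINT t:{0..\<delta>}|lebesgue. f (x + t)) = (LINT t:{0..\<delta>}|lebesgue. f0 (x + t))"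
    unfolding set_lebesgue_integral_def
  proof (rule integral_cong_AE)
    have "(\<lambda>t. f (x + t)) \<in> borel_measurable lebesgue" by (rule lebesgue_measurable_shift[OF f])
    then show "(\<lambda>t. indicat_real {0..\<delta>} t *\<^sub>R f (x + t)) \<in> borel_measurable lebesgue"
      by (intro borel_measurable_scaleR[OF measurable_completion]) simp_all
    show "(\<lambda>t. indicat_real {0..\<delta>} t *\<^sub>R f0 (x + t)) \<in> borel_measurable lebesgue"
      by (rule measurable_completion) simp
    have "AE t in lebesgue. f (x + t) = f0 (x + t)" using AE_lborel_shift[OF ae] by (rule AE_completion)
    then show "AE t in lebesgue. indicat_real {0..\<delta>} t *\<^sub>R f (x + t) = indicat_real {0..\<delta>} t *\<^sub>R f0 (x + t)"
      by eventually_elim simp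
  qed
  then show ?thesis by (simp add: steklov_def)
qed

lemma bernstein_D_cong_AE:
  assumes f[measurable]: "f \<in> borel_measurable lebesgue" and f0[measurable]: "f0 \<in> borel_measurable borel" and ae: "AE x in lborel. f x = f0 x"
  shows "bernstein_D r \<sigma> k f x = bernstein_D r \<sigma> k f0 x"
proof -
  have G: "(\<lambda>u. complex_of_real (bernstein_G \<sigma> r k (u - x))) \<in> borel_measurable lebesgue"
    by (rule measurable_completion) simp
  have "(LINT u|lebesgue. f u * complex_of_real (bernstein_G \<sigma> r k (u - x))) = (LINT u|lebesgue. f0 u * complex_of_real (bernstein_G \<sigma> r k (u - x)))"
  proof (rule integral_cong_AE)
    show "(\<lambda>u. f u * complex_of_real (bernstein_G \<sigma> r k (u - x))) \<in> borel_measurable lebesgue"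
      by (rule borel_measurable_times[OF f G])
    show "(\<lambda>u. f0 u * complex_of_real (bernstein_G \<sigma> r k (u - x))) \<in> borel_measurable lebesgue"
      by (rule measurable_completion) simp
    show "AE u in lebesgue. f u * complex_of_real (bernstein_G \<sigma> r k (u - x)) = f0 u * complex_of_real (bernstein_G \<sigma> r k (u - x))"
      using AE_completion[OF ae] by eventually_elim simp
  qed
  then show ?thesis by (simp add: bernstein_D_def)
qed

lemma steklov_defect_iterate_cong_AE:
  assumes f: "f \<in> borel_measurable lebesgue" and f0: "f0 \<in> borel_measurable borel" and ae: "AE x in lborel. f x = f0 x"
  shows "(steklov_defect \<delta> ^^ k) f \<in> borel_measurable lebesgue \<and> (AE x in lborel. (steklov_defect \<delta> ^^ k) f x = (steklov_defect \<delta> ^^ k) f0 x)"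
proof (induction k)
  case (Suc k)
  let ?h = "(steklov_defect \<delta> ^^ k) f" and ?b = "(steklov_defect \<delta> ^^ k) f0"
  have h0: "?b \<in> borel_measurable borel" by (rule steklov_defect_iterate_borel[OF f0])
  have eq: "steklov_defect \<delta> ?h = (\<lambda>x. ?h x - steklov \<delta> ?b x)"
    using steklov_cong_AE[of ?h ?b] Suc h0 by (auto simp: steklov_defect_def fun_eq_iff)
  have S: "steklov \<delta> ?b \<in> borel_measurable lebesgue" using steklov_borel[OF h0] by (intro measurable_completion) simp
  have "(\<lambda>x. ?h x - steklov \<delta> ?b x) \<in> borel_measurable lebesgue"
    by (rule borel_measurable_diff[OF Suc[THEN conjunct1] S])
  then have "steklov_defect \<delta> ?h \<in> borel_measurable lebesgue" by (simp only: eq)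
  moreover have "AE x in lborel. steklov_defect \<delta> ?h x = steklov_defect \<delta> ?b x"
    unfolding eq using Suc[THEN conjunct2] by eventually_elim (simp add: steklov_defect_def[of _ ?b])
  ultimately show ?case by simp
qed (use f ae in simp)

context log_hoelder_exponent
begin

text \<open>
  Since \<open>p \<ge> 1\<close>, a nonnegative number is at most 1 plus its p-th power, and the
  decay kernel is both integrable and bounded.
\<close>
lemma Lp_var_kernel_mean_finite:
  assumes f: "f \<in> Lp_var p" and [measurable]: "f \<in> borel_measurable borel" and R: "0 < R"
  shows "kernel_mean R (ennorm f) x < \<infinity>"
proof -
  obtain \<mu> where \<mu>: "0 < \<mu>" and m: "modular p (\<lambda>y. f y / complex_of_real \<mu>) < \<infinity>"
    using f by (auto simp: Lp_var_def)
  have "kernel_mean R (ennorm f) x \<le> 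
    (\<integral>\<^sup>+y. ennreal \<mu> * (ennreal (decay_kernel (y / R) / R) + ennreal (1 / R) * ennreal (norm (f (x + y) / complex_of_real \<mu>) powr p (x + y))) \<partial>lborel)"
    unfolding kernel_mean_def
  proof (rule nn_integral_mono)
    fix y
    let ?a = "norm (f (x + y) / complex_of_real \<mu>)" and ?k = "decay_kernel (y / R)"
    have "?a \<le> 1 + ?a powr p (x + y)"
    proof (cases "?a \<le> 1")
      case False
      then have "?a powr 1 \<le> ?a powr p (x + y)" using p_ge_1[of "x + y"] by (intro powr_mono) auto
      then show ?thesis using False by simp
    qed (simp add: add_increasing2)
    then have "?k * ?a \<le> ?k * (1 + ?a powr p (x + y))" by (intro mult_left_mono) auto
    also have "\<dots> \<le> ?k + 1 * ?a powr p (x + y)"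
      unfolding distrib_left by (intro add_mono mult_right_mono decay_kernel_le_1) auto
    finally have "?k * norm (f (x + y)) \<le> \<mu> * (?k + ?a powr p (x + y))"
      using \<mu> by (simp add: norm_divide field_simps)
    then have "?k / R * norm (f (x + y)) \<le> \<mu> * (?k / R + 1 / R * ?a powr p (x + y))"
      using R divide_right_mono[of "?k * norm (f (x + y))" "\<mu> * (?k + ?a powr p (x + y))" R] by (simp add: field_simps)
    then show "ennreal (?k / R) * ennreal (norm (f (x + y))) \<le> ennreal \<mu> * (ennreal (?k / R) + ennreal (1 / R) * ennreal (?a powr p (x + y)))"
      using \<mu> R by (simp add: ennreal_mult[symmetric] ennreal_plus[symmetric] ennreal_leI del: ennreal_plus)
  qed
  also have "\<dots> = ennreal \<mu> * ((\<integral>\<^sup>+y. ennreal (decay_kernel (y / R) / R) \<partial>lborel) + ennreal (1 / R) * (\<integral>\<^sup>+y. ennreal (norm (f (x + y) / complex_of_real \<mu>) powr p (x + y)) \<partial>lborel))"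
    by (simp add: nn_integral_cmult nn_integral_add)
  also have "(\<integral>\<^sup>+y. ennreal (norm (f (x + y) / complex_of_real \<mu>) powr p (x + y)) \<partial>lborel) = modular p (\<lambda>y. f y / complex_of_real \<mu>)"
    unfolding modular_def nn_integral_completion
    using nn_integral_translation[of "\<lambda>y. ennreal (norm (f y / complex_of_real \<mu>) powr p y)" x] by (simp add: add.commute)
  also have "ennreal \<mu> * ((\<integral>\<^sup>+y. ennreal (decay_kernel (y / R) / R) \<partial>lborel) + ennreal (1 / R) * modular p (\<lambda>y. f y / complex_of_real \<mu>)) < \<infinity>"
    using m scaled_kernel_mass[OF R] by (simp add: ennreal_mult_less_top)
  finally show ?thesis .
qed

lemma tempered_rescaled:
  assumes f: "f \<in> Lp_var p" and f0[measurable]: "f \<in> borel_measurable borel" and \<sigma>: "0 < \<sigma>"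
  shows "tempered (\<lambda>y. f (y / \<sigma>))"
  using kernel_mean_scale[of "\<lambda>y. ennreal (norm (f y))" \<sigma> 0] Lp_var_kernel_mean_finite[OF f f0, of "1 / \<sigma>" 0] \<sigma>
  by (simp add: tempered_def)

text \<open>
  The Steklov mean is dominated by the decay kernel of the same scale.
\<close>
lemma steklov_defect_Lp_var:
  assumes f: "f \<in> Lp_var p" and f0[measurable]: "f \<in> borel_measurable borel" and \<sigma>: "0 < \<sigma>"
  shows "steklov_defect (1 / \<sigma>) f \<in> Lp_var p"
proof -
  let ?B = "2 powr (3/2) :: real"
  have B1: "1 \<le> ?B" by (simp add: ge_one_powr_ge_zero)
  have dom: "ennreal (norm (steklov_defect (1 / \<sigma>) f x)) \<le> ennreal ?B * (ennreal (norm (f x)) +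
      kernel_mean (1 / \<sigma>) (ennorm f) x)" for x
  proof -
    have "norm (steklov_defect (1 / \<sigma>) f x) \<le> norm (f x) + norm (steklov (1 / \<sigma>) f x)"
      unfolding steklov_defect_def by (rule norm_triangle_ineq4)
    then have "ennreal (norm (steklov_defect (1 / \<sigma>) f x)) \<le> ennreal 1 * ennreal (norm (f x)) + ennreal (norm (steklov (1 / \<sigma>) f x))"
      by (simp flip: ennreal_plus)
    also have "ennreal (norm (steklov (1 / \<sigma>) f x)) \<le> ennreal ?B * kernel_mean (1 / \<sigma>) (ennorm f) x"
      unfolding steklov_scale[OF \<sigma> f0] using norm_unit_mean_le[OF tempered_rescaled[OF f f0 \<sigma>], of "\<sigma> * x"]
        kernel_mean_scale[of "\<lambda>y. ennreal (norm (f y))" \<sigma> x] \<sigma> by simp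
    also have "ennreal 1 * ennreal (norm (f x)) \<le> ennreal ?B * ennreal (norm (f x))"
      by (intro mult_right_mono ennreal_leI B1) auto
    finally show ?thesis by (simp add: distrib_left add_mono)
  qed
  have meas: "steklov_defect (1 / \<sigma>) f \<in> borel_measurable lebesgue"
    by (rule measurable_completion) simp
  have pos: "0 < ?B" "0 < 1 / \<sigma>" using \<sigma> by auto
  show ?thesis by (rule norm_var_bound(1)[OF pos f0 f meas AE_I2[OF dom]])
qed

lemma steklov_defect_iterate_Lp_var:
  assumes f: "f \<in> Lp_var p" and f0: "f \<in> borel_measurable borel" and \<sigma>: "0 < \<sigma>"
  shows "(steklov_defect (1 / \<sigma>) ^^ k) f \<in> Lp_var p"
  by (induction k) (use f steklov_defect_Lp_var[OF _ steklov_defect_iterate_borel[OF f0] \<sigma>] in auto)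

text \<open>
  For a Borel representative, the pointwise bound at scale 1, transported by dilation, is of the form
  required by \<open>norm_var_bound\<close> with \<open>\<phi>\<close> the k-th Steklov defect. The
  constant depends neither on \<open>\<sigma>\<close> nor on f.
\<close>
lemma bernstein_approximation:
  assumes r: "1 \<le> r" and kr: "k + 2 \<le> 2 * r"
  shows "\<exists>C>0. \<forall>\<sigma>>0. \<forall>f\<in>Lp_var p.
           (\<lambda>x. f x - bernstein_D r \<sigma> k f x) \<in> Lp_var p \<and>
           norm_var p (\<lambda>x. f x - bernstein_D r \<sigma> k f x) \<le> C * Omega_var p k f (1 / \<sigma>)"
proof -
  obtain B where B: "0 < B" "\<And>f x. tempered f \<Longrightarrow> ennreal (norm (f x - bernstein_D r 1 k f x)) \<le>
    ennreal B * (ennreal (norm ((mean_defect ^^ k) f x)) + kernel_mean 1 (ennorm ((mean_defect ^^ k) f)) x)"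
    using bernstein_D_pointwise_bound[OF r kr] by blast
  show ?thesis
  proof (intro exI[of _ "norm_const B"] conjI[OF norm_const_pos[OF B(1)]] allI impI ballI)
    fix \<sigma> :: real and f assume \<sigma>: "0 < \<sigma>" and f: "f \<in> Lp_var p"
    have fm: "f \<in> borel_measurable lebesgue" using f by (simp add: Lp_var_def)
    obtain f0 where f0[measurable]: "f0 \<in> borel_measurable borel" and ae: "AE x in lborel. f x = f0 x"
      using lebesgue_borel_representative[OF fm] by blast
    have f0L: "f0 \<in> Lp_var p" by (rule Lp_var_cong_AE[OF ae f]) (rule measurable_completion, simp)
    define \<phi> where "\<phi> = (steklov_defect (1 / \<sigma>) ^^ k) f0"
    have \<phi>[measurable]: "\<phi> \<in> borel_measurable borel" unfolding \<phi>_def by (rule steklov_defect_iterate_borel[OF f0])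
    have \<phi>L: "\<phi> \<in> Lp_var p" unfolding \<phi>_def by (rule steklov_defect_iterate_Lp_var[OF f0L f0 \<sigma>])
    \<comment> \<open>The norm does not distinguish the defects of f and of its Borel representative.\<close>
    have \<Omega>: "Omega_var p k f (1 / \<sigma>) = norm_var p \<phi>"
      unfolding Omega_var_eq \<phi>_def
      by (rule norm_var_cong_AE) (use steklov_defect_iterate_cong_AE[OF fm f0 ae] in blast)
    have bound: "ennreal (norm (f0 x - bernstein_D r \<sigma> k f0 x)) \<le> ennreal B * (ennreal (norm (\<phi> x)) +
       kernel_mean (1 / \<sigma>) (ennorm \<phi>) x)" for x
    proof -
      have it: "(mean_defect ^^ k) (\<lambda>y. f0 (y / \<sigma>)) = (\<lambda>y. \<phi> (y / \<sigma>))"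
        unfolding \<phi>_def by (rule steklov_defect_iterate_scale[OF \<sigma> f0])
      have "ennreal (norm (f0 x - bernstein_D r \<sigma> k f0 x)) \<le>
        ennreal B * (ennreal (norm (\<phi> x)) + kernel_mean 1 (\<lambda>y. ennreal (norm (\<phi> (y / \<sigma>)))) (\<sigma> * x))"
        using B(2)[OF tempered_rescaled[OF f0L f0 \<sigma>], of "\<sigma> * x"] \<sigma>
        unfolding it bernstein_D_scale[OF \<sigma> f0] by simp
      also have "kernel_mean 1 (\<lambda>y. ennreal (norm (\<phi> (y / \<sigma>)))) (\<sigma> * x) = kernel_mean (1 / \<sigma>) (ennorm \<phi>) x"
        by (rule kernel_mean_scale[OF _ \<sigma>]) simp
      finally show ?thesis .
    qed
    have D: "bernstein_D r \<sigma> k f x = bernstein_D r \<sigma> k f0 x" for x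
      by (rule bernstein_D_cong_AE[OF fm f0 ae])
    have "bernstein_D r \<sigma> k f0 \<in> borel_measurable lebesgue" by (rule measurable_completion) simp
    then have H: "(\<lambda>x. f x - bernstein_D r \<sigma> k f x) \<in> borel_measurable lebesgue"
      unfolding D by (intro borel_measurable_diff fm)
    have "AE x in lebesgue. ennreal (norm (f x - bernstein_D r \<sigma> k f x)) \<le> ennreal B * (ennreal (norm (\<phi> x)) +
       kernel_mean (1 / \<sigma>) (ennorm \<phi>) x)"
      using AE_completion[OF ae]
    proof eventually_elim
      case (elim x)
      show ?case unfolding D elim by (rule bound)
    qed
    from norm_var_bound[OF B(1) _ \<phi> \<phi>L H this] \<sigma>
    show "(\<lambda>x. f x - bernstein_D r \<sigma> k f x) \<in> Lp_var p \<and>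
      norm_var p (\<lambda>x. f x - bernstein_D r \<sigma> k f x) \<le> norm_const B * Omega_var p k f (1 / \<sigma>)"
      unfolding \<Omega> by simp
  qed
qed

end

lemma log_hoelder_continuous:
  fixes p :: "real \<Rightarrow> real"
  assumes c: "0 < c" and log: "\<And>x y. \<bar>p x - p y\<bar> * ln (exp 1 + 1 / \<bar>x - y\<bar>) \<le> c"
  shows "continuous_on UNIV p"
  unfolding continuous_on_iff
proof (intro ballI allI impI)
  fix x e :: real assume e: "0 < e"
  define d where "d = exp (- (c / e))"
  have "dist (p y) (p x) < e" if "dist y x < d" for y
  proof (cases "x = y")
    case False
    then have xy: "0 < \<bar>y - x\<bar>" "\<bar>y - x\<bar> < d" using that by (auto simp: dist_real_def)
    have "exp (c / e) = 1 / d" by (simp add: d_def exp_minus inverse_eq_divide)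
    also have "\<dots> < 1 / \<bar>y - x\<bar>" using xy by (simp add: d_def frac_less2)
    also have "\<dots> < exp 1 + 1 / \<bar>y - x\<bar>" by simp
    finally have "ln (exp (c / e)) < ln (exp 1 + 1 / \<bar>y - x\<bar>)" by (subst ln_less_cancel_iff) (auto simp: add_pos_nonneg)
    then have "c < e * ln (exp 1 + 1 / \<bar>y - x\<bar>)" using e by (simp add: field_simps)
    with log[of y x] have "\<bar>p y - p x\<bar> * ln (exp 1 + 1 / \<bar>y - x\<bar>) < e * ln (exp 1 + 1 / \<bar>y - x\<bar>)" by linarith
    moreover have "0 < ln (exp 1 + 1 / \<bar>y - x\<bar>)"
    proof (rule ln_gt_zero)
      have "1 < exp (1::real)" by simp
      moreover have "0 \<le> 1 / \<bar>y - x\<bar>" by simp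
      ultimately show "1 < exp 1 + 1 / \<bar>y - x\<bar>" by linarith
    qed
    ultimately show ?thesis by (simp add: dist_real_def)
  qed (use e in simp)
  then show "\<exists>d>0. \<forall>x'\<in>UNIV. dist x' x < d \<longrightarrow> dist (p x') (p x) < e"
    by (intro exI[of _ d]) (auto simp: d_def)
qed

theorem theorem5p11:
  fixes p :: "real \<Rightarrow> real" and k r :: nat
  assumes "p \<in> log_exponent_class"
    and "k \<ge> 1"
    and "r = nat \<lceil>(real k + 2) / 2\<rceil>"
  shows "\<exists>C>0. \<forall>\<sigma>>0. \<forall>f\<in>Lp_var p.
           (\<lambda>x. f x - bernstein_D r \<sigma> k f x) \<in> Lp_var p \<and>
           norm_var p (\<lambda>x. f x - bernstein_D r \<sigma> k f x) \<le> C * Omega_var p k f (1 / \<sigma>)"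
proof -
  obtain c1 c2 c3 where c: "0 < c1" "0 < c2"
    and local_log: "\<And>x y. \<bar>p x - p y\<bar> * ln (exp 1 + 1 / \<bar>x - y\<bar>) \<le> c1"
    and decay_log: "\<And>x. \<bar>p x - c3\<bar> * ln (exp 1 + \<bar>x\<bar>) \<le> c2"
    using assms(1) unfolding log_exponent_class_def by blast
  interpret log_hoelder_exponent p c1 c2 c3
  proof
    show "p \<in> borel_measurable borel"
      by (rule borel_measurable_continuous_onI[OF log_hoelder_continuous[OF c(1) local_log]])
    show "1 \<le> p x" for x
      using assms(1) by (auto simp: log_exponent_class_def exponent_class_def)
  qed (use c local_log decay_log in auto)
  have "(real k + 2) / 2 \<le> real r"
    unfolding assms(3) by (rule real_nat_ceiling_ge)
  then have "real (k + 2) \<le> real (2 * r)" by simp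
  then have "k + 2 \<le> 2 * r" by (simp only: of_nat_le_iff)
  moreover from this have "1 \<le> r" by linarith
  ultimately show ?thesis by (intro bernstein_approximation)
qed

end
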